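(* Let $d,n\in\mathbb{N}_{\geq1}$, $s\in\mathbb{N}_{\geq0}$, $0<\lambda\leq1$, $\gamma:=s+\lambda$. For any $0<\epsilon<1$ and any $\boldsymbol{f}:[0,1]^{d\times n}\to\mathbb{R}^{d\times n}$ whose components $f_{pq}$ all belong to $C^{s,\lambda}([0,1]^{d\times n})$, there exists a Transformer $\boldsymbol{T}:\mathbb{R}^{d\times n}\to\mathbb{R}^{d\times n}$ of length $n$ with size \begin{align*} &L_0=4,\quad W_0=\mathcal{O}(\epsilon^{-1/\gamma});\\ &H_1=(3d+1)3^{dn}\binom{s+dn-1}{dn-1},\quad S_1=\max\{dn,3\};\\ &L_l=3,\quad W_l=d3^{dn}\binom{s+dn-1}{dn-1}(4n+11),\quad l=1,\dots,n-1;\\ &H_l=d3^{dn+1}\binom{s+dn-1}{dn-1},\quad S_l=3,\quad l=2,\dots,n;\\ &L_n=\mathcal{O}(\log\tfrac{1}{\epsilon}),\quad W_n=\mathcal{O}(\epsilon^{-dn/\gamma}) \end{align*} and dimension vector $\big(d,\ d+n+1+3^n,\ (2dn+5d)3^{dn}\binom{s+dn-1}{dn-1}\boldsymbol 1_{1\times n},\ d\big)$ such that for all $p\in[d],q\in[n]$, $$\|T_{pq}-f_{pq}\|_{L^\infty([0,1]^{d\times n})}\leq\epsilon.$$ Furthermore, the weight bounds of $\boldsymbol T$ are $B_{EB}=\mathcal{O}(1)$, $B_{FF}=\mathcal{O}(\epsilon^{-\max\{(6dn+2)/\gamma,1/\lambda\}})$, $B_{SA}=\mathcal{O}(\log\frac1\epsilon)$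 and its numbers of parameters are $M_{EB}=\mathcal{O}(1)$, $M_{FF}=\mathcal{O}(\epsilon^{-dn/\gamma})$, $M_{SA}=\mathcal{O}(1)$, where all $\mathcal{O}(\cdot)$ constants are independent of $\epsilon$.
   Context: Hölder space: for $\Omega\subset\mathbb{R}^D$, multi-indices $\boldsymbol{\mu}\in\mathbb{N}_{\geq0}^D$, $|\boldsymbol{\mu}|=\sum\mu_i$, $D^{\boldsymbol\mu}f$ the partial derivative; $\|f\|_{C^{s,\lambda}(\Omega)}:=\max\{\max_{|\boldsymbol\mu|\le s}\sup_{\Omega}|D^{\boldsymbol\mu}f|,\ \max_{|\boldsymbol\mu|=s}\sup_{x\neq y\in\Omega}|D^{\boldsymbol\mu}f(x)-D^{\boldsymbol\mu}f(y)|/\|x-y\|_2^\lambda\}$, and $C^{s,\lambda}(\Omega)$ is the set of functions with finite norm ($[0,1]^{d\times n}$ identified with $[0,1]^{dn}$). $[m]=\{1,\dots,m\}$. Transformers: $\sigma_R(x)=\max\{x,0\}$ entrywise; $\sigma_S$ is the column-wise softmax, $[\sigma_S(\boldsymbol x)]_i=e^{x_i}/\sum_{j=1}^n e^{x_j}$ applied to each column. A ReLU FNN $f:\mathbb{R}^a\to\mathbb{R}^b$ of depth $L$ and width $W$: $f_0=x$, $f_l=\sigma_R(W_lf_{l-1}+b_l)$ for $1\le l\le L-1$, $f=W_Lf_{L-1}+b_L$, with $W_1\in\mathbb{R}^{W\times a}$, $W_l\in\mathbb{R}^{W\times W}$, $W_L\in\mathbb{R}^{b\times W}$. The feedforward block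 generated by $f$ applies $f$ to each column of a matrix in $\mathbb{R}^{a\times n}$. A self-attention layer $\mathcal F_{SA}:\mathbb{R}^{D\times n}\to\mathbb{R}^{D\times n}$ with head number $H$, head size $S$: $\mathcal F_{SA}(X)=X+\sum_{h=1}^H W_O^{(h)}W_V^{(h)}X\sigma_S(X^\top W_K^{(h)\top}W_Q^{(h)}X)$, $W_O^{(h)}\in\mathbb{R}^{D\times S}$, $W_V^{(h)},W_K^{(h)},W_Q^{(h)}\in\mathbb{R}^{S\times D}$. An embedding layer is $\mathcal F_{EB}(X)=W_{EB}X+B_{EB}$. A Transformer of length $K$ is $\mathcal F_{FF}^{(K)}\circ\mathcal F_{SA}^{(K)}\circ\cdots\circ\mathcal F_{FF}^{(1)}\circ\mathcal F_{SA}^{(1)}\circ\mathcal F_{FF}^{(0)}\circ\mathcal F_{EB}$ with $\mathcal F_{EB}:\mathbb{R}^{d_{in}\times n}\to\mathbb{R}^{d_0\times n}$, $\mathcal F_{FF}^{(k)}:\mathbb{R}^{d_k\times n}\to\mathbb{R}^{d_{k+1}\times n}$ ($d_{K+1}:=d_{out}$), $\mathcal F_{SA}^{(k)}$ acting on $\mathbb{R}^{d_k\times n}$. Its size is $\{(L_0,W_0),(H_1,S_1),(L_1,W_1),\dots,(H_K,S_K),(L_K,W_K)\}$ (depths/widths of feedforward blocks, head numbers/sizes of attention layers); its dimension vector is $(d_{in},d_0,\dots,d_K,d_{out})$. $B_{EB},B_{FF},B_{SA}$ bound the absolute values of the parameters of the embedding layer, all feedforward blocks, all self-attention layers; $M_{EB},M_{FF},M_{SA}$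 are the corresponding numbers of parameters. *)

theory Defs
  imports "HOL-Analysis.Analysis"
begin

text \<open>Matrices are represented as functions nat => nat => real (entry (i,j), 0-indexed),
  column vectors as nat => real.  Only the entries inside the declared shape are ever read.\<close>

type_synonym mat = "nat \<Rightarrow> nat \<Rightarrow> real"
type_synonym vec = "nat \<Rightarrow> real"

text \<open>Points of [0,1]^(d x n): entries in [0,1] inside the d x n shape, 0 outside (canonical rep.).\<close>
definition cube :: "nat \<Rightarrow> nat \<Rightarrow> mat set" where
  "cube d n = {X. (\<forall>i j. i < d \<and> j < n \<longrightarrow> 0 \<le> X i j \<and> X i j \<le> 1)
                 \<and> (\<forall>i j. \<not> (i < d \<and> j < n) \<longrightarrow> X i j = 0)}"

definition upd :: "mat \<Rightarrow> nat \<Rightarrow> nat \<Rightarrow> real \<Rightarrow> mat" where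
  "upd X i j t = X(i := (X i)(j := t))"

definition mdist :: "nat \<Rightarrow> nat \<Rightarrow> mat \<Rightarrow> mat \<Rightarrow> real" where
  "mdist d n X Y = sqrt (\<Sum>i<d. \<Sum>j<n. (X i j - Y i j)\<^sup>2)"

text \<open>Partial derivative in the coordinate (i,j), taken within the cube (one-sided at the boundary).\<close>
definition pdiff :: "nat \<Rightarrow> nat \<Rightarrow> (mat \<Rightarrow> real) \<Rightarrow> mat \<Rightarrow> real" where
  "pdiff i j g X = vector_derivative (\<lambda>t. g (upd X i j t)) (at (X i j) within {0..1})"

fun dlist :: "(nat \<times> nat) list \<Rightarrow> (mat \<Rightarrow> real) \<Rightarrow> mat \<Rightarrow> real" where
  "dlist [] g = g"
| "dlist ((i,j) # cs) g = pdiff i j (dlist cs g)"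

fun dexists :: "nat \<Rightarrow> nat \<Rightarrow> (nat \<times> nat) list \<Rightarrow> (mat \<Rightarrow> real) \<Rightarrow> bool" where
  "dexists d n [] g = True"
| "dexists d n ((i,j) # cs) g = (dexists d n cs g \<and>
     (\<forall>X\<in>cube d n. (\<lambda>t. dlist cs g (upd X i j t)) differentiable (at (X i j) within {0..1})))"

definition mi_abs :: "nat \<Rightarrow> nat \<Rightarrow> (nat \<Rightarrow> nat \<Rightarrow> nat) \<Rightarrow> nat" where
  "mi_abs d n mu = (\<Sum>i<d. \<Sum>j<n. mu i j)"

definition mi_list :: "nat \<Rightarrow> nat \<Rightarrow> (nat \<Rightarrow> nat \<Rightarrow> nat) \<Rightarrow> (nat \<times> nat) list" where
  "mi_list d n mu = concat (map (\<lambda>k. replicate (mu (k div n) (k mod n)) (k div n, k mod n)) [0..<d*n])"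

definition Dmu :: "nat \<Rightarrow> nat \<Rightarrow> (nat \<Rightarrow> nat \<Rightarrow> nat) \<Rightarrow> (mat \<Rightarrow> real) \<Rightarrow> mat \<Rightarrow> real" where
  "Dmu d n mu g = dlist (mi_list d n mu) g"

definition holder :: "nat \<Rightarrow> nat \<Rightarrow> nat \<Rightarrow> real \<Rightarrow> (mat \<Rightarrow> real) \<Rightarrow> bool" where
  "holder d n s lam g \<longleftrightarrow>
     (\<forall>mu. mi_abs d n mu \<le> s \<longrightarrow> dexists d n (mi_list d n mu) g) \<and>
     (\<exists>M. (\<forall>mu. mi_abs d n mu \<le> s \<longrightarrow> (\<forall>X\<in>cube d n. \<bar>Dmu d n mu g X\<bar> \<le> M)) \<and>
          (\<forall>mu. mi_abs d n mu = s \<longrightarrow> (\<forall>X\<in>cube d n. \<forall>Y\<in>cube d n. X \<noteq> Y \<longrightarrow>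
              \<bar>Dmu d n mu g X - Dmu d n mu g Y\<bar> \<le> M * mdist d n X Y powr lam)))"

definition relu :: "vec \<Rightarrow> vec" where
  "relu x = (\<lambda>i. max (x i) 0)"

definition aff :: "nat \<Rightarrow> mat \<Rightarrow> vec \<Rightarrow> vec \<Rightarrow> vec" where
  "aff m A c x = (\<lambda>i. (\<Sum>j<m. A i j * x j) + c i)"

fun fnn_run :: "nat \<Rightarrow> nat \<Rightarrow> (mat \<times> vec) list \<Rightarrow> vec \<Rightarrow> vec" where
  "fnn_run m w [] x = x"
| "fnn_run m w [(A, c)] x = aff m A c x"
| "fnn_run m w ((A, c) # l # ls) x = fnn_run w w (l # ls) (relu (aff m A c x))"

definition lay_in :: "nat \<Rightarrow> nat \<Rightarrow> nat \<Rightarrow> nat" where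
  "lay_in a w l = (if l = 0 then a else w)"
definition lay_out :: "nat \<Rightarrow> nat \<Rightarrow> nat \<Rightarrow> nat \<Rightarrow> nat" where
  "lay_out b w L l = (if l = L - 1 then b else w)"

definition ff_block :: "nat \<Rightarrow> nat \<Rightarrow> (mat \<times> vec) list \<Rightarrow> mat \<Rightarrow> mat" where
  "ff_block a w layers X = (\<lambda>i j. fnn_run a w layers (\<lambda>k. X k j) i)"

text \<open>A head (W_O, W_V, W_K, W_Q), W_O : D x S, the others S x D.\<close>
type_synonym head = "mat \<times> mat \<times> mat \<times> mat"

definition att_score :: "nat \<Rightarrow> nat \<Rightarrow> mat \<Rightarrow> mat \<Rightarrow> mat \<Rightarrow> nat \<Rightarrow> nat \<Rightarrow> real" where
  "att_score D S WK WQ X i j =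
     (\<Sum>r<S. (\<Sum>k<D. WK r k * X k i) * (\<Sum>k<D. WQ r k * X k j))"

definition softmax_col :: "nat \<Rightarrow> mat \<Rightarrow> mat" where
  "softmax_col n A = (\<lambda>i j. exp (A i j) / (\<Sum>i'<n. exp (A i' j)))"

definition head_out :: "nat \<Rightarrow> nat \<Rightarrow> nat \<Rightarrow> head \<Rightarrow> mat \<Rightarrow> mat" where
  "head_out D S n h X = (case h of (WO, WV, WK, WQ) \<Rightarrow>
     (\<lambda>p j. \<Sum>i<n. (\<Sum>r<S. WO p r * (\<Sum>k<D. WV r k * X k i))
                    * softmax_col n (att_score D S WK WQ X) i j))"

definition sa_layer :: "nat \<Rightarrow> nat \<Rightarrow> nat \<Rightarrow> head list \<Rightarrow> mat \<Rightarrow> mat" where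
  "sa_layer D S n hs X = (\<lambda>p j. X p j + (\<Sum>h\<leftarrow>hs. head_out D S n h X p j))"

definition emb_layer :: "nat \<Rightarrow> mat \<Rightarrow> mat \<Rightarrow> mat \<Rightarrow> mat" where
  "emb_layer din WE BE X = (\<lambda>i j. (\<Sum>k<din. WE i k * X k j) + BE i j)"

text \<open>A Transformer of length K = length tf_sa.
  tf_dims = [d_in, d_0, ..., d_K, d_out];  tf_ff = FF blocks 0..K (layer lists);
  tf_ffw = widths W_0..W_K;  tf_sa = attention layers 1..K (lists of heads);
  tf_hs = head sizes S_1..S_K.\<close>
record transformer =
  tf_dims :: "nat list"
  tf_WE :: mat
  tf_BE :: mat
  tf_ff :: "(mat \<times> vec) list list"
  tf_ffw :: "nat list"
  tf_sa :: "head list list"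
  tf_hs :: "nat list"

definition tf_len :: "transformer \<Rightarrow> nat" where
  "tf_len T = length (tf_sa T)"

definition tf_wf :: "transformer \<Rightarrow> bool" where
  "tf_wf T \<longleftrightarrow> length (tf_dims T) = tf_len T + 3 \<and> length (tf_ff T) = tf_len T + 1
     \<and> length (tf_ffw T) = tf_len T + 1 \<and> length (tf_hs T) = tf_len T
     \<and> (\<forall>k\<le>tf_len T. tf_ff T ! k \<noteq> [])"

definition tf_eval :: "nat \<Rightarrow> transformer \<Rightarrow> mat \<Rightarrow> mat" where
  "tf_eval n T X =
     fold (\<lambda>k Y. ff_block (tf_dims T ! (k+1)) (tf_ffw T ! k) (tf_ff T ! k)
                  (sa_layer (tf_dims T ! (k+1)) (tf_hs T ! (k-1)) n (tf_sa T ! (k-1)) Y))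
          [1..<tf_len T + 1]
          (ff_block (tf_dims T ! 1) (tf_ffw T ! 0) (tf_ff T ! 0)
             (emb_layer (tf_dims T ! 0) (tf_WE T) (tf_BE T) X))"

definition L_ff :: "transformer \<Rightarrow> nat \<Rightarrow> nat" where "L_ff T k = length (tf_ff T ! k)"
definition W_ff :: "transformer \<Rightarrow> nat \<Rightarrow> nat" where "W_ff T k = tf_ffw T ! k"
definition H_sa :: "transformer \<Rightarrow> nat \<Rightarrow> nat" where "H_sa T l = length (tf_sa T ! (l - 1))"
definition S_sa :: "transformer \<Rightarrow> nat \<Rightarrow> nat" where "S_sa T l = tf_hs T ! (l - 1)"

definition mat_entries :: "nat \<Rightarrow> nat \<Rightarrow> mat \<Rightarrow> real set" where
  "mat_entries r c A = {A i j |i j. i < r \<and> j < c}"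
definition vec_entries :: "nat \<Rightarrow> vec \<Rightarrow> real set" where
  "vec_entries r v = {v i |i. i < r}"
definition mat_nnz :: "nat \<Rightarrow> nat \<Rightarrow> mat \<Rightarrow> nat" where
  "mat_nnz r c A = card {(i, j). i < r \<and> j < c \<and> A i j \<noteq> 0}"
definition vec_nnz :: "nat \<Rightarrow> vec \<Rightarrow> nat" where
  "vec_nnz r v = card {i. i < r \<and> v i \<noteq> 0}"

definition fnn_params :: "nat \<Rightarrow> nat \<Rightarrow> nat \<Rightarrow> (mat \<times> vec) list \<Rightarrow> real set" where
  "fnn_params a b w ls = (\<Union>l<length ls.
      mat_entries (lay_out b w (length ls) l) (lay_in a w l) (fst (ls ! l))
      \<union> vec_entries (lay_out b w (length ls) l) (snd (ls ! l)))"
definition fnn_nnz :: "nat \<Rightarrow> nat \<Rightarrow> nat \<Rightarrow> (mat \<times> vec) list \<Rightarrow> nat" where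
  "fnn_nnz a b w ls = (\<Sum>l<length ls.
      mat_nnz (lay_out b w (length ls) l) (lay_in a w l) (fst (ls ! l))
      + vec_nnz (lay_out b w (length ls) l) (snd (ls ! l)))"

definition head_params :: "nat \<Rightarrow> nat \<Rightarrow> head \<Rightarrow> real set" where
  "head_params D S h = (case h of (WO, WV, WK, WQ) \<Rightarrow>
     mat_entries D S WO \<union> mat_entries S D WV \<union> mat_entries S D WK \<union> mat_entries S D WQ)"
definition head_nnz :: "nat \<Rightarrow> nat \<Rightarrow> head \<Rightarrow> nat" where
  "head_nnz D S h = (case h of (WO, WV, WK, WQ) \<Rightarrow>
     mat_nnz D S WO + mat_nnz S D WV + mat_nnz S D WK + mat_nnz S D WQ)"

definition EB_params :: "nat \<Rightarrow> transformer \<Rightarrow> real set" where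
  "EB_params n T = mat_entries (tf_dims T ! 1) (tf_dims T ! 0) (tf_WE T)
                   \<union> mat_entries (tf_dims T ! 1) n (tf_BE T)"
definition M_EB :: "nat \<Rightarrow> transformer \<Rightarrow> nat" where
  "M_EB n T = mat_nnz (tf_dims T ! 1) (tf_dims T ! 0) (tf_WE T)
              + mat_nnz (tf_dims T ! 1) n (tf_BE T)"

text \<open>FF block k maps d_k = dims!(k+1) to d_{k+1} = dims!(k+2).\<close>
definition FF_params :: "transformer \<Rightarrow> real set" where
  "FF_params T = (\<Union>k\<le>tf_len T. fnn_params (tf_dims T ! (k+1)) (tf_dims T ! (k+2))
                                   (tf_ffw T ! k) (tf_ff T ! k))"
definition M_FF :: "transformer \<Rightarrow> nat" where
  "M_FF T = (\<Sum>k\<le>tf_len T. fnn_nnz (tf_dims T ! (k+1)) (tf_dims T ! (k+2))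
                                   (tf_ffw T ! k) (tf_ff T ! k))"

text \<open>Attention layer k (1..K) acts on d_k = dims!(k+1) with head size hs!(k-1).\<close>
definition SA_params :: "transformer \<Rightarrow> real set" where
  "SA_params T = (\<Union>k\<in>{1..tf_len T}. \<Union>h\<in>set (tf_sa T ! (k-1)).
                    head_params (tf_dims T ! (k+1)) (tf_hs T ! (k-1)) h)"
definition M_SA :: "transformer \<Rightarrow> nat" where
  "M_SA T = (\<Sum>k\<in>{1..tf_len T}. \<Sum>h\<leftarrow>tf_sa T ! (k-1).
                    head_nnz (tf_dims T ! (k+1)) (tf_hs T ! (k-1)) h)"

end

theory Submission
  imports Defs
begin

text \<open>Column \<open>j\<close> receives its one-hot position through the embedding bias, so the first feedforward block can
  place its entries in coordinates that the other columns keep at zero. One head with vanishing query and key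
  matrices averages uniformly; it adds up the columns and thereby puts the whole input matrix, exactly, into
  every column. All other heads are zero, the intermediate blocks are identities on nonnegative data, and the
  statement becomes one about a single ReLU network in \<open>m = d n\<close> variables.

  With \<open>N \<approx> \<epsilon>\<^bsup>-1/\<gamma>\<^esup>\<close>, a function in \<open>C\<^bsup>s,\<lambda>\<^esup>\<close> is within \<open>O(N\<^bsup>-\<gamma>\<^esup>)\<close> of a polynomial on each cube of
  side \<open>1/N\<close>. These polynomials are glued by a product partition of unity with \<open>2\<^bsup>m\<^esup>\<close> colours. Within one colour
  the supports are separated, so a continuous staircase yields the exact index of the current cell on the support,
  and the coefficients are looked up as functions of that single integer. What remains is a bounded number of
  products of factors in \<open>[0,1]\<close>, computed to accuracy \<open>4\<^bsup>-k\<^esup>\<close> in depth \<open>O(k)\<close> by sawtooth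
  squaring. The wide layers, of \<open>O(N\<^bsup>m\<^esup>)\<close> neurons, are separated by layers of bounded size, so even dense matrices
  have only \<open>O(N\<^bsup>m\<^esup>)\<close> entries.\<close>

section \<open>Families of functions computed by hidden layers\<close>

text \<open>A feedforward block treats all columns alike, so one network must produce
  \<open>f X p q\<close> for every column \<open>q\<close>, which it sees only as a one-hot input.
  The position therefore enters each product as one more factor, whereas the row \<open>p\<close> is
  resolved by the weights of the output layer.

  A ReLU network is continuous and cannot return the index of a cell everywhere, yet the error bound
  admits no exceptional strips near the faces of the cells. Each colour is thus allowed to fail:
  where one of its bumps vanishes, the lookup may return any numbers in [0,1]. The exact product is
  0 there, and the computed one differs from it by O(4^-k), because all factors, right or wrong,
  stay in [0,1]. Where no bump of the colour vanishes, the lookup is exact. Two errors remain,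
  O(N^-\<gamma>) from the polynomials and O(4^-k) from the products, and each is made at most
  \<epsilon>/2.\<close>

fun hrun :: "nat \<Rightarrow> nat \<Rightarrow> (mat \<times> vec) list \<Rightarrow> vec \<Rightarrow> vec" where
  "hrun a w [] x = x"
| "hrun a w ((A, c) # ls) x = hrun w w ls (relu (aff a A c x))"

text \<open>\<open>hrun\<close> recurses from the input side, but the constructions append layers at
  the output side. \<open>lay_in\<close> accounts for the first layer, whose input dimension is
  \<open>a\<close> instead of \<open>w\<close>. Every layer of \<open>hrun\<close> applies the ReLU;
  the closing affine layer is added only in \<open>computes_output\<close>.\<close>

lemma hrun_snoc:
  "hrun a w (hs @ [(A, c)]) x = relu (aff (lay_in a w (length hs)) A c (hrun a w hs x))"
proof (induction hs arbitrary: a x)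
  case (Cons h hs)
  then show ?case by (cases h) (auto simp: lay_in_def)
qed (simp add: lay_in_def)

lemma fnn_run_snoc:
  "fnn_run a w (hs @ [(A, c)]) x = aff (lay_in a w (length hs)) A c (hrun a w hs x)"
proof (induction hs arbitrary: a x)
  case (Cons h hs)
  obtain A1 c1 where h: "h = (A1, c1)" by (cases h)
  obtain l ls where l: "hs @ [(A, c)] = l # ls" by (cases "hs @ [(A, c)]") auto
  have "fnn_run a w ((h # hs) @ [(A, c)]) x = fnn_run w w (hs @ [(A, c)]) (relu (aff a A1 c1 x))"
    using l by (simp add: h)
  also have "\<dots> = aff (lay_in w w (length hs)) A c (hrun w w hs (relu (aff a A1 c1 x)))"
    by (rule Cons)
  finally show ?case by (simp add: h lay_in_def)
qed (simp add: lay_in_def)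

section \<open>Layers over labelled neurons\<close>

text \<open>The possible preactivations of one neuron, with a single bound for all coefficients and
  the bias. Agreement is required on \<open>S\<close> only, since many identities used for the
  network hold just for the intended inputs.\<close>

definition affine_comb ::
  "'x set \<Rightarrow> 'l set \<Rightarrow> ('l \<Rightarrow> 'x \<Rightarrow> real) \<Rightarrow> real \<Rightarrow> ('x \<Rightarrow> real) \<Rightarrow> bool" where
  "affine_comb S V \<phi> b g \<longleftrightarrow> (\<exists>A c. (\<forall>v\<in>V. \<bar>A v\<bar> \<le> b) \<and> \<bar>c\<bar> \<le> b
     \<and> (\<forall>x\<in>S. g x = (\<Sum>v\<in>V. A v * \<phi> v x) + c))"

lemma affine_comb_const: "\<bar>c\<bar> \<le> b \<Longrightarrow> affine_comb S V \<phi> b (\<lambda>_. c)"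
  unfolding affine_comb_def by (intro exI[of _ "\<lambda>_. 0"] exI[of _ c]) auto

lemma affine_comb_base:
  assumes "finite V" "v \<in> V" "1 \<le> b"
  shows "affine_comb S V \<phi> b (\<phi> v)"
  unfolding affine_comb_def
  using assms by (intro exI[of _ "\<lambda>u. if u = v then 1 else 0"] exI[of _ 0]) (auto simp: if_distrib[of "\<lambda>t. t * _"] cong: if_cong)

lemma affine_comb_add:
  assumes "affine_comb S V \<phi> b1 g1" "affine_comb S V \<phi> b2 g2"
  shows "affine_comb S V \<phi> (b1 + b2) (\<lambda>x. g1 x + g2 x)"
proof -
  obtain A1 c1 where 1: "\<forall>v\<in>V. \<bar>A1 v\<bar> \<le> b1" "\<bar>c1\<bar> \<le> b1" "\<forall>x\<in>S. g1 x = (\<Sum>v\<in>V. A1 v * \<phi> v x) + c1"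
    using assms(1) unfolding affine_comb_def by blast
  obtain A2 c2 where 2: "\<forall>v\<in>V. \<bar>A2 v\<bar> \<le> b2" "\<bar>c2\<bar> \<le> b2" "\<forall>x\<in>S. g2 x = (\<Sum>v\<in>V. A2 v * \<phi> v x) + c2"
    using assms(2) unfolding affine_comb_def by blast
  show ?thesis unfolding affine_comb_def
  proof (intro exI[of _ "\<lambda>v. A1 v + A2 v"] exI[of _ "c1 + c2"] conjI ballI)
    fix v assume "v \<in> V"
    then show "\<bar>A1 v + A2 v\<bar> \<le> b1 + b2" using 1(1) 2(1) by (meson abs_triangle_ineq add_mono order_trans)
  next
    show "\<bar>c1 + c2\<bar> \<le> b1 + b2" using 1 2 by linarith
  next
    fix x assume "x \<in> S"
    then show "g1 x + g2 x = (\<Sum>v\<in>V. (A1 v + A2 v) * \<phi> v x) + (c1 + c2)"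
      using 1(3) 2(3) by (simp add: distrib_right sum.distrib)
  qed
qed

lemma affine_comb_scale:
  assumes "affine_comb S V \<phi> b g"
  shows "affine_comb S V \<phi> (\<bar>k\<bar> * b) (\<lambda>x. k * g x)"
proof -
  obtain A c where 1: "\<forall>v\<in>V. \<bar>A v\<bar> \<le> b" "\<bar>c\<bar> \<le> b" "\<forall>x\<in>S. g x = (\<Sum>v\<in>V. A v * \<phi> v x) + c"
    using assms unfolding affine_comb_def by blast
  show ?thesis unfolding affine_comb_def
    using 1 by (intro exI[of _ "\<lambda>v. k * A v"] exI[of _ "k * c"])
      (auto simp: abs_mult sum_distrib_left mult.assoc distrib_left intro!: mult_left_mono)
qed

lemma affine_comb_mono:
  "affine_comb S V \<phi> b g \<Longrightarrow> b \<le> b' \<Longrightarrow> affine_comb S V \<phi> b' g"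
  unfolding affine_comb_def by (meson order_trans)

lemma affine_comb_cong:
  "affine_comb S V \<phi> b g \<Longrightarrow> (\<And>x. x \<in> S \<Longrightarrow> g x = g' x) \<Longrightarrow> affine_comb S V \<phi> b g'"
  unfolding affine_comb_def by auto

lemma affine_comb_sum:
  assumes "finite I" "\<And>i. i \<in> I \<Longrightarrow> affine_comb S V \<phi> (b i) (g i)"
  shows "affine_comb S V \<phi> (\<Sum>i\<in>I. b i) (\<lambda>x. \<Sum>i\<in>I. g i x)"
  using assms
  by (induction I rule: finite_induct) (auto intro!: affine_comb_const affine_comb_add)

text \<open>Neurons are addressed by labels of any type, and their positions stay hidden in the
  injection \<open>e\<close>; layers can then be indexed by sums and products of sets. Neurons
  without a label may carry anything. The weight bound ranges over all indices, also outside the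
  declared shape, which saves side conditions.\<close>

definition computes ::
  "nat \<Rightarrow> nat \<Rightarrow> 'x set \<Rightarrow> ('x \<Rightarrow> vec) \<Rightarrow> 'l set \<Rightarrow> ('l \<Rightarrow> 'x \<Rightarrow> real) \<Rightarrow> nat \<Rightarrow> nat \<Rightarrow> real \<Rightarrow> bool" where
  "computes a w S inp V \<phi> L M b \<longleftrightarrow> finite V \<and> (\<exists>hs e. length hs = L \<and> inj_on e V
     \<and> e ` V \<subseteq> {..<lay_in a w L}
     \<and> (\<forall>x\<in>S. \<forall>v\<in>V. hrun a w hs (inp x) (e v) = \<phi> v x)
     \<and> (\<forall>l<L. \<forall>i. (\<forall>j. \<bar>fst (hs ! l) i j\<bar> \<le> b) \<and> \<bar>snd (hs ! l) i\<bar> \<le> b)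
     \<and> (\<Sum>l<L. mat_nnz w (lay_in a w l) (fst (hs ! l)) + vec_nnz w (snd (hs ! l))) \<le> M)"

lemma computes_finite: "computes a w S inp V \<phi> L M b \<Longrightarrow> finite V"
  by (simp add: computes_def)

lemma computes_input:
  assumes "finite V" "V \<subseteq> {..<a}"
  shows "computes a w S inp V (\<lambda>i x. inp x i) 0 0 b"
  unfolding computes_def using assms
  by (intro conjI exI[of _ "[]"] exI[of _ id]) (auto simp: lay_in_def)

lemma computes_mono:
  "computes a w S inp V \<phi> L M b \<Longrightarrow> M \<le> M' \<Longrightarrow> computes a w S inp V \<phi> L M' b"
  unfolding computes_def
  by (elim conjE exE, intro conjI exI) (assumption | erule (1) order_trans)+

text \<open>Rows and columns without a label are filled with zeros. Uncontrolled neurons then do no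
  harm, which is why \<open>y\<close> is arbitrary apart from its labelled entries, and the number
  of nonzero weights is bounded independently of the row count \<open>r\<close>. The
  \<open>+ 1\<close> counts the bias. The lemma serves hidden layers (\<open>r = w\<close>) as well
  as the output layer.\<close>

lemma new_layer:
  fixes V :: "'l set" and V' :: "'k set"
  assumes "finite V" "finite V'" "inj_on e V" "e ` V \<subseteq> {..<k}" "inj_on e' V'" "0 \<le> b"
    and "\<And>v'. v' \<in> V' \<Longrightarrow> affine_comb S V \<phi> b (g v')"
  shows "\<exists>A c. (\<forall>x\<in>S. \<forall>v'\<in>V'. \<forall>y. (\<forall>v\<in>V. y (e v) = \<phi> v x) \<longrightarrow> aff k A c y (e' v') = g v' x)
     \<and> (\<forall>i. (\<forall>j. \<bar>A i j\<bar> \<le> b) \<and> \<bar>c i\<bar> \<le> b)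
     \<and> mat_nnz r k A + vec_nnz r c \<le> card V' * (card V + 1)"
proof -
  from assms(7) have "\<forall>v'\<in>V'. \<exists>A c. (\<forall>v\<in>V. \<bar>A v\<bar> \<le> b) \<and> \<bar>c\<bar> \<le> b
     \<and> (\<forall>x\<in>S. g v' x = (\<Sum>v\<in>V. A v * \<phi> v x) + c)"
    unfolding affine_comb_def by blast
  then obtain P c where P: "\<And>v' v. v' \<in> V' \<Longrightarrow> v \<in> V \<Longrightarrow> \<bar>P v' v\<bar> \<le> b"
    and c: "\<And>v'. v' \<in> V' \<Longrightarrow> \<bar>c v'\<bar> \<le> b"
    and g: "\<And>v' x. v' \<in> V' \<Longrightarrow> x \<in> S \<Longrightarrow> g v' x = (\<Sum>v\<in>V. P v' v * \<phi> v x) + c v'"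
    by metis
  define A where "A = (\<lambda>i j. if i \<in> e' ` V' \<and> j \<in> e ` V then P (inv_into V' e' i) (inv_into V e j) else (0::real))"
  define cc where "cc = (\<lambda>i. if i \<in> e' ` V' then c (inv_into V' e' i) else (0::real))"
  have "aff k A cc y (e' v') = g v' x"
    if "x \<in> S" "v' \<in> V'" "\<forall>v\<in>V. y (e v) = \<phi> v x" for x v' y
  proof -
    have "(\<Sum>j<k. A (e' v') j * y j) = (\<Sum>j\<in>e ` V. A (e' v') j * y j)"
      using assms(4) by (intro sum.mono_neutral_right) (auto simp: A_def)
    also have "\<dots> = (\<Sum>v\<in>V. A (e' v') (e v) * y (e v))"
      by (rule sum.reindex_cong[OF assms(3)]) auto
    also have "\<dots> = (\<Sum>v\<in>V. P v' v * \<phi> v x)"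
      using that assms(3,5) by (intro sum.cong) (auto simp: A_def)
    finally show ?thesis
      using that assms(5) by (simp add: aff_def g cc_def)
  qed
  moreover have "\<bar>A i j\<bar> \<le> b" for i j
    using assms(6) P inv_into_into[of i e' V'] inv_into_into[of j e V] by (auto simp: A_def)
  moreover have "\<bar>cc i\<bar> \<le> b" for i
    using assms(6) c inv_into_into[of i e' V'] by (auto simp: cc_def)
  moreover have "mat_nnz r k A \<le> card V' * card V"
  proof -
    have "mat_nnz r k A \<le> card (e' ` V' \<times> e ` V)"
      unfolding mat_nnz_def using assms(1,2) by (intro card_mono) (auto simp: A_def split: if_splits)
    also have "\<dots> = card V' * card V"
      using assms(3,5) by (simp add: card_cartesian_product card_image)
    finally show ?thesis .
  qed
  moreover have "vec_nnz r cc \<le> card V'"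
  proof -
    have "vec_nnz r cc \<le> card (e' ` V')"
      unfolding vec_nnz_def using assms(2) by (intro card_mono) (auto simp: cc_def split: if_splits)
    then show ?thesis using assms(5) by (simp add: card_image)
  qed
  ultimately show ?thesis
    by (intro exI[of _ A] exI[of _ cc]) auto
qed

text \<open>Quantities needed later have to be carried from layer to layer: a nonnegative one passes
  the ReLU unchanged, at the cost of one neuron.\<close>

lemma computes_step:
  fixes V' :: "'k set"
  assumes comp: "computes a w S inp V \<phi> L M b" and "0 \<le> b"
    and fin: "finite V'" and card: "card V' \<le> w"
    and step: "\<And>v'. v' \<in> V' \<Longrightarrow> \<exists>g. affine_comb S V \<phi> b g \<and> (\<forall>x\<in>S. \<phi>' v' x = max (g x) 0)"
  shows "computes a w S inp V' \<phi>' (Suc L) (M + card V' * (card V + 1)) b"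
proof -
  obtain hs e where len: "length hs = L" and inj: "inj_on e V" and sub: "e ` V \<subseteq> {..<lay_in a w L}"
    and run: "\<forall>x\<in>S. \<forall>v\<in>V. hrun a w hs (inp x) (e v) = \<phi> v x"
    and bnd: "\<forall>l<L. \<forall>i. (\<forall>j. \<bar>fst (hs ! l) i j\<bar> \<le> b) \<and> \<bar>snd (hs ! l) i\<bar> \<le> b"
    and nnz: "(\<Sum>l<L. mat_nnz w (lay_in a w l) (fst (hs ! l)) + vec_nnz w (snd (hs ! l))) \<le> M"
    and V: "finite V"
    using comp unfolding computes_def by blast
  obtain g where g: "\<And>v'. v' \<in> V' \<Longrightarrow> affine_comb S V \<phi> b (g v')"
      "\<And>v' x. v' \<in> V' \<Longrightarrow> x \<in> S \<Longrightarrow> \<phi>' v' x = max (g v' x) 0"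
    using step by metis
  obtain e' :: "'k \<Rightarrow> nat" where e': "inj_on e' V'" "e' ` V' = {0..<card V'}"
    using ex_bij_betw_finite_nat[OF fin] by (auto simp: bij_betw_def)
  obtain A c where A: "\<forall>x\<in>S. \<forall>v'\<in>V'. \<forall>y. (\<forall>v\<in>V. y (e v) = \<phi> v x) \<longrightarrow> aff (lay_in a w L) A c y (e' v') = g v' x"
    "\<forall>i. (\<forall>j. \<bar>A i j\<bar> \<le> b) \<and> \<bar>c i\<bar> \<le> b"
    "mat_nnz w (lay_in a w L) A + vec_nnz w c \<le> card V' * (card V + 1)"
    using new_layer[OF V fin inj sub e'(1) assms(2), of S \<phi> g w] g(1) by blast
  show ?thesis
    unfolding computes_def
  proof (intro conjI exI[of _ "hs @ [(A, c)]"] exI[of _ e'])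
    show "e' ` V' \<subseteq> {..<lay_in a w (Suc L)}"
      using card e' by (auto simp: lay_in_def)
    show "\<forall>x\<in>S. \<forall>v\<in>V'. hrun a w (hs @ [(A, c)]) (inp x) (e' v) = \<phi>' v x"
      using A(1) run g(2) by (simp add: hrun_snoc len relu_def)
    show "\<forall>l<Suc L. \<forall>i. (\<forall>j. \<bar>fst ((hs @ [(A, c)]) ! l) i j\<bar> \<le> b) \<and> \<bar>snd ((hs @ [(A, c)]) ! l) i\<bar> \<le> b"
      using bnd A(2) len by (auto simp: nth_append less_Suc_eq)
    show "(\<Sum>l<Suc L. mat_nnz w (lay_in a w l) (fst ((hs @ [(A, c)]) ! l)) +
        vec_nnz w (snd ((hs @ [(A, c)]) ! l))) \<le> M + card V' * (card V + 1)"
      using nnz A(3) len by (simp add: nth_append)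
  qed (use fin len e' in auto)
qed

lemma computes_output:
  assumes comp: "computes a w S inp V \<phi> L M b" and b: "0 \<le> b"
    and out: "\<And>p. p < r \<Longrightarrow> affine_comb S V \<phi> b (g p)"
  obtains ls where "length ls = Suc L"
    "\<And>x p. x \<in> S \<Longrightarrow> p < r \<Longrightarrow> fnn_run a w ls (inp x) p = g p x"
    "\<And>y. y \<in> fnn_params a r w ls \<Longrightarrow> \<bar>y\<bar> \<le> b"
    "fnn_nnz a r w ls \<le> M + r * (card V + 1)"
proof -
  obtain hs e where len: "length hs = L" and inj: "inj_on e V" and sub: "e ` V \<subseteq> {..<lay_in a w L}"
    and run: "\<forall>x\<in>S. \<forall>v\<in>V. hrun a w hs (inp x) (e v) = \<phi> v x"
    and bnd: "\<forall>l<L. \<forall>i. (\<forall>j. \<bar>fst (hs ! l) i j\<bar> \<le> b) \<and> \<bar>snd (hs ! l) i\<bar> \<le> b"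
    and nnz: "(\<Sum>l<L. mat_nnz w (lay_in a w l) (fst (hs ! l)) + vec_nnz w (snd (hs ! l))) \<le> M"
    and V: "finite V"
    using comp unfolding computes_def by blast
  obtain A c where A: "\<forall>x\<in>S. \<forall>p\<in>{..<r}. \<forall>y. (\<forall>v\<in>V. y (e v) = \<phi> v x) \<longrightarrow> aff (lay_in a w L) A c y (id p) = g p x"
    "\<forall>i. (\<forall>j. \<bar>A i j\<bar> \<le> b) \<and> \<bar>c i\<bar> \<le> b"
    "mat_nnz r (lay_in a w L) A + vec_nnz r c \<le> card {..<r} * (card V + 1)"
    using new_layer[OF V _ inj sub _ b, of "{..<r}" id S \<phi> g r] out by auto
  have bnd': "\<forall>l<Suc L. \<forall>i. (\<forall>j. \<bar>fst ((hs @ [(A, c)]) ! l) i j\<bar> \<le> b) \<and> \<bar>snd ((hs @ [(A, c)]) ! l) i\<bar> \<le> b"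
    using bnd A(2) len by (auto simp: nth_append less_Suc_eq)
  show ?thesis
  proof (rule that[of "hs @ [(A, c)]"])
    show "length (hs @ [(A, c)]) = Suc L" by (simp add: len)
    show "fnn_run a w (hs @ [(A, c)]) (inp x) p = g p x" if "x \<in> S" "p < r" for x p
      using A(1) run that by (simp add: fnn_run_snoc len)
    show "\<bar>y\<bar> \<le> b" if "y \<in> fnn_params a r w (hs @ [(A, c)])" for y
      using that bnd' len by (auto simp: fnn_params_def mat_entries_def vec_entries_def)
    show "fnn_nnz a r w (hs @ [(A, c)]) \<le> M + r * (card V + 1)"
      using nnz A(3) len by (simp add: fnn_nnz_def nth_append lay_out_def)
  qed
qed

section \<open>Approximate products\<close>

lemma computes_reindex:
  assumes "computes a w S inp V \<phi> L M b" "inj_on h V'" "h ` V' \<subseteq> V"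
  shows "computes a w S inp V' (\<lambda>v. \<phi> (h v)) L M b"
proof -
  obtain hs e where *: "length hs = L" "inj_on e V" "e ` V \<subseteq> {..<lay_in a w L}"
    "\<forall>x\<in>S. \<forall>v\<in>V. hrun a w hs (inp x) (e v) = \<phi> v x"
    "\<forall>l<L. \<forall>i. (\<forall>j. \<bar>fst (hs ! l) i j\<bar> \<le> b) \<and> \<bar>snd (hs ! l) i\<bar> \<le> b"
    "(\<Sum>l<L. mat_nnz w (lay_in a w l) (fst (hs ! l)) + vec_nnz w (snd (hs ! l))) \<le> M"
    and V: "finite V"
    using assms(1) unfolding computes_def by blast
  have "finite V'" using assms(2,3) V by (meson finite_imageD finite_subset)
  then show ?thesis
    unfolding computes_def
  proof (intro conjI exI[of _ hs] exI[of _ "e \<circ> h"])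
    show "inj_on (e \<circ> h) V'"
      using assms(2,3) *(2) by (intro comp_inj_on) (auto intro: inj_on_subset)
    show "(e \<circ> h) ` V' \<subseteq> {..<lay_in a w L}"
      unfolding image_comp[symmetric] using image_mono[OF assms(3), of e] *(3) by (rule subset_trans)
    show "\<forall>x\<in>S. \<forall>v\<in>V'. hrun a w hs (inp x) ((e \<circ> h) v) = \<phi> (h v) x"
      using *(4) assms(3) by auto
  qed (use * in auto)
qed

section \<open>Squares and products through iterated tent functions\<close>

definition tent :: "real \<Rightarrow> real" where
  "tent t = 2 * max t 0 - 4 * max (t - 1/2) 0"

text \<open>The piecewise linear interpolant of \<open>z - z^2\<close> on the dyadic grid of mesh
  \<open>2^-k\<close> in [0,1].\<close>

definition sawtooth_sum :: "nat \<Rightarrow> real \<Rightarrow> real" where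
  "sawtooth_sum k z = (\<Sum>j<k. (tent ^^ Suc j) z / 4 ^ Suc j)"

lemma tent_unit: "t \<in> {0..1} \<Longrightarrow> tent t \<in> {0..1}"
  by (auto simp: tent_def max_def)

lemma tent_iter_unit: "t \<in> {0..1} \<Longrightarrow> (tent ^^ k) t \<in> {0..1}"
  by (induction k) (auto simp del: atLeastAtMost_iff intro: tent_unit)

text \<open>Each half of the parabola \<open>t - t^2\<close> is, up to a linear term, a copy of the
  whole one scaled by 1/4, and the tent maps either half onto [0,1]. Iterating this functional
  equation gives the geometric decay of the error.\<close>

lemma parabola_tent: "t \<in> {0..1} \<Longrightarrow> t - t\<^sup>2 = (tent t + (tent t - (tent t)\<^sup>2)) / 4"
  by (cases "t \<le> 1/2") (auto simp: tent_def max_def power2_eq_square field_simps)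

lemma parabola_sawtooth:
  assumes "z \<in> {0..1}"
  shows "z - z\<^sup>2 = sawtooth_sum k z + ((tent ^^ k) z - ((tent ^^ k) z)\<^sup>2) / 4 ^ k"
proof (induction k)
  case (Suc k)
  define u where "u = (tent ^^ k) z"
  have "(u - u\<^sup>2) / 4 ^ k = (tent u + (tent u - (tent u)\<^sup>2)) / 4 / 4 ^ k"
    unfolding u_def by (subst parabola_tent[OF tent_iter_unit[OF assms]]) simp
  also have "\<dots> = tent u / 4 ^ Suc k + (tent u - (tent u)\<^sup>2) / 4 ^ Suc k"
    by (simp add: add_divide_distrib[symmetric])
  finally show ?case
    using Suc by (simp add: sawtooth_sum_def u_def)
qed (simp add: sawtooth_sum_def)

lemma sawtooth_sum_error:
  assumes "z \<in> {0..1}"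
  shows "0 \<le> (z - z\<^sup>2) - sawtooth_sum k z" "(z - z\<^sup>2) - sawtooth_sum k z \<le> 1 / 4 / 4 ^ k"
proof -
  define u where "u = (tent ^^ k) z"
  have u: "u \<in> {0..1}" unfolding u_def by (rule tent_iter_unit[OF assms])
  have "0 \<le> u - u\<^sup>2" using u by (auto simp: power2_eq_square mult_left_le)
  moreover have "u - u\<^sup>2 \<le> 1 / 4"
    using zero_le_power2[of "u - 1/2"] by (simp add: power2_diff) (simp add: power2_eq_square)
  moreover have "(z - z\<^sup>2) - sawtooth_sum k z = (u - u\<^sup>2) / 4 ^ k"
    using parabola_sawtooth[OF assms, of k] by (simp add: u_def)
  ultimately show "0 \<le> (z - z\<^sup>2) - sawtooth_sum k z" "(z - z\<^sup>2) - sawtooth_sum k z \<le> 1 / 4 / 4 ^ k"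
    using divide_right_mono[of "u - u\<^sup>2" "1 / 4" "4 ^ k"] by auto
qed

lemma sawtooth_sum_nonneg: "z \<in> {0..1} \<Longrightarrow> 0 \<le> sawtooth_sum k z"
  unfolding sawtooth_sum_def
  using tent_iter_unit[of z "Suc _"] by (intro sum_nonneg divide_nonneg_nonneg) auto

text \<open>Truncation to [0,1], written as two nested ReLUs so that two layers compute it.\<close>

definition clamp_unit :: "real \<Rightarrow> real" where
  "clamp_unit z = max (1 - max (1 - z) 0) 0"

text \<open>Polarisation \<open>x y = 2 ((x + y) / 2)\<^sup>2 - x\<^sup>2 / 2 - y\<^sup>2 / 2\<close>
  with every square \<open>z\<^sup>2\<close> replaced by \<open>z - sawtooth_sum k z\<close>.\<close>
definition approx_mult :: "nat \<Rightarrow> real \<Rightarrow> real \<Rightarrow> real" where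
  "approx_mult k x y = clamp_unit ((x + y) / 2 - 2 * sawtooth_sum k ((x + y) / 2)
     + sawtooth_sum k x / 2 + sawtooth_sum k y / 2)"

lemma approx_mult_unit: "approx_mult k x y \<in> {0..1}"
  by (auto simp: approx_mult_def clamp_unit_def)

text \<open>The errors of the three squares lie between 0 and \<open>1 / 4 / 4 ^ k\<close> and enter
  with the weights 2, -1/2, -1/2. Clamping cannot increase the error, since the exact product lies
  in [0,1].\<close>

lemma approx_mult_error:
  assumes "x \<in> {0..1}" "y \<in> {0..1}"
  shows "\<bar>approx_mult k x y - x * y\<bar> \<le> 1 / 4 ^ k"
proof -
  define z where "z = (x + y) / 2"
  have z: "z \<in> {0..1}" using assms by (auto simp: z_def)
  define e where "e = (\<lambda>z. (z - z\<^sup>2) - sawtooth_sum k z)"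
  define v where "v = z - 2 * sawtooth_sum k z + sawtooth_sum k x / 2 + sawtooth_sum k y / 2"
  have "x * y = z - 2 * (z - z\<^sup>2) + (x - x\<^sup>2) / 2 + (y - y\<^sup>2) / 2"
    by (simp add: z_def power2_eq_square field_simps)
  then have "v - x * y = 2 * e z - e x / 2 - e y / 2"
    by (simp add: v_def e_def field_simps)
  moreover have "0 \<le> e u \<and> e u \<le> 1 / 4 / 4 ^ k" if "u \<in> {0..1}" for u
    using sawtooth_sum_error[OF that, of k] by (simp add: e_def)
  note this[OF z] this[OF assms(1)] this[OF assms(2)]
  ultimately have "\<bar>v - x * y\<bar> \<le> 1 / 4 ^ k" by linarith
  moreover have "0 \<le> x * y" "x * y \<le> 1"
    using assms by (auto simp: mult_le_one)
  ultimately show ?thesis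
    unfolding approx_mult_def z_def[symmetric] v_def[symmetric]
    by (auto simp: clamp_unit_def max_def abs_if split: if_splits)
qed

text \<open>Of the \<open>k + 3\<close> layers one prepares the arguments, \<open>k\<close> iterate
  the tent and two clamp. Each pair needs three squares with four neurons each, hence 12. The
  functions \<open>F\<close> are carried along because later multiplications reuse them. The bound 8
  covers the weights of every layer, whatever \<open>k\<close> is.\<close>

lemma computes_mult:
  fixes F :: "'v \<Rightarrow> 'x \<Rightarrow> real" and P :: "'i \<Rightarrow> 'x \<Rightarrow> real"
  assumes comp: "computes a w S inp (V <+> I) (case_sum F P) L M b"
    and F: "\<And>v x. v \<in> V \<Longrightarrow> x \<in> S \<Longrightarrow> F v x \<in> {0..1}"
    and P: "\<And>i x. i \<in> I \<Longrightarrow> x \<in> S \<Longrightarrow> P i x \<in> {0..1}"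
    and f: "\<And>i. i \<in> I \<Longrightarrow> f i \<in> V"
    and b: "8 \<le> b" and w: "card V + 12 * card I \<le> w"
  shows "computes a w S inp (V <+> I) (case_sum F (\<lambda>i x. approx_mult k (P i x) (F (f i) x)))
    (L + (k + 3)) (M + (k + 3) * (card V + 12 * card I + 1)\<^sup>2) b"
proof -
  define z where "z = (\<lambda>i e x. if e = (0::nat) then (P i x + F (f i) x) / 2 else if e = 1 then P i x else F (f i) x)"
  \<comment> \<open>After \<open>j\<close> rounds component 0 holds the tent iterate, 1 its excess
    over 1/2 (the kink of the tent), 2 the partial sum, 3 the argument itself; \<open>e\<close>
    selects one of the three numbers to be squared.\<close>
  define st where "st = (\<lambda>j. case_sum F (\<lambda>(i, c, e) x. if c = (0::nat) then (tent ^^ j) (z i e x)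
    else if c = 1 then max ((tent ^^ j) (z i e x) - 1/2) 0 else if c = 2 then sawtooth_sum j (z i e x) else z i e x))"
  define V' where "V' = V <+> I \<times> {..<4::nat} \<times> {..<3::nat}"
  define Q where "Q = (card V + 12 * card I + 1)\<^sup>2"
  have finVI: "finite V" "finite I"
    using computes_finite[OF comp] by (auto simp: finite_Plus_iff)
  then have fin: "finite (V <+> I)" "finite V'" by (auto simp: V'_def)
  have card': "card V' = card V + 12 * card I"
    using finVI by (simp add: V'_def card_Plus card_cartesian_product)
  have card: "card (V <+> I) = card V + card I"
    using finVI by (simp add: card_Plus)
  have b0: "0 \<le> b" using b by simp
  have z: "z i e x \<in> {0..1}" if "i \<in> I" "x \<in> S" for i e x
    using P[OF that] F[OF f[OF that(1)] that(2)] by (auto simp: z_def)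
  have Fpos: "max (F v x) 0 = F v x" if "v \<in> V" "x \<in> S" for v x
    using F[OF that] by auto
  have stage0: "computes a w S inp V' (st 0) (Suc L) (M + Q) b"
  proof (rule computes_mono[OF computes_step[OF comp b0 fin(2)]])
    show "card V' \<le> w" using w card' by simp
    show "M + card V' * (card (V <+> I) + 1) \<le> M + Q"
      unfolding card card' Q_def power2_eq_square by (intro add_left_mono mult_mono) auto
    fix u assume u: "u \<in> V'"
    show "\<exists>g. affine_comb S (V <+> I) (case_sum F P) b g \<and> (\<forall>x\<in>S. st 0 u x = max (g x) 0)"
    proof (cases u)
      case (Inl v)
      then have v: "v \<in> V" using u by (auto simp: V'_def)
      have "affine_comb S (V <+> I) (case_sum F P) b (case_sum F P (Inl v))"
        by (rule affine_comb_base) (use fin v b in auto)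
      then show ?thesis using Fpos v Inl by (intro exI conjI) (auto simp: st_def)
    next
      case (Inr t)
      then obtain i c e where t: "t = (i, c, e)" and i: "i \<in> I" "c < 4" "e < 3"
        using u by (cases t) (auto simp: V'_def)
      have aP: "affine_comb S (V <+> I) (case_sum F P) 1 (P i)"
        using affine_comb_base[of "V <+> I" "Inr i" 1 S "case_sum F P", OF fin(1) InrI[OF i(1)]] by simp
      have aF: "affine_comb S (V <+> I) (case_sum F P) 1 (F (f i))"
        using affine_comb_base[of "V <+> I" "Inl (f i)" 1 S "case_sum F P", OF fin(1) InlI[OF f[OF i(1)]]] by simp
      have az: "affine_comb S (V <+> I) (case_sum F P) 1 (z i e)"
      proof -
        have "affine_comb S (V <+> I) (case_sum F P) 1 (\<lambda>x. 1/2 * P i x + 1/2 * F (f i) x)"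
          by (rule affine_comb_mono, (rule affine_comb_add affine_comb_scale aP aF)+) simp
        then have "affine_comb S (V <+> I) (case_sum F P) 1 (\<lambda>x. (P i x + F (f i) x) / 2)"
          by (rule affine_comb_cong) simp
        then show ?thesis
          using aP aF unfolding z_def by (cases "e = 0"; cases "e = 1") simp_all
      qed
      have "affine_comb S (V <+> I) (case_sum F P) b (\<lambda>x. z i e x + - 1/2)"
        by (rule affine_comb_mono, (rule affine_comb_add affine_comb_const[OF order_refl] az)+) (use b in simp)
      moreover have "affine_comb S (V <+> I) (case_sum F P) b (z i e)"
        by (rule affine_comb_mono[OF az]) (use b in simp)
      moreover have "affine_comb S (V <+> I) (case_sum F P) b (\<lambda>_. 0)"
        by (rule affine_comb_const) (use b in simp)
      moreover have "max (z i e x) 0 = z i e x" if "x \<in> S" for x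
        using z[OF i(1) that] by auto
      ultimately show ?thesis
        by (cases "c = 0"; cases "c = 1"; cases "c = 2")
          (force simp: Inr t st_def sawtooth_sum_def)+
    qed
  qed
  have stage: "computes a w S inp V' (st j) (Suc L + j) (M + Q + j * Q) b" for j
  proof (induction j)
    case (Suc j)
    have "computes a w S inp V' (st (Suc j)) (Suc (Suc L + j)) (M + Q + j * Q + Q) b"
    proof (rule computes_mono[OF computes_step[OF Suc b0 fin(2)]])
      show "card V' \<le> w" using w card' by simp
      show "M + Q + j * Q + card V' * (card V' + 1) \<le> M + Q + j * Q + Q"
        unfolding card card' Q_def power2_eq_square by (intro add_left_mono mult_mono) auto
      fix u assume u: "u \<in> V'"
      show "\<exists>g. affine_comb S V' (st j) b g \<and> (\<forall>x\<in>S. st (Suc j) u x = max (g x) 0)"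
      proof (cases u)
        case (Inl v)
        then have v: "v \<in> V" using u by (auto simp: V'_def)
        have "affine_comb S V' (st j) b (st j (Inl v))"
          by (rule affine_comb_base) (use fin u Inl b in auto)
        then show ?thesis using Fpos v Inl by (intro exI conjI) (auto simp: st_def)
      next
        case (Inr t)
        then obtain i c e where t: "t = (i, c, e)" and i: "i \<in> I" "c < 4" "e < 3"
          using u by (cases t) (auto simp: V'_def)
        have base: "affine_comb S V' (st j) 1 (st j (Inr (i, c, e)))" if "c < 4" for c
          by (rule affine_comb_base) (use fin i that in \<open>auto simp: V'_def\<close>)
        define T where "T = (\<lambda>x. (tent ^^ Suc j) (z i e x))"
        \<comment> \<open>The next iterate is twice component 0 minus four times component 1, whence
          6 = 2 + 4.\<close>
        have aT: "affine_comb S V' (st j) 6 T"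
        proof -
          have "affine_comb S V' (st j) 6 (\<lambda>x. 2 * st j (Inr (i, 0, e)) x + (- 4) * st j (Inr (i, 1, e)) x)"
            by (rule affine_comb_mono, (rule affine_comb_add affine_comb_scale base | simp)+)
          then show ?thesis
          proof (rule affine_comb_cong)
            fix x assume "x \<in> S"
            then have "(tent ^^ j) (z i e x) \<in> {0..1}" by (intro tent_iter_unit z i)
            then show "2 * st j (Inr (i, 0, e)) x + (- 4) * st j (Inr (i, 1, e)) x = T x"
              by (simp add: st_def T_def tent_def)
          qed
        qed
        have T: "max (T x) 0 = T x" if "x \<in> S" for x
          using tent_iter_unit[OF z[OF i(1) that], of "Suc j"] unfolding T_def by simp
        consider "c = 0" | "c = 1" | "c = 2" | "c = 3" using i(2) by linarith
        then show ?thesis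
        proof cases
          case 1
          then show ?thesis using affine_comb_mono[OF aT, of b] b T
            by (intro exI[of _ T]) (auto simp: Inr t st_def T_def)
        next
          case 2
          have "affine_comb S V' (st j) b (\<lambda>x. T x + - 1/2)"
            by (rule affine_comb_mono, (rule affine_comb_add affine_comb_const[OF order_refl] aT)+) (use b in simp)
          then show ?thesis using 2
            by (intro exI conjI) (auto simp: Inr t st_def T_def)
        next
          case 3
          have "affine_comb S V' (st j) b (\<lambda>x. st j (Inr (i, 2, e)) x + 1 / 4 ^ Suc j * T x)"
          proof (rule affine_comb_mono, (rule affine_comb_add affine_comb_scale base[of 2] aT | simp only:)+)
            \<comment> \<open>The power of 1/4 is applied when the summand is added, so that the
              weights stay bounded as \<open>j\<close> grows.\<close>
            have "\<bar>1 / 4 ^ Suc j\<bar> \<le> (1 / 4 :: real)"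
              by (simp add: divide_simps)
            then show "1 + \<bar>1 / 4 ^ Suc j\<bar> * 6 \<le> b" using b by linarith
          qed
          moreover have "st (Suc j) u x = max (st j (Inr (i, 2, e)) x + 1 / 4 ^ Suc j * T x) 0" if "x \<in> S" for x
            using sawtooth_sum_nonneg[OF z[OF i(1) that], of "Suc j" e]
            by (simp add: Inr t 3 st_def T_def sawtooth_sum_def max_def)
          ultimately show ?thesis by blast
        next
          case 4
          have "max (z i e x) 0 = z i e x" if "x \<in> S" for x
            using z[OF i(1) that] by auto
          then show ?thesis using affine_comb_mono[OF base[of 3], of b] b 4
            by (intro exI[of _ "st j (Inr (i, 3, e))"]) (auto simp: Inr t st_def)
        qed
      qed
    qed
    then show ?case by (simp add: add_ac)
  qed (use stage0 in simp)
  \<comment> \<open>The clamp takes the last two layers: the first stores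
    \<open>max (1 - R i x) 0\<close>, the second subtracts it from 1.\<close>
  define R where "R = (\<lambda>i x. (P i x + F (f i) x) / 2 - 2 * sawtooth_sum k ((P i x + F (f i) x) / 2)
     + sawtooth_sum k (P i x) / 2 + sawtooth_sum k (F (f i) x) / 2)"
  have "computes a w S inp (V <+> I) (case_sum F (\<lambda>i x. max (1 - R i x) 0)) (Suc (Suc L + k)) (M + Q + k * Q + Q) b"
  proof (rule computes_mono[OF computes_step[OF stage b0 fin(1)]])
    show "card (V <+> I) \<le> w" using w card by simp
    show "M + Q + k * Q + card (V <+> I) * (card V' + 1) \<le> M + Q + k * Q + Q"
      unfolding card card' Q_def power2_eq_square by (intro add_left_mono mult_mono) auto
    fix u assume u: "u \<in> V <+> I"
    show "\<exists>g. affine_comb S V' (st k) b g \<and> (\<forall>x\<in>S. case_sum F (\<lambda>i x. max (1 - R i x) 0) u x = max (g x) 0)"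
    proof (cases u)
      case (Inl v)
      then have v: "v \<in> V" using u by auto
      have "affine_comb S V' (st k) b (st k (Inl v))"
        by (rule affine_comb_base) (use fin v b in \<open>auto simp: V'_def\<close>)
      then show ?thesis using Fpos v Inl by (intro exI conjI) (auto simp: st_def)
    next
      case (Inr i)
      then have i: "i \<in> I" using u by auto
      have base: "affine_comb S V' (st k) 1 (st k (Inr (i, c, e)))" if "c < 4" "e < 3" for c e
        by (rule affine_comb_base) (use fin i that in \<open>auto simp: V'_def\<close>)
      have "affine_comb S V' (st k) b (\<lambda>x. 1 + (- 1) * st k (Inr (i, 3, 0)) x + 2 * st k (Inr (i, 2, 0)) x
          + (- (1/2)) * st k (Inr (i, 2, 1)) x + (- (1/2)) * st k (Inr (i, 2, 2)) x)"
        by (rule affine_comb_mono, (rule affine_comb_add affine_comb_scale affine_comb_const[OF order_refl] base | use b in simp)+)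
      moreover have "1 - R i x = 1 + (- 1) * st k (Inr (i, 3, 0)) x + 2 * st k (Inr (i, 2, 0)) x
          + (- (1/2)) * st k (Inr (i, 2, 1)) x + (- (1/2)) * st k (Inr (i, 2, 2)) x" for x
        by (simp add: st_def z_def R_def) (simp add: field_simps)
      ultimately show ?thesis
        by (intro exI conjI ballI) (assumption, simp only: Inr sum.case)
    qed
  qed
  then have "computes a w S inp (V <+> I) (case_sum F (\<lambda>i x. approx_mult k (P i x) (F (f i) x)))
     (Suc (Suc (Suc L + k))) (M + Q + k * Q + Q + Q) b"
  proof (rule computes_mono[OF computes_step[OF _ b0 fin(1)]])
    show "card (V <+> I) \<le> w" using w card by simp
    show "M + Q + k * Q + Q + card (V <+> I) * (card (V <+> I) + 1) \<le> M + Q + k * Q + Q + Q"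
      unfolding card card' Q_def power2_eq_square by (intro add_left_mono mult_mono) auto
    fix u assume u: "u \<in> V <+> I"
    let ?\<phi> = "case_sum F (\<lambda>i x. max (1 - R i x) 0)"
    show "\<exists>g. affine_comb S (V <+> I) ?\<phi> b g \<and>
       (\<forall>x\<in>S. case_sum F (\<lambda>i x. approx_mult k (P i x) (F (f i) x)) u x = max (g x) 0)"
    proof (cases u)
      case (Inl v)
      then have v: "v \<in> V" using u by auto
      have "affine_comb S (V <+> I) ?\<phi> b (?\<phi> (Inl v))"
        by (rule affine_comb_base) (use fin v b in auto)
      then show ?thesis using Fpos v Inl by (intro exI conjI) auto
    next
      case (Inr i)
      then have i: "i \<in> I" using u by auto
      have base: "affine_comb S (V <+> I) ?\<phi> 1 (?\<phi> (Inr i))"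
        by (rule affine_comb_base) (use fin i in auto)
      have "affine_comb S (V <+> I) ?\<phi> b (\<lambda>x. 1 + (- 1) * ?\<phi> (Inr i) x)"
        by (rule affine_comb_mono, (rule affine_comb_add affine_comb_scale affine_comb_const[OF order_refl] base)+) (use b in auto)
      then show ?thesis
        by (intro exI conjI) (auto simp: Inr R_def approx_mult_def clamp_unit_def)
    qed
  qed
  then show ?thesis by (simp add: Q_def add_ac numeral_3_eq_3)
qed

section \<open>Products of several factors\<close>

lemma prod_padded_list:
  fixes F :: "'v \<Rightarrow> 'a::comm_monoid_mult"
  assumes "length xs \<le> R"
  shows "(\<Prod>r<R. if r < length xs then F (xs ! r) else 1) = prod_list (map F xs)"
proof -
  have "(\<Prod>r<R. if r < length xs then F (xs ! r) else 1) = (\<Prod>r<length xs. F (xs ! r))"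
    using assms by (intro prod.mono_neutral_cong_right) auto
  then show ?thesis by (simp add: prod.list_conv_set_nth lessThan_atLeast0)
qed

text \<open>All products advance in parallel for \<open>R\<close> rounds; shorter lists are padded
  with a neuron of constant value 1, labelled \<open>None\<close>. Errors merely add up, since each
  round multiplies the old error by a factor in [0,1] and contributes at most
  \<open>1 / 4 ^ k\<close>.\<close>

lemma computes_products:
  fixes F :: "'v \<Rightarrow> 'x \<Rightarrow> real" and facs :: "'i \<Rightarrow> 'v list"
  assumes comp: "computes a w S inp V F L M b"
    and F: "\<And>v x. v \<in> V \<Longrightarrow> x \<in> S \<Longrightarrow> F v x \<in> {0..1}"
    and I: "finite I" "\<And>i. i \<in> I \<Longrightarrow> set (facs i) \<subseteq> V" "\<And>i. i \<in> I \<Longrightarrow> length (facs i) \<le> R"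
    and b: "8 \<le> b" and w: "card V + 1 + 12 * card I \<le> w"
  shows "\<exists>P. computes a w S inp I P (Suc L + R * (k + 3)) (M + (R * (k + 3) + 1) * (card V + 12 * card I + 2)\<^sup>2) b
    \<and> (\<forall>i\<in>I. \<forall>x\<in>S. \<bar>P i x - prod_list (map (\<lambda>v. F v x) (facs i))\<bar> \<le> real R / 4 ^ k)"
proof -
  define V' where "V' = insert None (Some ` V)"
  define F' where "F' = case_option (\<lambda>_. 1) F"
  define f where "f = (\<lambda>i r. if r < length (facs i) then Some (facs i ! r) else None)"
  define Q where "Q = (card V + 12 * card I + 2)\<^sup>2"
  have finV: "finite V" by (rule computes_finite[OF comp])
  then have finV': "finite V'" by (simp add: V'_def)
  have cardV': "card V' = card V + 1"
    using finV by (simp add: V'_def card_image)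
  have F': "F' v x \<in> {0..1}" if "v \<in> V'" "x \<in> S" for v x
    using F that by (auto simp: V'_def F'_def)
  have f: "f i r \<in> V'" if "i \<in> I" for i r
    using subsetD[OF I(2)[OF that] nth_mem[of r]] by (auto simp: f_def V'_def)
  have b0: "0 \<le> b" using b by simp
  have start: "computes a w S inp (V' <+> I) (case_sum F' (\<lambda>_ _. 1)) (Suc L) (M + Q) b"
  proof (rule computes_mono[OF computes_step[OF comp b0]])
    show "finite (V' <+> I)" using finV' I by simp
    have card: "card (V' <+> I) = card V + 1 + card I"
      using finV' I by (simp add: card_Plus cardV')
    show "card (V' <+> I) \<le> w" using w card by simp
    show "M + card (V' <+> I) * (card V + 1) \<le> M + Q"
      unfolding card Q_def power2_eq_square by (intro add_left_mono mult_mono) auto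
    have one: "affine_comb S V F b (\<lambda>_. 1)"
      by (rule affine_comb_const) (use b in simp)
    fix u assume u: "u \<in> V' <+> I"
    show "\<exists>g. affine_comb S V F b g \<and> (\<forall>x\<in>S. case_sum F' (\<lambda>_ _. 1) u x = max (g x) 0)"
    proof (cases "u \<in> Inl ` Some ` V")
      case True
      then obtain v where v: "v \<in> V" "u = Inl (Some v)" by auto
      have "affine_comb S V F b (F v)"
        by (rule affine_comb_base) (use finV v b in auto)
      then show ?thesis using F v by (intro exI[of _ "F v"] conjI) (auto simp: F'_def)
    next
      case False
      then show ?thesis using u one by (intro exI[of _ "\<lambda>_. 1"] conjI) (auto simp: F'_def V'_def)
    qed
  qed
  \<comment> \<open>The invariant includes \<open>P i x \<in> {0..1}\<close>: the clamp supplies it,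
    and the next multiplication requires it.\<close>
  have "\<exists>P. computes a w S inp (V' <+> I) (case_sum F' P) (Suc L + r * (k + 3)) (M + Q + r * (k + 3) * Q) b
    \<and> (\<forall>i\<in>I. \<forall>x\<in>S. P i x \<in> {0..1} \<and> \<bar>P i x - (\<Prod>r<r. F' (f i r) x)\<bar> \<le> real r / 4 ^ k)" for r
  proof (induction r)
    case 0
    then show ?case using start by (intro exI[of _ "\<lambda>_ _. 1"]) auto
  next
    case (Suc r)
    then obtain P where P: "computes a w S inp (V' <+> I) (case_sum F' P) (Suc L + r * (k + 3)) (M + Q + r * (k + 3) * Q) b"
      "\<And>i x. i \<in> I \<Longrightarrow> x \<in> S \<Longrightarrow> P i x \<in> {0..1}"
      "\<And>i x. i \<in> I \<Longrightarrow> x \<in> S \<Longrightarrow> \<bar>P i x - (\<Prod>r<r. F' (f i r) x)\<bar> \<le> real r / 4 ^ k" by blast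
    define P' where "P' = (\<lambda>i x. approx_mult k (P i x) (F' (f i r) x))"
    have "computes a w S inp (V' <+> I) (case_sum F' P') (Suc L + r * (k + 3) + (k + 3))
      (M + Q + r * (k + 3) * Q + (k + 3) * (card V' + 12 * card I + 1)\<^sup>2) b"
      unfolding P'_def
      by (rule computes_mult[OF P(1)]) (use F' P(2) f b w cardV' in auto)
    then have "computes a w S inp (V' <+> I) (case_sum F' P') (Suc L + Suc r * (k + 3))
      (M + Q + Suc r * (k + 3) * Q) b"
      by (simp add: Q_def cardV' algebra_simps)
    moreover have "\<bar>P' i x - (\<Prod>r<Suc r. F' (f i r) x)\<bar> \<le> real (Suc r) / 4 ^ k" if i: "i \<in> I" "x \<in> S" for i x
    proof -
      define p q where "p = (\<Prod>r<r. F' (f i r) x)" and "q = F' (f i r) x"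
      have q: "0 \<le> q" "q \<le> 1" using F'[OF f[OF i(1)] i(2)] by (auto simp: q_def)
      have "\<bar>P' i x - P i x * q\<bar> \<le> 1 / 4 ^ k"
        unfolding P'_def q_def by (rule approx_mult_error[OF P(2)[OF i] F'[OF f[OF i(1)] i(2)]])
      moreover have "\<bar>P i x * q - p * q\<bar> \<le> real r / 4 ^ k"
      proof -
        have "\<bar>P i x * q - p * q\<bar> = \<bar>P i x - p\<bar> * q"
          using q by (simp add: left_diff_distrib[symmetric] abs_mult)
        also have "\<dots> \<le> \<bar>P i x - p\<bar>" using q by (simp add: mult_left_le)
        finally show ?thesis using P(3)[OF i] by (simp add: p_def)
      qed
      ultimately have "\<bar>P' i x - p * q\<bar> \<le> 1 / 4 ^ k + real r / 4 ^ k" by linarith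
      then show ?thesis by (simp add: p_def q_def add_divide_distrib)
    qed
    moreover have "P' i x \<in> {0..1}" for i x
      unfolding P'_def by (rule approx_mult_unit)
    ultimately show ?case by blast
  qed
  then obtain P where P: "computes a w S inp (V' <+> I) (case_sum F' P) (Suc L + R * (k + 3)) (M + Q + R * (k + 3) * Q) b"
    "\<And>i x. i \<in> I \<Longrightarrow> x \<in> S \<Longrightarrow> \<bar>P i x - (\<Prod>r<R. F' (f i r) x)\<bar> \<le> real R / 4 ^ k"
    by metis
  have "computes a w S inp I (\<lambda>i. case_sum F' P (Inr i)) (Suc L + R * (k + 3)) (M + Q + R * (k + 3) * Q) b"
    by (rule computes_reindex[OF P(1)]) auto
  then have "computes a w S inp I P (Suc L + R * (k + 3)) (M + (R * (k + 3) + 1) * Q) b"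
    by (simp add: algebra_simps)
  moreover have "(\<Prod>r<R. F' (f i r) x) = prod_list (map (\<lambda>v. F v x) (facs i))" if "i \<in> I" for i x
    unfolding prod_padded_list[OF I(3)[OF that], symmetric]
    by (intro prod.cong) (auto simp: F'_def f_def)
  ultimately show ?thesis
    using P(2) unfolding Q_def by (intro exI[of _ P]) auto
qed

section \<open>Partition of unity and cell index\<close>

definition ramp :: "real \<Rightarrow> nat \<Rightarrow> real" where
  "ramp v j = max (v - real j) 0 - max (v - real (j + 1)) 0"

text \<open>On \<open>[j/N, (j+1)/N]\<close> the variable \<open>v = 4 N t - 4 j\<close> runs through four unit intervals:
  the staircase \<open>stair False\<close> climbs on the first, where \<open>bump False\<close> vanishes; \<open>bump False\<close> rises
  on the second and falls on the fourth; \<open>stair True\<close> climbs on the third, where \<open>bump True\<close> vanishes.\<close>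
definition stair :: "nat \<Rightarrow> bool \<Rightarrow> real \<Rightarrow> real" where
  "stair N c t = (\<Sum>i<N. ramp (4 * real N * t) (4 * i + (if c then 2 else 0)))"

definition bump :: "nat \<Rightarrow> bool \<Rightarrow> real \<Rightarrow> real" where
  "bump N c t = (let u = \<Sum>i<N. ramp (4 * real N * t) (4 * i + 1) - ramp (4 * real N * t) (4 * i + 3)
     in if c then 1 - u else u)"

lemma bump_partition: "bump N True t + bump N False t = 1"
  by (simp add: bump_def Let_def)

lemma ramp_nonneg: "0 \<le> ramp v j"
  by (auto simp: ramp_def max_def)

lemma stair_nonneg: "0 \<le> stair N c t"
  unfolding stair_def by (intro sum_nonneg ramp_nonneg)

text \<open>While \<open>v\<close> is in period \<open>j\<close>, the ramps of earlier periods have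
  reached 1 and those of later periods have not started, so only the ramp of period \<open>j\<close>
  itself remains visible.\<close>

lemma sum_ramps:
  assumes "4 * real j \<le> v" "v \<le> 4 * real j + 4" "j < N" "r < 4"
  shows "(\<Sum>i<N. ramp v (4 * i + r)) = real j + ramp v (4 * j + r)"
proof -
  have "ramp v (4 * i + r) = (if i < j then 1 else 0) + (if i = j then ramp v (4 * j + r) else 0)" for i
  proof -
    consider "i < j" | "i = j" | "j < i" by linarith
    then show ?thesis
    proof cases
      case 1
      then have "4 * i + r + 1 \<le> 4 * j" using assms(4) by linarith
      then have "real (4 * i + r + 1) \<le> real (4 * j)" by (simp only: of_nat_le_iff)
      then have "real (4 * i + r + 1) \<le> v" using assms(1) by simp
      then show ?thesis using 1 by (simp add: ramp_def)
    next
      case 3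
      then have "4 * j + 4 \<le> 4 * i + r" by linarith
      then have "real (4 * j + 4) \<le> real (4 * i + r)" by (simp only: of_nat_le_iff)
      then have "v \<le> real (4 * i + r)" using assms(2) by simp
      then show ?thesis using 3 by (simp add: ramp_def)
    qed simp
  qed
  then have "(\<Sum>i<N. ramp v (4 * i + r))
      = (\<Sum>i<N. if i < j then 1 else 0) + (\<Sum>i<N. if i = j then ramp v (4 * j + r) else 0)"
    by (simp add: sum.distrib)
  also have "(\<Sum>i<N. if i < j then 1 else (0::real)) = real j"
  proof -
    have "{..<N} \<inter> {i. i < j} = {..<j}" using assms(3) by auto
    then show ?thesis by (simp add: sum.If_cases)
  qed
  also have "(\<Sum>i<N. if i = j then ramp v (4 * j + r) else 0) = ramp v (4 * j + r)"
    using assms(3) by (simp add: sum.delta')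
  finally show ?thesis .
qed

lemma grid_cell:
  assumes "t \<in> {0..1}" "1 \<le> N"
  obtains j where "j < N" "4 * real j \<le> 4 * real N * t" "4 * real N * t \<le> 4 * real j + 4"
\<comment> \<open>At \<open>t = 1\<close> the floor would give the cell \<open>N\<close>, which does
  not exist; this point belongs to the last cell.\<close>
proof (cases "t = 1")
  case True
  then show ?thesis using assms(2) by (intro that[of "N - 1"]) auto
next
  case False
  then have t: "0 \<le> t" "t < 1" using assms(1) by auto
  define j where "j = nat \<lfloor>real N * t\<rfloor>"
  have j: "real j \<le> real N * t" "real N * t < real j + 1"
    using t by (simp_all add: j_def)
  have "real N * t < real N" using t assms(2) by simp
  with j have "j < N" by simp
  then show ?thesis using j by (intro that[of j]) auto
qed

lemma stair_bump_local:
  assumes "t \<in> {0..1}" "1 \<le> N"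
  obtains j u where "j < N" "0 \<le> u" "u \<le> 4" "4 * real N * t = 4 * real j + u"
    "stair N c t = real j + (if c then max (u - 2) 0 - max (u - 3) 0 else max u 0 - max (u - 1) 0)"
    "bump N False t = (max (u - 1) 0 - max (u - 2) 0) - (max (u - 3) 0 - max (u - 4) 0)"
proof -
  obtain j where j: "j < N" "4 * real j \<le> 4 * real N * t" "4 * real N * t \<le> 4 * real j + 4"
    using grid_cell[OF assms] by blast
  show ?thesis
  proof (rule that[of j "4 * real N * t - 4 * real j"])
    show "stair N c t = real j + (if c then max (4 * real N * t - 4 * real j - 2) 0 - max (4 * real N * t - 4 * real j - 3) 0
        else max (4 * real N * t - 4 * real j) 0 - max (4 * real N * t - 4 * real j - 1) 0)"
      unfolding stair_def by (subst sum_ramps[OF j(2,3,1)]) (auto simp: ramp_def algebra_simps)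
    show "bump N False t = (max (4 * real N * t - 4 * real j - 1) 0 - max (4 * real N * t - 4 * real j - 2) 0)
        - (max (4 * real N * t - 4 * real j - 3) 0 - max (4 * real N * t - 4 * real j - 4) 0)"
      unfolding bump_def Let_def sum_subtractf
      by (subst sum_ramps[OF j(2,3,1)], simp, subst sum_ramps[OF j(2,3,1)]) (auto simp: ramp_def algebra_simps)
  qed (use j in auto)
qed

lemma bump_unit:
  assumes "t \<in> {0..1}" "1 \<le> N"
  shows "bump N c t \<in> {0..1}"
proof -
  obtain j u where "0 \<le> u" "u \<le> 4"
    "bump N False t = (max (u - 1) 0 - max (u - 2) 0) - (max (u - 3) 0 - max (u - 4) 0)"
    using stair_bump_local[OF assms] by metis
  then have "bump N False t \<in> {0..1}" by (auto simp: max_def)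
  then show ?thesis using bump_partition[of N t] by (cases c) auto
qed

text \<open>The staircase climbs only where the bump of the same colour vanishes, so it is an
  integer on the support. That integer is the index of one of the two endpoints of the cell of
  \<open>t\<close>; it ranges over \<open>0..N\<close>, and tables need \<open>N + 1\<close> entries
  per coordinate.\<close>

lemma stair_on_bump:
  assumes "t \<in> {0..1}" "1 \<le> N" "bump N c t \<noteq> 0"
  shows "\<exists>q\<le>N. stair N c t = real q \<and> \<bar>t - real q / real N\<bar> \<le> 1 / real N"
proof -
  obtain j u where j: "j < N" and u: "0 \<le> u" "u \<le> 4" "4 * real N * t = 4 * real j + u"
    "stair N c t = real j + (if c then max (u - 2) 0 - max (u - 3) 0 else max u 0 - max (u - 1) 0)"
    "bump N False t = (max (u - 1) 0 - max (u - 2) 0) - (max (u - 3) 0 - max (u - 4) 0)"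
    using stair_bump_local[OF assms(1,2), of c] by metis
  have eq: "t - real q / real N = (4 * real N * t - 4 * real q) / (4 * real N)" for q
    using assms(2) by (simp add: field_simps)
  have dist: "\<bar>t - real q / real N\<bar> \<le> 1 / real N" if "\<bar>4 * real N * t - 4 * real q\<bar> \<le> 4" for q
    unfolding eq using that assms(2) by (simp add: divide_simps)
  have "stair N c t = real j \<and> u \<le> 4 \<or> stair N c t = real (Suc j)"
  proof (cases c)
    case True
    then have "bump N False t \<noteq> 1" using assms(3) bump_partition[of N t] by auto
    then have "u < 2 \<or> u > 3" using u by (auto simp: max_def split: if_splits)
    then show ?thesis using True u by (auto simp: max_def)
  next
    case False
    then have "u > 1" using assms(3) u by (auto simp: max_def split: if_splits)
    then show ?thesis using False u by (auto simp: max_def)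
  qed
  then show ?thesis
  proof
    assume "stair N c t = real j \<and> u \<le> 4"
    then show ?thesis using j u by (intro exI[of _ j] conjI dist) auto
  next
    assume "stair N c t = real (Suc j)"
    then show ?thesis using j u by (intro exI[of _ "Suc j"] conjI dist) auto
  qed
qed

section \<open>Cell indices, colours and table lookup\<close>

definition digit :: "nat \<Rightarrow> nat \<Rightarrow> nat \<Rightarrow> nat" where
  "digit B y i = y div B ^ i mod B"

lemma digit_expansion:
  assumes "\<And>i. i < m \<Longrightarrow> q i < B"
  shows "(\<Sum>i<m. q i * B ^ i) < B ^ m \<and> (\<forall>i<m. digit B (\<Sum>i<m. q i * B ^ i) i = q i)"
  using assms
proof (induction m arbitrary: q)
  case (Suc m)
  have q0: "q 0 < B" and B: "0 < B" using Suc.prems[of 0] by (cases B; auto)+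
  define y where "y = (\<Sum>i<m. q (Suc i) * B ^ i)"
  have sum: "(\<Sum>i<Suc m. q i * B ^ i) = q 0 + B * y"
    by (simp only: sum.lessThan_Suc_shift) (simp add: y_def sum_distrib_left mult_ac)
  have y: "y < B ^ m" "\<And>i. i < m \<Longrightarrow> digit B y i = q (Suc i)"
    using Suc.IH[of "\<lambda>i. q (Suc i)"] Suc.prems by (auto simp: y_def)
  have "B * (y + 1) \<le> B * B ^ m" using y(1) by (intro mult_le_mono) auto
  then have less: "q 0 + B * y < B ^ Suc m" using q0 by (simp add: algebra_simps)
  have "digit B (q 0 + B * y) i = q i" if "i < Suc m" for i
  proof (cases i)
    case 0
    then show ?thesis using q0 by (simp add: digit_def)
  next
    case (Suc i')
    have "digit B (q 0 + B * y) (Suc i') = digit B y i'"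
      using q0 B by (simp add: digit_def div_mult2_eq)
    then show ?thesis using y(2) that Suc by simp
  qed
  with less show ?case unfolding sum by blast
qed simp

text \<open>The product of the sums \<open>h i True + h i False\<close>, multiplied out: a Boolean
  list, that is a colour, chooses one summand per coordinate.\<close>

lemma colour_partition:
  fixes h :: "nat \<Rightarrow> bool \<Rightarrow> 'a::comm_semiring_1"
  assumes "\<And>i. h i True + h i False = 1"
  shows "(\<Sum>c | length c = m. \<Prod>i<m. h i (c ! i)) = 1"
  using assms
proof (induction m arbitrary: h)
  case (Suc m)
  have img: "{c :: bool list. length c = Suc m} = (\<lambda>(b, c). b # c) ` (UNIV \<times> {c. length c = m})"
    by (auto simp: length_Suc_conv image_iff)
  have inj: "inj_on (\<lambda>(b, c). b # c) (UNIV \<times> {c :: bool list. length c = m})"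
    by (auto simp: inj_on_def)
  have "(\<Sum>c | length c = Suc m. \<Prod>i<Suc m. h i (c ! i))
      = (\<Sum>(b, c)\<in>UNIV \<times> {c. length c = m}. h 0 b * (\<Prod>i<m. h (Suc i) (c ! i)))"
    unfolding img by (subst sum.reindex[OF inj]) (simp add: case_prod_unfold prod.lessThan_Suc_shift del: prod.lessThan_Suc)
  also have "\<dots> = (\<Sum>b\<in>UNIV. h 0 b * (\<Sum>c | length c = m. \<Prod>i<m. h (Suc i) (c ! i)))"
    by (simp add: sum.cartesian_product[symmetric] sum_distrib_left)
  also have "\<dots> = 1"
    using Suc.IH[of "\<lambda>i. h (Suc i)"] Suc.prems by (simp add: UNIV_bool add.commute)
  finally show ?case .
qed simp

text \<open>A second difference of ReLUs is the hat of half-width 1 around \<open>K\<close>. At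
  integers it is a Kronecker delta, which makes a table lookup a linear combination of such
  hats.\<close>

lemma hat_of_nat:
  "max (real y - real K + 1) 0 - 2 * max (real y - real K) 0 + max (real y - real K - 1) 0
    = (if K = y then 1 else 0)"
proof -
  consider "K = y" | "K + 1 \<le> y" | "y + 1 \<le> K" by linarith
  then show ?thesis
  proof cases
    case 2
    then have "real (K + 1) \<le> real y" by (simp only: of_nat_le_iff)
    then show ?thesis using 2 by simp
  next
    case 3
    then have "real (y + 1) \<le> real K" by (simp only: of_nat_le_iff)
    then show ?thesis using 3 by simp
  qed simp
qed

text \<open>Wide and bounded layers alternate: ramps of the coordinates, then stairs and bumps, then
  the hats of all \<open>(N + 1) ^ m\<close> index values, then the table values and their clamp.
  Where a bump vanishes, only \<open>U t x \<in> {0..1}\<close> is claimed, as the staircase may lie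
  between two integers. The first \<open>m\<close> of the \<open>m'\<close> inputs form the index;
  the others are carried.\<close>

lemma computes_lookup:
  fixes table :: "'b \<Rightarrow> (nat \<Rightarrow> nat) \<Rightarrow> real" and \<xi> :: "nat \<Rightarrow> 'x \<Rightarrow> real"
  assumes comp: "computes a w S inp {..<m'} \<xi> 0 0 b"
    and \<xi>: "\<And>u x. u < m' \<Longrightarrow> x \<in> S \<Longrightarrow> \<xi> u x \<in> {0..1}"
    and m: "1 \<le> m" "m \<le> m'" and N: "1 \<le> N" and Lk: "finite Lk"
    and table: "\<And>l q. l \<in> Lk \<Longrightarrow> (\<And>i. i < m \<Longrightarrow> q i \<le> N) \<Longrightarrow> table l q \<in> {0..1}"
    and b: "(real m + 12) * (real N + 1) ^ m \<le> b"
    and w: "\<kappa> * (N + 1) ^ m \<le> w"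
    and \<kappa>_def: "\<kappa> = m' + 4 * m + 3 * 2 ^ m + 2 ^ m * card Lk + 1"
  shows "\<exists>U. computes a w S inp (({..<m'} <+> UNIV \<times> {..<m}) <+> {c. length c = m} \<times> Lk)
      (case_sum (case_sum \<xi> (\<lambda>(c, i) x. bump N c (\<xi> i x))) U) 5 (5 * \<kappa>\<^sup>2 * (N + 1) ^ m) b
    \<and> (\<forall>t\<in>{c. length c = m} \<times> Lk. \<forall>x\<in>S. U t x \<in> {0..1})
    \<and> (\<forall>c x. length c = m \<longrightarrow> x \<in> S \<longrightarrow> (\<forall>i<m. bump N (c ! i) (\<xi> i x) \<noteq> 0)
        \<longrightarrow> (\<exists>q. (\<forall>i<m. q i \<le> N \<and> \<bar>\<xi> i x - real (q i) / real N\<bar> \<le> 1 / real N) \<and> (\<forall>l\<in>Lk. U (c, l) x = table l q)))"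
proof -
  define G where "G = (N + 1) ^ m"
  have G: "N + 1 \<le> G" using m(1) self_le_power[of "N + 1" m] by (simp add: G_def)
  have rG: "real G = (real N + 1) ^ m" by (simp add: G_def add.commute)
  have rN: "real N + 1 \<le> real G" using of_nat_mono[OF G, where ?'a = real] by simp
  have bG: "(real m + 12) * real G \<le> b"
    using b unfolding rG .
  moreover have "0 \<le> (real m + 12) * real G" by simp
  ultimately have b0: "0 \<le> b" by linarith
  have wG: "\<kappa> * G \<le> w" using w by (simp add: G_def)
  have b12: "12 * real G \<le> b"
    using bG mult_nonneg_nonneg[of "real m" "real G"] unfolding distrib_right by linarith
  have b1: "1 \<le> b" using b12 rN by linarith
  define CC where "CC = {c :: bool list. length c = m}"
  have CC: "finite CC" "card CC = 2 ^ m"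
  proof -
    have "CC = {c. set c \<subseteq> (UNIV :: bool set) \<and> length c = m}" by (auto simp: CC_def)
    then show "finite CC" "card CC = 2 ^ m"
      using finite_lists_length_eq[of "UNIV :: bool set" m] card_lists_length_eq[of "UNIV :: bool set" m] by auto
  qed
  have bump: "bump N c (\<xi> i x) \<in> {0..1}" if "i < m" "x \<in> S" for c i x
    using \<xi>[of i x] that m by (intro bump_unit N) auto
  define V1 where "V1 = {..<m'} <+> {..<m} \<times> {..4 * N}"
  define \<phi>1 where "\<phi>1 = case_sum \<xi> (\<lambda>(i, j) x. max (4 * real N * \<xi> i x - real j) 0)"
  define V2 where "V2 = {..<m'} <+> (UNIV :: bool set) \<times> (UNIV :: bool set) \<times> {..<m}"
  define \<phi>2 where "\<phi>2 = case_sum \<xi> (\<lambda>(k, c, i) x. if k then bump N c (\<xi> i x) else stair N c (\<xi> i x))"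
  define carry where "carry = case_sum \<xi> (\<lambda>(c, i) x. bump N c (\<xi> i x))"
  define VC where "VC = {..<m'} <+> (UNIV :: bool set) \<times> {..<m}"
  \<comment> \<open>The base is \<open>N + 1\<close> because each staircase takes values in
    \<open>0..N\<close> on the support: distinct index vectors get distinct integers.\<close>
  define idx where "idx = (\<lambda>c x. \<Sum>i<m. (real N + 1) ^ i * stair N (c ! i) (\<xi> i x))"
  define V3 where "V3 = VC <+> CC \<times> {..<G} \<times> {..<3::nat}"
  \<comment> \<open>The three values of \<open>t\<close> are the three ReLUs of the hat at
    \<open>K\<close>.\<close>
  define \<phi>3 where "\<phi>3 = case_sum carry (\<lambda>(c, K, t) x. max (idx c x - real K + 1 - real t) 0)"
  define val where "val = (\<lambda>l K. table l (digit (N + 1) K))"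
  define T where "T = (\<lambda>(c, l) x. \<Sum>K<G. val l K * (\<phi>3 (Inr (c, K, 0)) x - 2 * \<phi>3 (Inr (c, K, 1)) x + \<phi>3 (Inr (c, K, 2)) x))"
  define V5 where "V5 = VC <+> CC \<times> Lk"
  have finV: "finite V1" "finite V2" "finite V3" "finite VC" "finite V5"
    using CC Lk by (auto simp: V1_def V2_def V3_def VC_def V5_def)
  have mG: "m * (4 * N + 1) \<le> m * (4 * G)" using G by (intro mult_le_mono2) simp
  have G1: "1 \<le> G" using G by simp
  have \<kappa>G: "\<kappa> * G = m' * G + 4 * m * G + 3 * 2 ^ m * G + 2 ^ m * card Lk * G + G"
    by (simp add: \<kappa>_def algebra_simps)
  have mono: "x \<le> x * G" for x :: nat using G1 by simp
  have c1: "card V1 + 1 \<le> \<kappa> * G"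
  proof -
    have "card V1 = m' + m * (4 * N + 1)"
      by (simp add: V1_def card_Plus card_cartesian_product)
    moreover have "m * (4 * N + 1) \<le> 4 * m * G" using mG by (simp add: mult_ac)
    ultimately show ?thesis using mono[of m'] G1 unfolding \<kappa>G by linarith
  qed
  have c2: "card V2 + 1 \<le> \<kappa>"
    by (simp add: V2_def card_Plus card_cartesian_product \<kappa>_def)
  have cVC: "card VC = m' + 2 * m"
    by (simp add: VC_def card_Plus card_cartesian_product)
  have c3: "card V3 + 1 \<le> \<kappa> * G"
  proof -
    have "card V3 = m' + 2 * m + 2 ^ m * (G * 3)"
      using finV CC by (simp add: V3_def card_Plus card_cartesian_product cVC)
    moreover have "2 ^ m * (G * 3) = 3 * 2 ^ m * G" by simp
    moreover have "2 * m \<le> 4 * m * G" using mono[of "4 * m"] by linarith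
    ultimately show ?thesis using mono[of m'] G1 unfolding \<kappa>G by linarith
  qed
  have c5: "card V5 + 1 \<le> \<kappa>"
    using finV CC Lk by (simp add: V5_def card_Plus card_cartesian_product cVC \<kappa>_def)
  have \<kappa>le: "\<kappa> \<le> \<kappa> * G" by (rule mono)
  \<comment> \<open>Of two neighbouring layers at most one is wide. A dense weight matrix between
    them has at most \<open>\<kappa> * (\<kappa> * G)\<close> entries, linear in the number
    \<open>G\<close> of index values.\<close>
  have q: "x * y \<le> \<kappa>\<^sup>2 * G" if "x \<le> \<kappa> \<and> y \<le> \<kappa> * G \<or> x \<le> \<kappa> * G \<and> y \<le> \<kappa>" for x y
    using that mult_le_mono[of x \<kappa> y "\<kappa> * G"] mult_le_mono[of x "\<kappa> * G" y \<kappa>]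
    by (auto simp: power2_eq_square mult_ac)
  have cm: "m' + 1 \<le> \<kappa>" by (simp add: \<kappa>_def)
  have pos\<xi>: "max (\<xi> u x) 0 = \<xi> u x" if "u < m'" "x \<in> S" for u x
    using \<xi>[OF that] by auto
  have posC: "max (carry u x) 0 = carry u x" if "u \<in> VC" "x \<in> S" for u x
    using that pos\<xi> bump by (fastforce simp: VC_def carry_def)
  have net1: "computes a w S inp V1 \<phi>1 1 (\<kappa>\<^sup>2 * G) b"
  proof -
    have "computes a w S inp V1 \<phi>1 (Suc 0) (0 + card V1 * (card {..<m'} + 1)) b"
    proof (rule computes_step[OF comp b0 finV(1)])
      show "card V1 \<le> w" using c1 wG by linarith
      fix u assume u: "u \<in> V1"
      have base: "affine_comb S {..<m'} \<xi> 1 (\<xi> i)" if "i < m'" for i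
        by (rule affine_comb_base) (use that in auto)
      show "\<exists>g. affine_comb S {..<m'} \<xi> b g \<and> (\<forall>x\<in>S. \<phi>1 u x = max (g x) 0)"
      proof (cases u)
        case (Inl i)
        then have "i < m'" using u by (auto simp: V1_def)
        then show ?thesis using affine_comb_mono[OF base b1] pos\<xi>
          by (intro exI[of _ "\<xi> i"]) (auto simp: Inl \<phi>1_def)
      next
        case (Inr p)
        then obtain i j where p: "u = Inr (i, j)" "i < m" "j \<le> 4 * N"
          using u by (cases p) (auto simp: V1_def)
        have i: "i < m'" using p m by simp
        have "real j \<le> 4 * real N" using p(3) by (metis of_nat_le_iff of_nat_mult of_nat_numeral)
        then have "affine_comb S {..<m'} \<xi> b (\<lambda>x. (4 * real N) * \<xi> i x + - real j)"
          by (intro affine_comb_mono[OF affine_comb_add[OF affine_comb_scale[OF base[OF i]] affine_comb_const[OF order_refl]]])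
            (use b12 rN in simp)
        then show ?thesis by (intro exI conjI) (auto simp: p \<phi>1_def)
      qed
    qed
    then show ?thesis
      using q[of "card V1" "m' + 1"] c1 cm by (auto elim!: computes_mono)
  qed
  have net2: "computes a w S inp V2 \<phi>2 2 (2 * (\<kappa>\<^sup>2 * G)) b"
  proof -
    have "computes a w S inp V2 \<phi>2 (Suc 1) (\<kappa>\<^sup>2 * G + card V2 * (card V1 + 1)) b"
    proof (rule computes_step[OF net1 b0 finV(2)])
      show "card V2 \<le> w" using c2 wG \<kappa>le by linarith
      fix u assume u: "u \<in> V2"
      have base: "affine_comb S V1 \<phi>1 1 (\<phi>1 v)" if "v \<in> V1" for v
        by (rule affine_comb_base) (use that finV in auto)
      have ramp: "affine_comb S V1 \<phi>1 2 (\<lambda>x. ramp (4 * real N * \<xi> i x) j)" if "i < m" "j < 4 * N" for i j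
      proof -
        have "affine_comb S V1 \<phi>1 (1 + \<bar>- 1\<bar> * 1) (\<lambda>x. \<phi>1 (Inr (i, j)) x + (- 1) * \<phi>1 (Inr (i, j + 1)) x)"
          by (intro affine_comb_add affine_comb_scale base) (use that in \<open>auto simp: V1_def\<close>)
        then show ?thesis by (simp add: \<phi>1_def ramp_def)
      qed
      have stair: "affine_comb S V1 \<phi>1 (real N * 2) (\<lambda>x. stair N c (\<xi> i x))" if "i < m" for c i
      proof -
        have "affine_comb S V1 \<phi>1 (\<Sum>j<N. 2) (\<lambda>x. \<Sum>j<N. ramp (4 * real N * \<xi> i x) (4 * j + (if c then 2 else 0)))"
          by (intro affine_comb_sum ramp that) auto
        then show ?thesis by (simp add: stair_def)
      qed
      have bump0: "affine_comb S V1 \<phi>1 (real N * 4) (\<lambda>x. bump N False (\<xi> i x))" if "i < m" for i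
      proof -
        have "affine_comb S V1 \<phi>1 (\<Sum>j<N. 2 + \<bar>- 1\<bar> * 2)
          (\<lambda>x. \<Sum>j<N. ramp (4 * real N * \<xi> i x) (4 * j + 1) + (- 1) * ramp (4 * real N * \<xi> i x) (4 * j + 3))"
          by (intro affine_comb_sum affine_comb_add affine_comb_scale ramp that) auto
        then show ?thesis by (simp add: bump_def Let_def)
      qed
      have bump1: "affine_comb S V1 \<phi>1 (1 + real N * 4) (\<lambda>x. bump N c (\<xi> i x))" if "i < m" for c i
      proof (cases c)
        case True
        have "affine_comb S V1 \<phi>1 (\<bar>1\<bar> + \<bar>- 1\<bar> * (real N * 4)) (\<lambda>x. 1 + (- 1) * bump N False (\<xi> i x))"
          by (intro affine_comb_add affine_comb_scale bump0[OF that] affine_comb_const) simp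
        moreover have "bump N True (\<xi> i x) = 1 + (- 1) * bump N False (\<xi> i x)" for x
          using bump_partition[of N "\<xi> i x"] by simp
        ultimately show ?thesis using True by simp
      qed (use affine_comb_mono[OF bump0[OF that]] in auto)
      show "\<exists>g. affine_comb S V1 \<phi>1 b g \<and> (\<forall>x\<in>S. \<phi>2 u x = max (g x) 0)"
      proof (cases u)
        case (Inl i)
        then have i: "i < m'" using u by (auto simp: V2_def)
        then have "Inl i \<in> V1" by (auto simp: V1_def)
        from affine_comb_mono[OF base[OF this] b1] show ?thesis using pos\<xi> i
          by (intro exI[of _ "\<xi> i"]) (auto simp: Inl \<phi>2_def \<phi>1_def)
      next
        case (Inr p)
        then obtain k c i where p: "u = Inr (k, c, i)" "i < m"
          using u by (cases p) (auto simp: V2_def)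
        show ?thesis
        proof (cases k)
          case True
          then show ?thesis using affine_comb_mono[OF bump1[OF p(2)], of b c] b12 rN bump[OF p(2)]
            by (intro exI[of _ "\<lambda>x. bump N c (\<xi> i x)"]) (auto simp: p \<phi>2_def)
        next
          case False
          then show ?thesis using affine_comb_mono[OF stair[OF p(2)], of b c] b12 rN stair_nonneg[of N c]
            by (intro exI[of _ "\<lambda>x. stair N c (\<xi> i x)"]) (auto simp: p \<phi>2_def)
        qed
      qed
    qed
    then show ?thesis
      using q[of "card V2" "card V1 + 1"] c1 c2 by (auto elim!: computes_mono simp: numeral_2_eq_2)
  qed
  have net3: "computes a w S inp V3 \<phi>3 3 (3 * (\<kappa>\<^sup>2 * G)) b"
  proof -
    have "computes a w S inp V3 \<phi>3 (Suc 2) (2 * (\<kappa>\<^sup>2 * G) + card V3 * (card V2 + 1)) b"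
    proof (rule computes_step[OF net2 b0 finV(3)])
      show "card V3 \<le> w" using c3 wG by linarith
      fix u assume u: "u \<in> V3"
      have base: "affine_comb S V2 \<phi>2 1 (\<phi>2 v)" if "v \<in> V2" for v
        by (rule affine_comb_base) (use that finV in auto)
      show "\<exists>g. affine_comb S V2 \<phi>2 b g \<and> (\<forall>x\<in>S. \<phi>3 u x = max (g x) 0)"
      proof (cases u)
        case (Inl v)
        then have v: "v \<in> VC" using u by (auto simp: V3_def)
        have "\<exists>v'\<in>V2. \<phi>2 v' = carry v"
        proof (cases v)
          case (Inl i)
          then show ?thesis using v by (intro bexI[of _ "Inl i"]) (auto simp: VC_def V2_def \<phi>2_def carry_def)
        next
          case (Inr p)
          then show ?thesis using v by (intro bexI[of _ "Inr (True, fst p, snd p)"])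
            (auto simp: VC_def V2_def \<phi>2_def carry_def)
        qed
        then have "affine_comb S V2 \<phi>2 b (carry v)"
          using affine_comb_mono[OF base b1] by metis
        then show ?thesis using posC[OF v] by (intro exI[of _ "carry v"]) (auto simp: Inl \<phi>3_def)
      next
        case (Inr p)
        then obtain c K t where p: "u = Inr (c, K, t)" "K < G" "t < 3"
          using u by (cases p) (auto simp: V3_def)
        have "affine_comb S V2 \<phi>2 (\<Sum>i<m. \<bar>(real N + 1) ^ i\<bar> * 1) (\<lambda>x. \<Sum>i<m. (real N + 1) ^ i * \<phi>2 (Inr (False, c ! i, i)) x)"
          by (intro affine_comb_sum affine_comb_scale base) (auto simp: V2_def)
        then have "affine_comb S V2 \<phi>2 (real m * real G) (idx c)"
        proof (rule affine_comb_mono[OF affine_comb_cong])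
          have "(\<Sum>i<m. \<bar>(real N + 1) ^ i\<bar> * 1) \<le> (\<Sum>i<m. real G)"
            unfolding rG by (intro sum_mono) (auto intro!: power_increasing)
          then show "(\<Sum>i<m. \<bar>(real N + 1) ^ i\<bar> * 1) \<le> real m * real G" by simp
        qed (simp add: \<phi>2_def idx_def)
        then have "affine_comb S V2 \<phi>2 (real m * real G + \<bar>1 - real K - real t\<bar>) (\<lambda>x. idx c x + (1 - real K - real t))"
          by (intro affine_comb_add affine_comb_const) auto
        moreover have "real m * real G + \<bar>1 - real K - real t\<bar> \<le> b"
        proof -
          have "real K \<le> real G" "real t \<le> 3" using p by auto
          then have "\<bar>1 - real K - real t\<bar> \<le> 12 * real G" using rN by (simp add: abs_if)
          then show ?thesis using bG by (simp add: distrib_right)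
        qed
        ultimately have "affine_comb S V2 \<phi>2 b (\<lambda>x. idx c x + (1 - real K - real t))"
          by (rule affine_comb_mono)
        then show ?thesis by (intro exI conjI) (auto simp: p \<phi>3_def algebra_simps)
      qed
    qed
    then show ?thesis
      using q[of "card V3" "card V2 + 1"] c3 c2 by (auto elim!: computes_mono simp: numeral_3_eq_3 numeral_2_eq_2)
  qed
  have net4: "computes a w S inp V5 (case_sum carry (\<lambda>t x. max (1 - T t x) 0)) 4 (4 * (\<kappa>\<^sup>2 * G)) b"
  proof -
    have "computes a w S inp V5 (case_sum carry (\<lambda>t x. max (1 - T t x) 0)) (Suc 3) (3 * (\<kappa>\<^sup>2 * G) + card V5 * (card V3 + 1)) b"
    proof (rule computes_step[OF net3 b0 finV(5)])
      show "card V5 \<le> w" using c5 wG \<kappa>le by linarith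
      fix u assume u: "u \<in> V5"
      have base: "affine_comb S V3 \<phi>3 1 (\<phi>3 v)" if "v \<in> V3" for v
        by (rule affine_comb_base) (use that finV in auto)
      show "\<exists>g. affine_comb S V3 \<phi>3 b g \<and> (\<forall>x\<in>S. case_sum carry (\<lambda>t x. max (1 - T t x) 0) u x = max (g x) 0)"
      proof (cases u)
        case (Inl v)
        then have v: "v \<in> VC" using u by (auto simp: V5_def)
        then have "Inl v \<in> V3" by (auto simp: V3_def)
        from affine_comb_mono[OF base[OF this] b1] show ?thesis using posC[OF v]
          by (intro exI[of _ "carry v"]) (auto simp: Inl \<phi>3_def)
      next
        case (Inr p)
        then obtain c l where p: "u = Inr (c, l)" "c \<in> CC" "l \<in> Lk"
          using u by (cases p) (auto simp: V5_def)
        have "affine_comb S V3 \<phi>3 (\<Sum>K<G. \<bar>val l K\<bar> * (1 + \<bar>- 2\<bar> * 1 + 1))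
            (\<lambda>x. \<Sum>K<G. val l K * (\<phi>3 (Inr (c, K, 0)) x + (- 2) * \<phi>3 (Inr (c, K, 1)) x + \<phi>3 (Inr (c, K, 2)) x))"
          by (intro affine_comb_sum affine_comb_scale affine_comb_add base) (use p in \<open>auto simp: V3_def\<close>)
        then have aT: "affine_comb S V3 \<phi>3 (4 * real G) (T (c, l))"
        proof (rule affine_comb_mono[OF affine_comb_cong])
          have "val l K \<in> {0..1}" for K
            unfolding val_def by (rule table[OF p(3)]) (simp add: digit_def flip: less_Suc_eq_le)
          then have "(\<Sum>K<G. \<bar>val l K\<bar> * (1 + \<bar>- 2\<bar> * 1 + 1)) \<le> (\<Sum>K<G. 1 * (4::real))"
            by (intro sum_mono mult_mono) auto
          then show "(\<Sum>K<G. \<bar>val l K\<bar> * (1 + \<bar>- 2\<bar> * 1 + 1)) \<le> 4 * real G" by simp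
        qed (simp add: T_def)
        have "affine_comb S V3 \<phi>3 b (\<lambda>x. 1 + (- 1) * T (c, l) x)"
          by (rule affine_comb_mono, (rule affine_comb_add affine_comb_scale affine_comb_const[OF order_refl] aT)+)
            (use b12 rN in simp)
        then show ?thesis by (intro exI conjI) (auto simp: p)
      qed
    qed
    then show ?thesis
      using q[of "card V5" "card V3 + 1"] c3 c5 by (auto elim!: computes_mono simp: eval_nat_numeral)
  qed
  define U where "U = (\<lambda>t x. clamp_unit (T t x))"
  have net5: "computes a w S inp V5 (case_sum carry U) 5 (5 * (\<kappa>\<^sup>2 * G)) b"
  proof -
    let ?\<phi> = "case_sum carry (\<lambda>t x. max (1 - T t x) 0)"
    have "computes a w S inp V5 (case_sum carry U) (Suc 4) (4 * (\<kappa>\<^sup>2 * G) + card V5 * (card V5 + 1)) b"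
    proof (rule computes_step[OF net4 b0 finV(5)])
      show "card V5 \<le> w" using c5 wG \<kappa>le by linarith
      fix u assume u: "u \<in> V5"
      have base: "affine_comb S V5 ?\<phi> 1 (?\<phi> v)" if "v \<in> V5" for v
        by (rule affine_comb_base) (use that finV in auto)
      show "\<exists>g. affine_comb S V5 ?\<phi> b g \<and> (\<forall>x\<in>S. case_sum carry U u x = max (g x) 0)"
      proof (cases u)
        case (Inl v)
        then have v: "v \<in> VC" using u by (auto simp: V5_def)
        from affine_comb_mono[OF base[OF u] b1] show ?thesis using posC[OF v]
          by (intro exI[of _ "carry v"]) (auto simp: Inl)
      next
        case (Inr p)
        have "affine_comb S V5 ?\<phi> b (\<lambda>x. 1 + (- 1) * ?\<phi> u x)"
          by (rule affine_comb_mono, (rule affine_comb_add affine_comb_scale affine_comb_const[OF order_refl] base[OF u])+)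
            (use b12 rN in simp)
        then show ?thesis by (intro exI conjI) (auto simp: Inr U_def clamp_unit_def)
      qed
    qed
    then show ?thesis
      using q[of "card V5" "card V5 + 1"] c5 \<kappa>le by (auto elim!: computes_mono simp: eval_nat_numeral)
  qed
  have good: "\<exists>q. (\<forall>i<m. q i \<le> N \<and> \<bar>\<xi> i x - real (q i) / real N\<bar> \<le> 1 / real N) \<and> (\<forall>l\<in>Lk. U (c, l) x = table l q)"
    if c: "length c = m" and x: "x \<in> S" and nz: "\<forall>i<m. bump N (c ! i) (\<xi> i x) \<noteq> 0" for c x
  proof -
    have "\<exists>q\<le>N. stair N (c ! i) (\<xi> i x) = real q \<and> \<bar>\<xi> i x - real q / real N\<bar> \<le> 1 / real N" if "i < m" for i
      using stair_on_bump[OF \<xi>[of i x] N] that m x nz by auto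
    then obtain q where q: "\<And>i. i < m \<Longrightarrow> q i \<le> N \<and> stair N (c ! i) (\<xi> i x) = real (q i)
        \<and> \<bar>\<xi> i x - real (q i) / real N\<bar> \<le> 1 / real N" by metis
    define y where "y = (\<Sum>i<m. q i * (N + 1) ^ i)"
    have y: "y < G" "\<And>i. i < m \<Longrightarrow> digit (N + 1) y i = q i"
      using digit_expansion[of m q "N + 1"] q unfolding y_def G_def by (auto simp: less_Suc_eq_le)
    have idx: "idx c x = real y"
      unfolding idx_def y_def using q by (simp add: mult.commute add.commute)
    \<comment> \<open>The witness is the digit function and not \<open>q\<close>: the two agree
      below \<open>m\<close> only, while \<open>table\<close> may depend on all values of its
      argument.\<close>
    define q' where "q' = digit (N + 1) y"
    have "U (c, l) x = table l q'" if l: "l \<in> Lk" for l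
    proof -
      have "T (c, l) x = (\<Sum>K<G. val l K * (max (real y - real K + 1) 0 - 2 * max (real y - real K) 0 + max (real y - real K - 1) 0))"
        by (simp add: T_def \<phi>3_def idx algebra_simps)
      also have "\<dots> = (\<Sum>K<G. if K = y then val l K else 0)"
        unfolding hat_of_nat by (intro sum.cong) auto
      also have "\<dots> = val l y" using y(1) by (simp add: sum.delta)
      finally have "T (c, l) x = table l q'" by (simp add: val_def q'_def)
      moreover have "table l q' \<in> {0..1}"
        by (rule table[OF l]) (use y(2) q in \<open>simp add: q'_def\<close>)
      ultimately show ?thesis by (simp add: U_def clamp_unit_def)
    qed
    then show ?thesis using q y(2) by (intro exI[of _ q']) (simp add: q'_def)
  qed
  show ?thesis
  proof (rule exI[of _ U], intro conjI)
    show "computes a w S inp (({..<m'} <+> UNIV \<times> {..<m}) <+> {c. length c = m} \<times> Lk)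
      (case_sum (case_sum \<xi> (\<lambda>(c, i) x. bump N c (\<xi> i x))) U) 5 (5 * \<kappa>\<^sup>2 * (N + 1) ^ m) b"
      using net5 by (simp add: V5_def VC_def CC_def carry_def G_def mult_ac)
    show "\<forall>t\<in>{c. length c = m} \<times> Lk. \<forall>x\<in>S. U t x \<in> {0..1}"
      by (auto simp: U_def clamp_unit_def)
    show "\<forall>c x. length c = m \<longrightarrow> x \<in> S \<longrightarrow> (\<forall>i<m. bump N (c ! i) (\<xi> i x) \<noteq> 0)
        \<longrightarrow> (\<exists>q. (\<forall>i<m. q i \<le> N \<and> \<bar>\<xi> i x - real (q i) / real N\<bar> \<le> 1 / real N) \<and> (\<forall>l\<in>Lk. U (c, l) x = table l q))"
      using good by blast
  qed
qed

section \<open>Local polynomial approximation in Hoelder spaces\<close>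

text \<open>Induction on \<open>r\<close>: the derivative of the remainder of \<open>D\<close> is
  the remainder of the shifted family \<open>\<lambda>j. D (Suc j)\<close>, and the mean value
  inequality on the segment from \<open>a\<close> to \<open>t\<close> gains one factor
  \<open>\<bar>t - a\<bar>\<close>. The Hoelder condition is used relative to the base point
  only.\<close>

lemma taylor_holder_1d:
  fixes D :: "nat \<Rightarrow> real \<Rightarrow> real"
  assumes "0 \<le> M" "a \<in> {0..1}" "0 \<le> lam"
    and "\<And>j t. j < r \<Longrightarrow> t \<in> {0..1} \<Longrightarrow> (D j has_real_derivative D (Suc j) t) (at t within {0..1})"
    and "\<And>t. t \<in> {0..1} \<Longrightarrow> t \<noteq> a \<Longrightarrow> \<bar>D r t - D r a\<bar> \<le> M * \<bar>t - a\<bar> powr lam"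
    and "t \<in> {0..1}"
  shows "\<bar>D 0 t - (\<Sum>j\<le>r. D j a / fact j * (t - a) ^ j)\<bar> \<le> M * \<bar>t - a\<bar> powr lam * \<bar>t - a\<bar> ^ r"
  using assms(4-)
proof (induction r arbitrary: D t)
  case 0
  then show ?case by (cases "t = a") auto
next
  case (Suc r)
  define R where "R = (\<lambda>t. D 0 t - (\<Sum>j\<le>Suc r. D j a / fact j * (t - a) ^ j))"
  define R' where "R' = (\<lambda>t. D 1 t - (\<Sum>j\<le>r. D (Suc j) a / fact j * (t - a) ^ j))"
  have R0: "R a = 0" by (simp add: R_def sum.atMost_Suc_shift del: sum.atMost_Suc)
  have deriv: "(R has_real_derivative R' u) (at u within {0..1})" if "u \<in> {0..1}" for u
  proof -
    have "((\<lambda>t. D (Suc j) a / fact (Suc j) * (t - a) ^ Suc j) has_real_derivative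
            D (Suc j) a / fact j * (u - a) ^ j) (at u within {0..1})" for j
      by (rule derivative_eq_intros refl | simp add: field_simps del: of_nat_Suc)+
    then have "((\<lambda>t. \<Sum>j\<le>r. D (Suc j) a / fact (Suc j) * (t - a) ^ Suc j) has_real_derivative
            (\<Sum>j\<le>r. D (Suc j) a / fact j * (u - a) ^ j)) (at u within {0..1})"
      by (intro DERIV_sum)
    moreover have "(D 0 has_real_derivative D 1 u) (at u within {0..1})"
      using Suc.prems(1)[of 0 u] that by simp
    ultimately have "((\<lambda>t. D 0 t - (D 0 a + (\<Sum>j\<le>r. D (Suc j) a / fact (Suc j) * (t - a) ^ Suc j))) has_real_derivative R' u) (at u within {0..1})"
      unfolding R'_def
      using DERIV_diff[OF _ DERIV_add[OF DERIV_const]] by fastforce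
    then show ?thesis
      by (simp add: R_def sum.atMost_Suc_shift del: sum.atMost_Suc)
  qed
  have R'_le: "\<bar>R' u\<bar> \<le> M * \<bar>u - a\<bar> powr lam * \<bar>u - a\<bar> ^ r" if "u \<in> {0..1}" for u
    using Suc.IH[of "\<lambda>j. D (Suc j)" u] Suc.prems(1,2) that unfolding R'_def by simp
  have mono: "\<bar>R' u\<bar> \<le> M * \<bar>t - a\<bar> powr lam * \<bar>t - a\<bar> ^ r" if "u \<in> closed_segment a t" for u
  proof -
    have "u \<in> {0..1}" "\<bar>u - a\<bar> \<le> \<bar>t - a\<bar>"
      using that assms(2) Suc.prems(3) by (auto simp: closed_segment_eq_real_ivl split: if_splits)
    then have "\<bar>R' u\<bar> \<le> M * \<bar>u - a\<bar> powr lam * \<bar>u - a\<bar> ^ r"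
      using R'_le by blast
    also have "\<dots> \<le> M * \<bar>t - a\<bar> powr lam * \<bar>t - a\<bar> ^ r"
      using \<open>\<bar>u - a\<bar> \<le> \<bar>t - a\<bar>\<close> assms(1,3)
      by (intro mult_mono power_mono powr_mono2 mult_left_mono) auto
    finally show ?thesis .
  qed
  have "norm (R t - R a) \<le> M * \<bar>t - a\<bar> powr lam * \<bar>t - a\<bar> ^ r * norm (t - a)"
  proof (rule field_differentiable_bound[of "closed_segment a t" R R'])
    show "(R has_real_derivative R' u) (at u within closed_segment a t)" if "u \<in> closed_segment a t" for u
    proof -
      have "closed_segment a t \<subseteq> {0..1}"
        using assms(2) Suc.prems(3) by (auto simp: closed_segment_eq_real_ivl)
      then show ?thesis using deriv that by (meson DERIV_subset subsetD)
    qed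
  qed (use mono in auto)
  then show ?case by (simp add: R0 R_def mult_ac)
qed

section \<open>Monomials and exponent lists\<close>

text \<open>The head is the exponent of the highest coordinate, so that passing from
  \<open>k\<close> to \<open>k + 1\<close> coordinates is a Cons, in step with the induction over
  the coordinates.\<close>

fun mono_val :: "nat list \<Rightarrow> (nat \<Rightarrow> real) \<Rightarrow> real" where
  "mono_val [] x = 1"
| "mono_val (i # xs) x = x (length xs) ^ i * mono_val xs x"

definition expos :: "nat \<Rightarrow> nat \<Rightarrow> nat list set" where
  "expos s k = {xs. set xs \<subseteq> {..s} \<and> length xs = k}"

lemma expos_Suc: "expos s (Suc k) = (\<lambda>(xs, i). i # xs) ` (expos s k \<times> {..s})"
  unfolding expos_def by (rule lists_length_Suc_eq)

lemma finite_expos: "finite (expos s k)"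
  unfolding expos_def by (rule finite_lists_length_eq) simp

lemma sum_expos_Suc:
  "(\<Sum>xs\<in>expos s (Suc k). F xs) = (\<Sum>i\<le>s. \<Sum>xs\<in>expos s k. F (i # xs))"
proof -
  have "(\<Sum>xs\<in>expos s (Suc k). F xs) = (\<Sum>(xs, i)\<in>expos s k \<times> {..s}. F (i # xs))"
    unfolding expos_Suc by (subst sum.reindex) (auto simp: inj_on_def case_prod_unfold)
  also have "\<dots> = (\<Sum>xs\<in>expos s k. \<Sum>i\<le>s. F (i # xs))"
    by (simp add: sum.cartesian_product)
  finally show ?thesis by (simp add: sum.swap[of _ "expos s k"])
qed

text \<open>Powers of \<open>x\<close> itself replace powers of \<open>x - a\<close>: the monomials
  are then the same in all cells, and only the coefficients have to be looked up. Letting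
  \<open>i\<close> run to \<open>s\<close> instead of \<open>r\<close> gives all orders the same
  index set.\<close>

lemma recentre_polynomial:
  fixes \<beta> :: "nat \<Rightarrow> real"
  assumes "r \<le> s"
  shows "(\<Sum>j\<le>r. \<beta> j * (x - a) ^ j) = (\<Sum>i\<le>s. (\<Sum>j\<le>r. \<beta> j * real (j choose i) * (- a) ^ (j - i)) * x ^ i)"
proof -
  have "(x - a) ^ j = (\<Sum>i\<le>s. real (j choose i) * (- a) ^ (j - i) * x ^ i)" if "j \<le> r" for j
  proof -
    have "(x - a) ^ j = (\<Sum>i\<le>j. real (j choose i) * x ^ i * (- a) ^ (j - i))"
      using binomial_ring[of x "- a" j] by simp
    also have "\<dots> = (\<Sum>i\<le>s. real (j choose i) * x ^ i * (- a) ^ (j - i))"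
      using that assms by (intro sum.mono_neutral_left) auto
    finally show ?thesis by (simp add: mult_ac)
  qed
  then have "(\<Sum>j\<le>r. \<beta> j * (x - a) ^ j)
      = (\<Sum>j\<le>r. \<Sum>i\<le>s. \<beta> j * (real (j choose i) * (- a) ^ (j - i) * x ^ i))"
    by (simp add: sum_distrib_left)
  also have "\<dots> = (\<Sum>i\<le>s. \<Sum>j\<le>r. \<beta> j * (real (j choose i) * (- a) ^ (j - i) * x ^ i))"
    by (rule sum.swap)
  finally show ?thesis by (simp add: sum_distrib_left sum_distrib_right mult_ac)
qed

section \<open>Coordinates of the cube and derivatives in prescribed order\<close>

definition coord :: "nat \<Rightarrow> mat \<Rightarrow> nat \<Rightarrow> real" where
  "coord n X k = X (k div n) (k mod n)"

definition sorted_partials :: "nat \<Rightarrow> nat \<Rightarrow> (nat \<Rightarrow> nat) \<Rightarrow> (nat \<times> nat) list" where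
  "sorted_partials n k \<nu> = concat (map (\<lambda>k. replicate (\<nu> k) (k div n, k mod n)) [0..<k])"

text \<open>Only the derivatives taken in the order prescribed by \<^const>\<open>mi_list\<close> are available,
  so the induction peels off the last coordinate first.\<close>
definition holder_below :: "nat \<Rightarrow> nat \<Rightarrow> real \<Rightarrow> nat \<Rightarrow> nat \<Rightarrow> real \<Rightarrow> (mat \<Rightarrow> real) \<Rightarrow> bool" where
  "holder_below d n lam k r M G \<longleftrightarrow> (\<forall>\<nu>. (\<Sum>i<k. \<nu> i) \<le> r \<longrightarrow>
     dexists d n (sorted_partials n k \<nu>) G
     \<and> (\<forall>X\<in>cube d n. \<bar>dlist (sorted_partials n k \<nu>) G X\<bar> \<le> M)
     \<and> ((\<Sum>i<k. \<nu> i) = r \<longrightarrow> (\<forall>X\<in>cube d n. \<forall>Y\<in>cube d n. X \<noteq> Y \<longrightarrow>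
          \<bar>dlist (sorted_partials n k \<nu>) G X - dlist (sorted_partials n k \<nu>) G Y\<bar>
            \<le> M * mdist d n X Y powr lam)))"

lemma dlist_append: "dlist (xs @ ys) G = dlist xs (dlist ys G)"
  by (induction xs) auto

lemma dexists_append: "dexists d n (xs @ ys) G \<longleftrightarrow> dexists d n ys G \<and> dexists d n xs (dlist ys G)"
  by (induction xs) (auto simp: dlist_append)

lemma sorted_partials_Suc:
  "sorted_partials n (Suc k) \<nu> = sorted_partials n k \<nu> @ replicate (\<nu> k) (k div n, k mod n)"
  by (simp add: sorted_partials_def)

lemma sorted_partials_cong:
  "(\<And>i. i < k \<Longrightarrow> \<nu> i = \<nu>' i) \<Longrightarrow> sorted_partials n k \<nu> = sorted_partials n k \<nu>'"
  unfolding sorted_partials_def by (rule arg_cong[of _ _ concat]) auto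

lemma coord_bounds:
  fixes k d n :: nat
  assumes "k < d * n" shows "k div n < d" "k mod n < n"
proof -
  from assms have "n > 0" by (cases n) auto
  then show "k div n < d" "k mod n < n"
    using assms by (auto simp: div_less_iff_less_mult)
qed

lemma coord_in_unit: "X \<in> cube d n \<Longrightarrow> k < d * n \<Longrightarrow> coord n X k \<in> {0..1}"
  using coord_bounds[of k d n] by (auto simp: cube_def coord_def)

lemma upd_in_cube:
  "X \<in> cube d n \<Longrightarrow> k < d * n \<Longrightarrow> t \<in> {0..1} \<Longrightarrow> upd X (k div n) (k mod n) t \<in> cube d n"
  using coord_bounds[of k d n] by (auto simp: cube_def upd_def)

lemma coord_upd: "coord n (upd X (k div n) (k mod n) t) l = (if l = k then t else coord n X l)"
proof (cases "l = k")
  case False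
  then have "\<not> (l div n = k div n \<and> l mod n = k mod n)"
    by (metis div_mult_mod_eq)
  then show ?thesis using False by (auto simp: coord_def upd_def)
qed (simp add: coord_def upd_def)

lemma upd_upd: "upd (upd X i j t) i j u = upd X i j u"
  by (auto simp: upd_def)

lemma mdist_upd:
  assumes "k < d * n"
  shows "mdist d n (upd X (k div n) (k mod n) t) (upd X (k div n) (k mod n) u) = \<bar>t - u\<bar>"
proof -
  have "(\<Sum>i<d. \<Sum>j<n. (upd X (k div n) (k mod n) t i j - upd X (k div n) (k mod n) u i j)\<^sup>2)
      = (\<Sum>i<d. \<Sum>j<n. if i = k div n \<and> j = k mod n then (t - u)\<^sup>2 else 0)"
    by (intro sum.cong) (auto simp: upd_def)
  also have "\<dots> = (\<Sum>i<d. if i = k div n then (t - u)\<^sup>2 else 0)"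
  proof (rule sum.cong)
    fix i
    show "(\<Sum>j<n. if i = k div n \<and> j = k mod n then (t - u)\<^sup>2 else 0) = (if i = k div n then (t - u)\<^sup>2 else 0)"
      using coord_bounds(2)[OF assms] by (cases "i = k div n") (simp_all add: sum.delta)
  qed simp
  also have "\<dots> = (t - u)\<^sup>2"
    using coord_bounds(1)[OF assms] by (simp add: sum.delta)
  finally show ?thesis by (simp add: mdist_def)
qed

lemma cube_eqI:
  assumes "X \<in> cube d n" "Y \<in> cube d n" "\<And>k. k < d * n \<Longrightarrow> coord n X k = coord n Y k"
  shows "X = Y"
proof (intro ext)
  fix i j
  show "X i j = Y i j"
  proof (cases "i < d \<and> j < n")
    case True
    then have "i * n + j < d * n"
      using mult_le_mono1[of "Suc i" d n] by simp
    from assms(3)[OF this] True show ?thesis by (simp add: coord_def)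
  qed (use assms(1,2) in \<open>auto simp: cube_def\<close>)
qed

lemma mono_val_cong: "(\<And>i. i < length e \<Longrightarrow> x i = y i) \<Longrightarrow> mono_val e x = mono_val e y"
  by (induction e) auto

text \<open>The derivatives in coordinate \<open>k\<close> are applied before those in lower
  coordinates, and \<open>j\<close> of them use up \<open>j\<close> of the order. Extending the
  multi-index by \<open>j\<close> at \<open>k\<close> reduces the claim to the assumption.\<close>

lemma holder_below_partial:
  assumes "holder_below d n lam (Suc k) r M G" "j \<le> r"
  shows "holder_below d n lam k (r - j) M (dlist (replicate j (k div n, k mod n)) G)"
  unfolding holder_below_def
proof (intro allI impI)
  fix \<nu> assume le: "(\<Sum>i<k. \<nu> i) \<le> r - j"
  define \<nu>' where "\<nu>' = \<nu>(k := j)"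
  have list: "sorted_partials n (Suc k) \<nu>' = sorted_partials n k \<nu> @ replicate j (k div n, k mod n)"
    by (simp add: sorted_partials_Suc \<nu>'_def cong: sorted_partials_cong)
  have sum: "(\<Sum>i<Suc k. \<nu>' i) = (\<Sum>i<k. \<nu> i) + j"
    by (simp add: \<nu>'_def)
  with le assms(2) have "(\<Sum>i<Suc k. \<nu>' i) \<le> r" by simp
  then have *: "dexists d n (sorted_partials n (Suc k) \<nu>') G
     \<and> (\<forall>X\<in>cube d n. \<bar>dlist (sorted_partials n (Suc k) \<nu>') G X\<bar> \<le> M)
     \<and> ((\<Sum>i<Suc k. \<nu>' i) = r \<longrightarrow> (\<forall>X\<in>cube d n. \<forall>Y\<in>cube d n. X \<noteq> Y \<longrightarrow>
          \<bar>dlist (sorted_partials n (Suc k) \<nu>') G X - dlist (sorted_partials n (Suc k) \<nu>') G Y\<bar>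
            \<le> M * mdist d n X Y powr lam))"
    by (rule assms(1)[unfolded holder_below_def, THEN spec, THEN mp])
  have "(\<Sum>i<k. \<nu> i) = r - j \<longleftrightarrow> (\<Sum>i<Suc k. \<nu>' i) = r"
    using sum assms(2) by linarith
  with * show "dexists d n (sorted_partials n k \<nu>) (dlist (replicate j (k div n, k mod n)) G)
     \<and> (\<forall>X\<in>cube d n. \<bar>dlist (sorted_partials n k \<nu>) (dlist (replicate j (k div n, k mod n)) G) X\<bar> \<le> M)
     \<and> ((\<Sum>i<k. \<nu> i) = r - j \<longrightarrow> (\<forall>X\<in>cube d n. \<forall>Y\<in>cube d n. X \<noteq> Y \<longrightarrow>
          \<bar>dlist (sorted_partials n k \<nu>) (dlist (replicate j (k div n, k mod n)) G) X
            - dlist (sorted_partials n k \<nu>) (dlist (replicate j (k div n, k mod n)) G) Y\<bar>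
            \<le> M * mdist d n X Y powr lam))"
    unfolding list dlist_append dexists_append by simp
qed

text \<open>The one-dimensional expansion along coordinate \<open>k\<close>: its coefficients are
  derivatives at \<open>X'\<close>, the point moved to \<open>a\<close> in that coordinate. On such
  a line \<open>mdist\<close> is the distance of the parameters.\<close>

lemma holder_below_taylor:
  assumes hb: "holder_below d n lam (Suc k) r M G" and k: "k < d * n" and "0 \<le> M" "0 \<le> lam"
    and X: "X \<in> cube d n" and a: "a \<in> {0..1}"
  defines "X' \<equiv> upd X (k div n) (k mod n) a"
  shows "\<bar>G X - (\<Sum>j\<le>r. dlist (replicate j (k div n, k mod n)) G X' / fact j * (coord n X k - a) ^ j)\<bar>
    \<le> M * \<bar>coord n X k - a\<bar> powr lam * \<bar>coord n X k - a\<bar> ^ r"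
proof -
  define G' where "G' = (\<lambda>j. dlist (replicate j (k div n, k mod n)) G)"
  define D where "D = (\<lambda>j t. G' j (upd X (k div n) (k mod n) t))"
  have part: "holder_below d n lam k (r - j) M (G' j)" if "j \<le> r" for j
    unfolding G'_def by (rule holder_below_partial[OF hb that])
  have nil: "sorted_partials n k (\<lambda>_. 0) = []"
    by (simp add: sorted_partials_def)
  have ex: "dexists d n (replicate j (k div n, k mod n)) G" if "j \<le> r" for j
  proof -
    have "sorted_partials n (Suc k) ((\<lambda>_. 0)(k := j)) = replicate j (k div n, k mod n)"
      using nil by (simp add: sorted_partials_Suc cong: sorted_partials_cong)
    moreover have "(\<Sum>i<Suc k. ((\<lambda>_. 0)(k := j)) i) = j" by simp
    ultimately show ?thesis
      using hb that unfolding holder_below_def by metis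
  qed
  have "\<bar>D 0 (coord n X k) - (\<Sum>j\<le>r. D j a / fact j * (coord n X k - a) ^ j)\<bar>
    \<le> M * \<bar>coord n X k - a\<bar> powr lam * \<bar>coord n X k - a\<bar> ^ r"
  proof (rule taylor_holder_1d)
    fix j :: nat and t :: real assume j: "j < r" and t: "t \<in> {0..1}"
    \<comment> \<open>\<open>dexists\<close> speaks of the derivative at the current entry of a
      point, so it is applied to \<open>X\<close> updated to \<open>t\<close>.\<close>
    have "(\<lambda>u. G' j (upd (upd X (k div n) (k mod n) t) (k div n) (k mod n) u))
        differentiable (at (upd X (k div n) (k mod n) t (k div n) (k mod n)) within {0..1})"
      using ex[of "Suc j"] j upd_in_cube[OF X k t] unfolding G'_def by simp
    then have "D j differentiable (at t within {0..1})"
      by (simp add: D_def upd_upd) (simp add: upd_def)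
    then have "(D j has_real_derivative vector_derivative (D j) (at t within {0..1})) (at t within {0..1})"
      by (simp add: vector_derivative_works has_real_derivative_iff_has_vector_derivative)
    moreover have "vector_derivative (D j) (at t within {0..1}) = D (Suc j) t"
    proof -
      have "D (Suc j) t = vector_derivative (\<lambda>u. G' j (upd (upd X (k div n) (k mod n) t) (k div n) (k mod n) u))
        (at (upd X (k div n) (k mod n) t (k div n) (k mod n)) within {0..1})"
        by (simp add: D_def G'_def pdiff_def)
      also have "\<dots> = vector_derivative (D j) (at t within {0..1})"
        unfolding upd_upd D_def by (simp add: upd_def)
      finally show ?thesis by simp
    qed
    ultimately show "(D j has_real_derivative D (Suc j) t) (at t within {0..1})" by simp
  next
    fix t :: real assume t: "t \<in> {0..1}" "t \<noteq> a"
    have "upd X (k div n) (k mod n) t \<noteq> upd X (k div n) (k mod n) a"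
      using t(2) by (metis coord_upd)
    then have "\<bar>D r t - D r a\<bar> \<le> M * mdist d n (upd X (k div n) (k mod n) t) (upd X (k div n) (k mod n) a) powr lam"
      using part[of r] upd_in_cube[OF X k] t a unfolding holder_below_def D_def
      by (auto dest!: spec[of _ "\<lambda>_. 0"] simp: nil)
    then show "\<bar>D r t - D r a\<bar> \<le> M * \<bar>t - a\<bar> powr lam"
      by (simp add: mdist_upd[OF k])
  qed (use assms coord_in_unit in auto)
  moreover have "D 0 (coord n X k) = G X"
    by (simp add: D_def G'_def coord_def upd_def)
  ultimately show ?thesis by (simp add: D_def G'_def X'_def)
qed

section \<open>Local polynomials, coordinate by coordinate\<close>

text \<open>Coordinates from \<open>k\<close> on are frozen at those of \<open>a\<close>, which
  permits induction on \<open>k\<close>. The coefficients do not depend on \<open>X\<close> or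
  \<open>h\<close>, so one table entry serves all points near \<open>a\<close>; their bound
  \<open>K\<close> is needed to scale the table into [0,1].\<close>

definition approximates_near ::
  "nat \<Rightarrow> nat \<Rightarrow> nat \<Rightarrow> nat \<Rightarrow> real \<Rightarrow> real \<Rightarrow> (mat \<Rightarrow> real) \<Rightarrow> mat \<Rightarrow> (nat list \<Rightarrow> real) \<Rightarrow> bool" where
  "approximates_near d n s k \<rho> K G a b \<longleftrightarrow> (\<forall>e. \<bar>b e\<bar> \<le> K)
    \<and> (\<forall>h X. 0 < h \<longrightarrow> X \<in> cube d n \<longrightarrow> (\<forall>i<k. \<bar>coord n X i - coord n a i\<bar> \<le> h)
        \<longrightarrow> (\<forall>i. k \<le> i \<longrightarrow> i < d * n \<longrightarrow> coord n X i = coord n a i)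
        \<longrightarrow> \<bar>G X - (\<Sum>e\<in>expos s k. b e * mono_val e (coord n X))\<bar> \<le> K * h powr \<rho>)"

lemma approximates_nearD:
  assumes "approximates_near d n s k \<rho> K G a b"
  shows "\<bar>b e\<bar> \<le> K"
    and "0 < h \<Longrightarrow> X \<in> cube d n \<Longrightarrow> (\<And>i. i < k \<Longrightarrow> \<bar>coord n X i - coord n a i\<bar> \<le> h)
      \<Longrightarrow> (\<And>i. k \<le> i \<Longrightarrow> i < d * n \<Longrightarrow> coord n X i = coord n a i)
      \<Longrightarrow> \<bar>G X - (\<Sum>e\<in>expos s k. b e * mono_val e (coord n X))\<bar> \<le> K * h powr \<rho>"
  using assms unfolding approximates_near_def by simp_all

text \<open>Expand in the last coordinate, then replace each Taylor coefficient, a derivative of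
  order \<open>j\<close>, by its own polynomial in the lower coordinates. The order left to it is
  \<open>r - j\<close>, and the error \<open>h powr (real (r - j) + lam)\<close> is compensated by
  the factor \<open>\<bar>t - \<alpha>\<bar> ^ j \<le> h ^ j\<close>. \<open>K\<close> is fixed
  before \<open>G\<close>, \<open>M\<close> and \<open>a\<close>.\<close>

lemma local_polynomial:
  assumes "0 \<le> lam" "k \<le> d * n" "r \<le> s"
  shows "\<exists>K\<ge>0. \<forall>G M a. 0 \<le> M \<longrightarrow> holder_below d n lam k r M G \<longrightarrow> a \<in> cube d n
    \<longrightarrow> (\<exists>b. approximates_near d n s k (real r + lam) (K * M) G a b)"
  using assms(2,3)
proof (induction k arbitrary: r)
  case 0
  have "(\<exists>b. approximates_near d n s 0 (real r + lam) (1 * M) G a b)"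
    if M: "0 \<le> M" and hb: "holder_below d n lam 0 r M G" and a: "a \<in> cube d n" for G M a
  proof (rule exI[of _ "\<lambda>_. G a"], unfold approximates_near_def, intro conjI allI impI)
    show "\<bar>G a\<bar> \<le> 1 * M"
      using hb a by (simp add: holder_below_def sorted_partials_def)
    fix h :: real and X assume "0 < h" "X \<in> cube d n" "\<forall>i. 0 \<le> i \<longrightarrow> i < d * n \<longrightarrow> coord n X i = coord n a i"
    then have "X = a" using cube_eqI[OF _ a] by blast
    moreover have "expos s 0 = {[]}" by (auto simp: expos_def)
    ultimately show "\<bar>G X - (\<Sum>e\<in>expos s 0. G a * mono_val e (coord n X))\<bar> \<le> 1 * M * h powr (real r + lam)"
      using M by simp
  qed
  then show ?case using zero_le_one by blast
next
  case (Suc k)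
  then have k: "k < d * n" by simp
  define c where "c = (k div n, k mod n)"
  have "\<exists>K\<ge>0. \<forall>G M a. 0 \<le> M \<longrightarrow> holder_below d n lam k (r - j) M G \<longrightarrow> a \<in> cube d n
    \<longrightarrow> (\<exists>b. approximates_near d n s k (real (r - j) + lam) (K * M) G a b)" for j
    using Suc by simp
  then obtain K where K0: "\<And>j. 0 \<le> K j"
    and K: "\<And>j G M a. 0 \<le> M \<Longrightarrow> holder_below d n lam k (r - j) M G \<Longrightarrow> a \<in> cube d n \<Longrightarrow>
      (\<exists>b. approximates_near d n s k (real (r - j) + lam) (K j * M) G a b)"
    by metis
  \<comment> \<open>The summand 1 stands for the Taylor remainder; \<open>2 ^ r\<close> bounds the
    binomial coefficients created by recentring.\<close>
  define KK where "KK = 2 ^ r * (1 + (\<Sum>j\<le>r. K j))"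
  have sumK: "0 \<le> (\<Sum>j\<le>r. K j)" using K0 by (intro sum_nonneg) auto
  have KK0: "0 \<le> KK" using sumK by (simp add: KK_def)
  show ?case
  proof (rule exI[of _ KK], intro conjI KK0 allI impI ballI)
    fix G M a
    assume M: "0 \<le> M" and hb: "holder_below d n lam (Suc k) r M G" and a: "a \<in> cube d n"
    define \<alpha> where "\<alpha> = coord n a k"
    have \<alpha>: "\<alpha> \<in> {0..1}" unfolding \<alpha>_def by (rule coord_in_unit[OF a k])
    have "(\<exists>b. approximates_near d n s k (real (r - j) + lam) (K j * M) (dlist (replicate j c) G) a b)" if "j \<le> r" for j
      unfolding c_def by (rule K[OF M holder_below_partial[OF hb that] a])
    then obtain b where b: "\<And>j. j \<le> r \<Longrightarrow> approximates_near d n s k (real (r - j) + lam) (K j * M) (dlist (replicate j c) G) a (b j)"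
      by metis
    note b_le = approximates_nearD(1)[OF b]
    define B where "B = (\<lambda>i e. \<Sum>j\<le>r. (b j e / fact j) * real (j choose i) * (- \<alpha>) ^ (j - i))"
    define b' where "b' = (\<lambda>es. case es of [] \<Rightarrow> 0 | i # e \<Rightarrow> B i e)"
    have B_le: "\<bar>B i e\<bar> \<le> KK * M" for i e
    proof -
      have "\<bar>(b j e / fact j) * real (j choose i) * (- \<alpha>) ^ (j - i)\<bar> \<le> K j * M * 2 ^ r" if j: "j \<le> r" for j
      proof -
        have "\<bar>b j e / fact j\<bar> \<le> K j * M"
        proof -
          have "\<bar>b j e / fact j\<bar> \<le> \<bar>b j e\<bar>"
            using fact_ge_1[of j, where ?'a = real] by (simp add: divide_le_eq mult_left_le mult_le_cancel_left1 abs_mult)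
          then show ?thesis using b_le[OF j, of e] by linarith
        qed
        moreover have "real (j choose i) \<le> 2 ^ r"
        proof -
          have "(j choose i) \<le> (2::nat) ^ j" by (rule binomial_le_pow2)
          also have "\<dots> \<le> 2 ^ r" using j by (intro power_increasing) auto
          finally show ?thesis by (metis of_nat_le_iff of_nat_numeral of_nat_power)
        qed
        moreover have "\<bar>(- \<alpha>) ^ (j - i)\<bar> \<le> 1"
          using \<alpha> by (simp add: power_abs power_le_one)
        ultimately have "\<bar>b j e / fact j\<bar> * real (j choose i) * \<bar>(- \<alpha>) ^ (j - i)\<bar> \<le> K j * M * 2 ^ r * 1"
          using K0[of j] M by (intro mult_mono) auto
        then show ?thesis by (simp add: abs_mult)
      qed
      then have "\<bar>B i e\<bar> \<le> (\<Sum>j\<le>r. K j * M * 2 ^ r)"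
        unfolding B_def by (intro order_trans[OF sum_abs] sum_mono) auto
      also have "\<dots> = (2 ^ r * (\<Sum>j\<le>r. K j)) * M"
        by (simp add: sum_distrib_left sum_distrib_right mult_ac)
      also have "\<dots> \<le> KK * M"
        unfolding KK_def using M by (intro mult_right_mono mult_left_mono) auto
      finally show ?thesis .
    qed
    show "(\<exists>b. approximates_near d n s (Suc k) (real r + lam) (KK * M) G a b)"
    proof (rule exI[of _ b'], unfold approximates_near_def, intro conjI allI impI)
      fix e show "\<bar>b' e\<bar> \<le> KK * M"
        using B_le M KK0 by (cases e) (auto simp: b'_def)
    next
      fix h :: real and X
      assume h: "0 < h" and X: "X \<in> cube d n"
        and close: "\<forall>i<Suc k. \<bar>coord n X i - coord n a i\<bar> \<le> h"
        and eq: "\<forall>i. Suc k \<le> i \<longrightarrow> i < d * n \<longrightarrow> coord n X i = coord n a i"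
      define t where "t = coord n X k"
      \<comment> \<open>\<open>X'\<close> agrees with \<open>a\<close> from coordinate
        \<open>k\<close> on, as the induction hypothesis demands, and monomials in the first
        \<open>k\<close> coordinates do not distinguish it from \<open>X\<close>.\<close>
      define X' where "X' = upd X (k div n) (k mod n) \<alpha>"
      have th: "\<bar>t - \<alpha>\<bar> \<le> h" using close unfolding t_def \<alpha>_def by simp
      define P where "P = (\<lambda>j. \<Sum>e\<in>expos s k. b j e * mono_val e (coord n X))"
      define Q where "Q = (\<lambda>j. dlist (replicate j c) G X')"
      have PQ: "\<bar>Q j - P j\<bar> \<le> K j * M * h powr (real (r - j) + lam)" if "j \<le> r" for j
      proof -
        have "P j = (\<Sum>e\<in>expos s k. b j e * mono_val e (coord n X'))"
          unfolding P_def X'_def by (intro sum.cong refl arg_cong2[of _ _ _ _ "(*)"] mono_val_cong)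
            (auto simp: coord_upd expos_def)
        moreover have "X' \<in> cube d n"
          unfolding X'_def by (rule upd_in_cube[OF X k \<alpha>])
        moreover have "\<bar>coord n X' i - coord n a i\<bar> \<le> h" if "i < k" for i
          using that close by (auto simp: X'_def coord_upd)
        moreover have "coord n X' i = coord n a i" if "k \<le> i" "i < d * n" for i
          using that eq by (auto simp: X'_def coord_upd \<alpha>_def)
        ultimately show ?thesis
          using approximates_nearD(2)[OF b[OF that] h, of X'] unfolding Q_def by simp
      qed
      have taylor: "\<bar>G X - (\<Sum>j\<le>r. Q j / fact j * (t - \<alpha>) ^ j)\<bar> \<le> M * h powr (real r + lam)"
      proof -
        have "\<bar>G X - (\<Sum>j\<le>r. Q j / fact j * (t - \<alpha>) ^ j)\<bar> \<le> M * \<bar>t - \<alpha>\<bar> powr lam * \<bar>t - \<alpha>\<bar> ^ r"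
          unfolding Q_def c_def X'_def t_def by (rule holder_below_taylor[OF hb k M assms(1) X \<alpha>])
        also have "\<dots> \<le> M * h powr lam * h ^ r"
          using th M assms(1) h by (intro mult_mono power_mono powr_mono2 mult_left_mono) auto
        also have "\<dots> = M * h powr (real r + lam)"
          using h by (simp add: powr_add powr_realpow)
        finally show ?thesis .
      qed
      have diff: "\<bar>(\<Sum>j\<le>r. Q j / fact j * (t - \<alpha>) ^ j) - (\<Sum>j\<le>r. P j / fact j * (t - \<alpha>) ^ j)\<bar>
          \<le> (\<Sum>j\<le>r. K j * M * h powr (real r + lam))"
      proof -
        have "\<bar>(Q j - P j) / fact j * (t - \<alpha>) ^ j\<bar> \<le> K j * M * h powr (real r + lam)" if j: "j \<le> r" for j
        proof -
          have "\<bar>(Q j - P j) / fact j\<bar> \<le> \<bar>Q j - P j\<bar>"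
            using fact_ge_1[of j, where ?'a = real] by (simp add: divide_le_eq mult_left_le mult_le_cancel_left1 abs_mult)
          also have "\<dots> \<le> K j * M * h powr (real (r - j) + lam)" by (rule PQ[OF j])
          finally have "\<bar>(Q j - P j) / fact j\<bar> * \<bar>(t - \<alpha>) ^ j\<bar>
              \<le> K j * M * h powr (real (r - j) + lam) * h ^ j"
            using th h K0[of j] M by (intro mult_mono) (auto simp: power_abs power_mono)
          also have "\<dots> = K j * M * h powr (real r + lam)"
            using h j by (simp add: powr_realpow[symmetric] powr_add[symmetric] mult.assoc add_ac of_nat_diff)
          finally show ?thesis by (simp add: abs_mult)
        qed
        then have "\<bar>\<Sum>j\<le>r. (Q j - P j) / fact j * (t - \<alpha>) ^ j\<bar> \<le> (\<Sum>j\<le>r. K j * M * h powr (real r + lam))"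
          by (intro order_trans[OF sum_abs] sum_mono) auto
        then show ?thesis
          by (simp add: sum_subtractf[symmetric] diff_divide_distrib left_diff_distrib)
      qed
      have "(\<Sum>j\<le>r. P j / fact j * (t - \<alpha>) ^ j) = (\<Sum>i\<le>s. (\<Sum>j\<le>r. P j / fact j * real (j choose i) * (- \<alpha>) ^ (j - i)) * t ^ i)"
        by (rule recentre_polynomial) (use Suc.prems in auto)
      also have "\<dots> = (\<Sum>i\<le>s. \<Sum>e\<in>expos s k. B i e * (t ^ i * mono_val e (coord n X)))"
      proof (rule sum.cong[OF refl])
        fix i
        have "(\<Sum>j\<le>r. P j / fact j * real (j choose i) * (- \<alpha>) ^ (j - i))
            = (\<Sum>j\<le>r. \<Sum>e\<in>expos s k. b j e / fact j * real (j choose i) * (- \<alpha>) ^ (j - i) * mono_val e (coord n X))"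
          unfolding P_def by (simp add: sum_distrib_left sum_distrib_right sum_divide_distrib mult_ac)
        also have "\<dots> = (\<Sum>e\<in>expos s k. B i e * mono_val e (coord n X))"
          unfolding B_def by (subst sum.swap) (simp add: sum_distrib_right)
        finally show "(\<Sum>j\<le>r. P j / fact j * real (j choose i) * (- \<alpha>) ^ (j - i)) * t ^ i
            = (\<Sum>e\<in>expos s k. B i e * (t ^ i * mono_val e (coord n X)))"
          by (simp add: sum_distrib_left sum_distrib_right mult_ac)
      qed
      also have "\<dots> = (\<Sum>e\<in>expos s (Suc k). b' e * mono_val e (coord n X))"
        unfolding sum_expos_Suc by (intro sum.cong) (auto simp: b'_def t_def expos_def)
      finally have "\<bar>G X - (\<Sum>e\<in>expos s (Suc k). b' e * mono_val e (coord n X))\<bar>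
          \<le> M * h powr (real r + lam) + (\<Sum>j\<le>r. K j * M * h powr (real r + lam))"
        using taylor diff by linarith
      also have "\<dots> = 1 * (1 + (\<Sum>j\<le>r. K j)) * (M * h powr (real r + lam))"
        by (simp add: sum_distrib_right sum_distrib_left algebra_simps)
      also have "\<dots> \<le> KK * (M * h powr (real r + lam))"
        unfolding KK_def using sumK M by (intro mult_right_mono) auto
      finally show "\<bar>G X - (\<Sum>e\<in>expos s (Suc k). b' e * mono_val e (coord n X))\<bar> \<le> KK * M * h powr (real r + lam)"
        by (simp add: mult_ac)
    qed
  qed
qed

lemma holder_local_polynomial:
  assumes "holder d n s lam g" "0 \<le> lam" "1 \<le> n"
  obtains K where "0 \<le> K"
    "\<And>a. a \<in> cube d n \<Longrightarrow> (\<exists>b. approximates_near d n s (d * n) (real s + lam) K g a b)"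
proof -
  obtain M where M: "\<forall>mu. mi_abs d n mu \<le> s \<longrightarrow> (\<forall>X\<in>cube d n. \<bar>Dmu d n mu g X\<bar> \<le> M)"
     "\<forall>mu. mi_abs d n mu = s \<longrightarrow> (\<forall>X\<in>cube d n. \<forall>Y\<in>cube d n. X \<noteq> Y \<longrightarrow>
              \<bar>Dmu d n mu g X - Dmu d n mu g Y\<bar> \<le> M * mdist d n X Y powr lam)"
    and ex: "\<forall>mu. mi_abs d n mu \<le> s \<longrightarrow> dexists d n (mi_list d n mu) g"
    using assms(1)[unfolded holder_def] by (elim conjE exE) (rule that)
  define M' where "M' = max M 0"
  have hb: "holder_below d n lam (d * n) s M' g"
    unfolding holder_below_def
  proof (intro allI impI)
    fix \<nu> :: "nat \<Rightarrow> nat" assume le: "(\<Sum>i<d * n. \<nu> i) \<le> s"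
    \<comment> \<open>Row-major flattening: the resulting list of derivatives is the same, including
      its order.\<close>
    define mu where "mu = (\<lambda>i j. \<nu> (i * n + j))"
    have list: "mi_list d n mu = sorted_partials n (d * n) \<nu>"
      by (simp add: mi_list_def sorted_partials_def mu_def)
    have "mi_abs d n mu = (\<Sum>i<d. sum \<nu> {i * n..<i * n + n})"
      unfolding mi_abs_def mu_def
      by (rule sum.cong[OF refl], subst sum.atLeastLessThan_shift_0) (simp add: lessThan_atLeast0)
    also have "\<dots> = (\<Sum>i<d * n. \<nu> i)" by (rule sum.nat_group)
    finally have abs: "mi_abs d n mu = (\<Sum>i<d * n. \<nu> i)" .
    have "\<bar>dlist (sorted_partials n (d * n) \<nu>) g X\<bar> \<le> M'" if "X \<in> cube d n" for X
      using M(1)[rule_format, of mu X] that le abs list unfolding Dmu_def M'_def by simp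
    moreover have "\<bar>dlist (sorted_partials n (d * n) \<nu>) g X - dlist (sorted_partials n (d * n) \<nu>) g Y\<bar>
        \<le> M' * mdist d n X Y powr lam"
      if "(\<Sum>i<d * n. \<nu> i) = s" "X \<in> cube d n" "Y \<in> cube d n" "X \<noteq> Y" for X Y
    proof -
      have "\<bar>dlist (sorted_partials n (d * n) \<nu>) g X - dlist (sorted_partials n (d * n) \<nu>) g Y\<bar>
        \<le> M * mdist d n X Y powr lam"
        using M(2)[rule_format, of mu X Y] that abs list unfolding Dmu_def by simp
      also have "\<dots> \<le> M' * mdist d n X Y powr lam"
        unfolding M'_def by (intro mult_right_mono) auto
      finally show ?thesis .
    qed
    moreover have "dexists d n (sorted_partials n (d * n) \<nu>) g"
      using ex le abs list by (metis)
    ultimately show "dexists d n (sorted_partials n (d * n) \<nu>) g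
     \<and> (\<forall>X\<in>cube d n. \<bar>dlist (sorted_partials n (d * n) \<nu>) g X\<bar> \<le> M')
     \<and> ((\<Sum>i<d * n. \<nu> i) = s \<longrightarrow> (\<forall>X\<in>cube d n. \<forall>Y\<in>cube d n. X \<noteq> Y \<longrightarrow>
          \<bar>dlist (sorted_partials n (d * n) \<nu>) g X - dlist (sorted_partials n (d * n) \<nu>) g Y\<bar>
            \<le> M' * mdist d n X Y powr lam))" by blast
  qed
  have M'0: "0 \<le> M'" by (simp add: M'_def)
  obtain K where K: "0 \<le> K" "\<And>G M a. 0 \<le> M \<Longrightarrow> holder_below d n lam (d * n) s M G \<Longrightarrow> a \<in> cube d n
    \<Longrightarrow> (\<exists>b. approximates_near d n s (d * n) (real s + lam) (K * M) G a b)"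
    using local_polynomial[OF assms(2) order_refl[of "d * n"] order_refl[of s]] by blast
  show ?thesis
    by (rule that[of "K * M'"]) (use K hb M'0 in auto)
qed

section \<open>Approximation by ReLU networks\<close>

fun mono_factors :: "nat list \<Rightarrow> nat list" where
  "mono_factors [] = []"
| "mono_factors (i # xs) = replicate i (length xs) @ mono_factors xs"

lemma prod_mono_factors: "prod_list (map x (mono_factors e)) = mono_val e x"
  by (induction e) auto

lemma set_mono_factors: "set (mono_factors e) \<subseteq> {..<length e}"
  by (induction e) auto

lemma length_mono_factors: "set e \<subseteq> {..s} \<Longrightarrow> length (mono_factors e) \<le> s * length e"
  by (induction e) auto

definition sgn_of :: "bool \<Rightarrow> real" where "sgn_of \<sigma> = (if \<sigma> then 1 else - 1)"

definition grid_point :: "nat \<Rightarrow> nat \<Rightarrow> nat \<Rightarrow> (nat \<Rightarrow> nat) \<Rightarrow> mat" where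
  "grid_point d n N Q = (\<lambda>i j. if i < d \<and> j < n then real (Q (i * n + j)) / real N else 0)"

lemma grid_point_cube:
  assumes "1 \<le> N" "\<And>i. i < d * n \<Longrightarrow> Q i \<le> N"
  shows "grid_point d n N Q \<in> cube d n"
proof -
  have "Q (i * n + j) \<le> N" if "i < d" "j < n" for i j
    using mult_le_mono1[of "Suc i" d n] that by (intro assms(2)) simp
  then show ?thesis
    using assms(1) by (auto simp: cube_def grid_point_def divide_le_eq)
qed

lemma coord_grid_point: "k < d * n \<Longrightarrow> coord n (grid_point d n N Q) k = real (Q k) / real N"
  using coord_bounds[of k d n] by (simp add: coord_def grid_point_def)

text \<open>A lookup returns values in [0,1], but coefficients have a sign and a size up to
  \<open>K\<close>. Their positive and negative parts, divided by \<open>K\<close>, are stored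
  separately, and output weights \<open>K\<close> and \<open>- K\<close> recombine them. The row is
  selected by these weights, the column by the indicator inside the product.\<close>

lemma sum_signed_table:
  fixes K :: real and p q d n :: nat
  assumes "p < d" "q < n" "0 < K"
  shows "(\<Sum>(p', q', e, \<sigma>)\<in>{..<d} \<times> {..<n} \<times> E \<times> UNIV.
      (if p' = p then sgn_of \<sigma> * K else 0) * (max (sgn_of \<sigma> * \<beta> p' q' e) 0 / K * (if q' = q then 1 else 0) * \<mu> e))
    = (\<Sum>e\<in>E. \<beta> p q e * \<mu> e)"
proof -
  have "(\<Sum>(p', q', e, \<sigma>)\<in>{..<d} \<times> {..<n} \<times> E \<times> UNIV.
      (if p' = p then sgn_of \<sigma> * K else 0) * (max (sgn_of \<sigma> * \<beta> p' q' e) 0 / K * (if q' = q then 1 else 0) * \<mu> e))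
    = (\<Sum>p'<d. \<Sum>q'<n. \<Sum>e\<in>E. \<Sum>\<sigma>\<in>UNIV. (if p' = p then sgn_of \<sigma> * K else 0)
        * (max (sgn_of \<sigma> * \<beta> p' q' e) 0 / K * (if q' = q then 1 else 0) * \<mu> e))"
    by (simp add: sum.cartesian_product)
  also have "\<dots> = (\<Sum>p'<d. \<Sum>q'<n. if p' = p then if q' = q then (\<Sum>e\<in>E. \<beta> p q e * \<mu> e) else 0 else 0)"
  proof (intro sum.cong refl)
    fix p' q'
    have "(\<Sum>\<sigma>\<in>UNIV. sgn_of \<sigma> * K * (max (sgn_of \<sigma> * \<beta> p' q' e) 0 / K * \<mu> e)) = \<beta> p' q' e * \<mu> e" for e
    proof -
      have "(\<Sum>\<sigma>\<in>UNIV. sgn_of \<sigma> * K * (max (sgn_of \<sigma> * \<beta> p' q' e) 0 / K * \<mu> e))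
        = (max (\<beta> p' q' e) 0 - max (- \<beta> p' q' e) 0) * \<mu> e"
        using assms(3) by (simp add: UNIV_bool sgn_of_def left_diff_distrib)
      also have "max (\<beta> p' q' e) 0 - max (- \<beta> p' q' e) 0 = \<beta> p' q' e" by simp
      finally show ?thesis .
    qed
    then show "(\<Sum>e\<in>E. \<Sum>\<sigma>\<in>UNIV. (if p' = p then sgn_of \<sigma> * K else 0)
        * (max (sgn_of \<sigma> * \<beta> p' q' e) 0 / K * (if q' = q then 1 else 0) * \<mu> e))
      = (if p' = p then if q' = q then (\<Sum>e\<in>E. \<beta> p q e * \<mu> e) else 0 else 0)"
      using assms(3) by (cases "p' = p"; cases "q' = q") simp_all
  qed
  also have "\<dots> = (\<Sum>p'<d. if p' = p then (\<Sum>e\<in>E. \<beta> p q e * \<mu> e) else 0)"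
  proof (rule sum.cong[OF refl])
    have "(\<Sum>q'<n. if q' = q then T else 0) = T" for T :: real
      using assms(2) by simp
    then show "(\<Sum>q'<n. if p' = p then if q' = q then (\<Sum>e\<in>E. \<beta> p q e * \<mu> e) else 0 else 0)
      = (if p' = p then (\<Sum>e\<in>E. \<beta> p q e * \<mu> e) else 0)" for p'
      by simp
  qed
  also have "\<dots> = (\<Sum>e\<in>E. \<beta> p q e * \<mu> e)"
    using assms(1) by simp
  finally show ?thesis .
qed

text \<open>The columns reaching the last feedforward block: after \<open>d n\<close> irrelevant entries they contain the
  one-hot position \<open>q\<close> and then all \<open>d n\<close> entries of the input matrix.\<close>
definition encoded :: "nat \<Rightarrow> nat \<Rightarrow> (mat \<times> nat \<times> vec) set" where
  "encoded d n = {(X, q, z). X \<in> cube d n \<and> q < n \<and> (\<forall>j<n. z (d * n + j) = (if j = q then 1 else 0))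
     \<and> (\<forall>k<d * n. z (d * n + n + k) = coord n X k)}"

text \<open>Reorders the column so that the coordinates of the matrix come first, as the lookup
  expects; the position keeps its place.\<close>

definition feature :: "nat \<Rightarrow> nat \<Rightarrow> nat \<Rightarrow> mat \<times> nat \<times> vec \<Rightarrow> real" where
  "feature d n u x = snd (snd x) (if u < d * n then d * n + n + u else u)"

lemma feature_coord: "(X, q, z) \<in> encoded d n \<Longrightarrow> u < d * n \<Longrightarrow> feature d n u (X, q, z) = coord n X u"
  by (simp add: encoded_def feature_def)

lemma feature_position:
  "(X, q, z) \<in> encoded d n \<Longrightarrow> j < n \<Longrightarrow> feature d n (d * n + j) (X, q, z) = (if j = q then 1 else 0)"
  by (simp add: encoded_def feature_def)

lemma feature_unit:
  assumes "x \<in> encoded d n" "u < d * n + n"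
  shows "feature d n u x \<in> {0..1}"
proof -
  obtain X q z where x: "x = (X, q, z)" by (cases x)
  show ?thesis
  proof (cases "u < d * n")
    case True
    then show ?thesis
      using feature_coord[of X q z d n u] coord_in_unit[of X d n u] assms by (simp add: x encoded_def)
  next
    case False
    then show ?thesis
      using feature_position[of X q z d n "u - d * n"] assms by (simp add: x)
  qed
qed

lemma computes_features:
  assumes "2 * (d * n) + n \<le> a"
  shows "computes a w S (\<lambda>x. snd (snd x)) {..<d * n + n} (feature d n) 0 0 b"
proof -
  have "computes a w S (\<lambda>x. snd (snd x)) {..<a} (\<lambda>i x. snd (snd x) i) 0 0 b"
    by (rule computes_input) auto
  then have "computes a w S (\<lambda>x. snd (snd x)) {..<d * n + n}
      (\<lambda>u x. snd (snd x) (if u < d * n then d * n + n + u else u)) 0 0 b"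
    by (rule computes_reindex) (use assms in \<open>auto simp: inj_on_def split: if_splits\<close>)
  moreover have "feature d n = (\<lambda>u x. snd (snd x) (if u < d * n then d * n + n + u else u))"
    by (intro ext) (simp add: feature_def)
  ultimately show ?thesis by simp
qed

text \<open>Label \<open>m + q\<close> is the indicator of position \<open>q\<close>; as a factor it
  silences the terms that belong to other columns.\<close>

definition term_factors ::
  "nat \<Rightarrow> bool list \<times> nat \<times> nat \<times> nat list \<times> bool
    \<Rightarrow> ((nat + bool \<times> nat) + bool list \<times> nat \<times> nat \<times> nat list \<times> bool) list" where
  "term_factors m t = (case t of (c, p, q, e, \<sigma>) \<Rightarrow>
     Inr t # Inl (Inl (m + q)) # map (\<lambda>i. Inl (Inr (c ! i, i))) [0..<m] @ map (\<lambda>u. Inl (Inl u)) (mono_factors e))"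

lemma prod_term_factors:
  "prod_list (map (\<lambda>v. case_sum (case_sum \<xi> (\<lambda>(c, i) x. bump N c (\<xi> i x))) U v x) (term_factors m (c, p, q, e, \<sigma>)))
    = U (c, p, q, e, \<sigma>) x * \<xi> (m + q) x * mono_val e (\<lambda>u. \<xi> u x) * (\<Prod>i<m. bump N (c ! i) (\<xi> i x))"
  by (simp add: term_factors_def comp_def prod_mono_factors[of "\<lambda>u. \<xi> u x", symmetric]
      prod.list_conv_set_nth[of "map _ [0..<m]"] lessThan_atLeast0 mult_ac)

section \<open>Size and error at a fixed resolution\<close>

text \<open>The constant precedes \<open>N\<close> and \<open>k\<close>, so it may depend on
  \<open>f\<close> but on neither of them. For a colour whose bumps do not vanish, the sum over the
  table labels is a local polynomial at a nearby grid point; the exact partition of unity averages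
  such polynomials, all of which approximate \<open>f X p q\<close>.\<close>

lemma network_for_resolution:
  fixes f :: "mat \<Rightarrow> mat"
  assumes "1 \<le> d" "1 \<le> n" "0 \<le> lam" "2 * (d * n) + n \<le> a"
    and hol: "\<forall>p<d. \<forall>q<n. holder d n s lam (\<lambda>X. f X p q)"
  shows "\<exists>C0\<ge>1. \<forall>N\<ge>1. \<forall>k. \<exists>ls w. ls \<noteq> [] \<and> real (length ls) \<le> C0 * (1 + real k)
     \<and> real w \<le> C0 * (real N + 1) ^ (d * n)
     \<and> (\<forall>y\<in>fnn_params a d w ls. \<bar>y\<bar> \<le> C0 * (real N + 1) ^ (d * n))
     \<and> real (fnn_nnz a d w ls) \<le> C0 * ((real N + 1) ^ (d * n) + real k)
     \<and> (\<forall>X q z. (X, q, z) \<in> encoded d n \<longrightarrow> (\<forall>p<d. \<bar>fnn_run a w ls z p - f X p q\<bar>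
          \<le> C0 * (1 / real N) powr (real s + lam) + C0 / 4 ^ k))"
proof -
  define m where "m = d * n"
  define \<gamma> where "\<gamma> = real s + lam"
  have m1: "1 \<le> m" using assms(1,2) by (simp add: m_def)
  have "\<exists>K\<ge>0. \<forall>a\<in>cube d n. \<exists>b. approximates_near d n s m \<gamma> K (\<lambda>X. f X p q) a b" if "p < d" "q < n" for p q
    using holder_local_polynomial[of d n s lam "\<lambda>X. f X p q"] hol that assms(2,3) unfolding m_def \<gamma>_def by metis
  then obtain K where K: "\<And>p q. p < d \<Longrightarrow> q < n \<Longrightarrow> 0 \<le> K p q"
      "\<And>p q a. p < d \<Longrightarrow> q < n \<Longrightarrow> a \<in> cube d n \<Longrightarrow> \<exists>b. approximates_near d n s m \<gamma> (K p q) (\<lambda>X. f X p q) a b"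
    by metis
  then obtain \<beta> where \<beta>: "\<And>p q a. p < d \<Longrightarrow> q < n \<Longrightarrow> a \<in> cube d n
      \<Longrightarrow> approximates_near d n s m \<gamma> (K p q) (\<lambda>X. f X p q) a (\<beta> p q a)"
    by metis
  \<comment> \<open>One bound for the coefficients of all components; the summand 1 makes it
    positive, as the table divides by it.\<close>
  define K' where "K' = 1 + (\<Sum>p<d. \<Sum>q<n. K p q)"
  have K'_ge: "K p q \<le> K'" if "p < d" "q < n" for p q
  proof -
    have "K p q \<le> (\<Sum>q<n. K p q)" using K that by (intro member_le_sum) auto
    also have "\<dots> \<le> (\<Sum>p<d. \<Sum>q<n. K p q)"
      using K that by (intro member_le_sum[of p "{..<d}" "\<lambda>p. \<Sum>q<n. K p q"] sum_nonneg) auto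
    finally show ?thesis by (simp add: K'_def)
  qed
  have "0 \<le> (\<Sum>p<d. \<Sum>q<n. K p q)" using K by (intro sum_nonneg) auto
  then have K'1: "1 \<le> K'" by (simp add: K'_def)
  define Lk where "Lk = {..<d} \<times> {..<n} \<times> expos s m \<times> (UNIV :: bool set)"
  define I where "I = {c :: bool list. length c = m} \<times> Lk"
  have finLk: "finite Lk" by (simp add: Lk_def finite_expos)
  have finC: "finite {c :: bool list. length c = m}"
    using finite_lists_length_eq[of "UNIV :: bool set" m] by simp
  have cardC: "card {c :: bool list. length c = m} = 2 ^ m"
    using card_lists_length_eq[of "UNIV :: bool set" m] by simp
  have finI: "finite I" using finC finLk by (simp add: I_def)
  have cardI: "card I = 2 ^ m * card Lk" by (simp add: I_def card_cartesian_product cardC)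
  \<comment> \<open>The factors of a term: \<open>m\<close> bumps, the table value, the position,
    and at most \<open>s\<close> powers of each of the \<open>m\<close> coordinates.\<close>
  define R where "R = m + 2 + s * m"
  define \<kappa> where "\<kappa> = (m + n) + 4 * m + 3 * 2 ^ m + 2 ^ m * card Lk + 1"
  define \<kappa>2 where "\<kappa>2 = \<kappa> + 12 * card I + 1"
  define C1 where "C1 = 5 * \<kappa>\<^sup>2 + (3 * R + 1) * \<kappa>2\<^sup>2 + d * (card I + 1) + R * \<kappa>2\<^sup>2"
  define C0 where "C0 = real \<kappa>2 + real C1 + (real m + 20 + real (card I) * K') + real (card I) * K' * real R + K' + real (7 + 3 * R)"
  have C0parts: "real \<kappa>2 \<le> C0" "real C1 \<le> C0" "real m + 20 + real (card I) * K' \<le> C0"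
      "real (card I) * K' * real R \<le> C0" "K' \<le> C0" "real (7 + 3 * R) \<le> C0" "1 \<le> C0"
    using K'1 by (auto simp: C0_def)
  have main: "\<exists>ls w. ls \<noteq> [] \<and> real (length ls) \<le> C0 * (1 + real k)
     \<and> real w \<le> C0 * (real N + 1) ^ m
     \<and> (\<forall>y\<in>fnn_params a d w ls. \<bar>y\<bar> \<le> C0 * (real N + 1) ^ m)
     \<and> real (fnn_nnz a d w ls) \<le> C0 * ((real N + 1) ^ m + real k)
     \<and> (\<forall>X q z. (X, q, z) \<in> encoded d n \<longrightarrow> (\<forall>p<d. \<bar>fnn_run a w ls z p - f X p q\<bar>
          \<le> C0 * (1 / real N) powr \<gamma> + C0 / 4 ^ k))"
    if N: "1 \<le> N" for N k
  proof -
    define S where "S = encoded d n"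
    define \<xi> where "\<xi> = feature d n"
    define G where "G = (N + 1) ^ m"
    define w where "w = \<kappa>2 * G"
    \<comment> \<open>Large enough for the index weights of the lookup, the 8 of the multiplications
      and the sum of the output weights.\<close>
    define b where "b = (real m + 20 + real (card I) * K') * real G"
    have G1: "1 \<le> G" by (simp add: G_def)
    have rG: "real G = (real N + 1) ^ m" by (simp add: G_def add.commute)
    have rG1: "1 \<le> real G" using G1 by simp
    define table where "table = (\<lambda>(p, q, e, \<sigma>) Q. max (sgn_of \<sigma> * \<beta> p q (grid_point d n N Q) e) 0 / K')"
    have table: "table l Q \<in> {0..1}" if l: "l \<in> Lk" and Q: "\<And>i. i < m \<Longrightarrow> Q i \<le> N" for l Q
    proof -
      obtain p q e \<sigma> where l': "l = (p, q, e, \<sigma>)" "p < d" "q < n"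
        using l by (auto simp: Lk_def)
      have "grid_point d n N Q \<in> cube d n"
        using N Q by (intro grid_point_cube) (auto simp: m_def)
      then have "\<bar>\<beta> p q (grid_point d n N Q) e\<bar> \<le> K'"
        using approximates_nearD(1)[OF \<beta>[OF l'(2,3)], of "grid_point d n N Q" e] K'_ge[OF l'(2,3)] by linarith
      then have "max (sgn_of \<sigma> * \<beta> p q (grid_point d n N Q) e) 0 \<le> K'"
        using K'1 by (auto simp: sgn_of_def)
      then show ?thesis using K'1 by (simp add: table_def l' divide_le_eq)
    qed
    have start: "computes a w S (\<lambda>x. snd (snd x)) {..<m + n} \<xi> 0 0 b"
      unfolding m_def \<xi>_def by (rule computes_features[OF assms(4)])
    have \<xi>: "\<xi> u x \<in> {0..1}" if "u < m + n" "x \<in> S" for u x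
      using feature_unit[of x d n u] that unfolding m_def S_def \<xi>_def by simp
    define VV where "VV = ({..<m + n} <+> (UNIV :: bool set) \<times> {..<m}) <+> I"
    have lookup: "\<exists>U. computes a w S (\<lambda>x. snd (snd x)) (({..<m + n} <+> UNIV \<times> {..<m}) <+> {c. length c = m} \<times> Lk)
        (case_sum (case_sum \<xi> (\<lambda>(c, i) x. bump N c (\<xi> i x))) U) 5 (5 * \<kappa>\<^sup>2 * (N + 1) ^ m) b
      \<and> (\<forall>t\<in>{c. length c = m} \<times> Lk. \<forall>x\<in>S. U t x \<in> {0..1})
      \<and> (\<forall>c x. length c = m \<longrightarrow> x \<in> S \<longrightarrow> (\<forall>i<m. bump N (c ! i) (\<xi> i x) \<noteq> 0)
        \<longrightarrow> (\<exists>q. (\<forall>i<m. q i \<le> N \<and> \<bar>\<xi> i x - real (q i) / real N\<bar> \<le> 1 / real N) \<and> (\<forall>l\<in>Lk. U (c, l) x = table l q)))"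
    proof (rule computes_lookup[OF start \<xi> m1 _ N finLk table])
      show "(real m + 12) * (real N + 1) ^ m \<le> b"
        unfolding b_def rG[symmetric] using K'1 by (intro mult_right_mono) auto
      show "\<kappa> * (N + 1) ^ m \<le> w"
        unfolding w_def G_def \<kappa>2_def by (intro mult_right_mono) auto
    qed (auto simp: \<kappa>_def)
    then obtain U where U: "computes a w S (\<lambda>x. snd (snd x)) VV
        (case_sum (case_sum \<xi> (\<lambda>(c, i) x. bump N c (\<xi> i x))) U) 5 (5 * \<kappa>\<^sup>2 * G) b"
      and U01: "\<And>t x. t \<in> I \<Longrightarrow> x \<in> S \<Longrightarrow> U t x \<in> {0..1}"
      and Ugood: "\<And>c x. length c = m \<Longrightarrow> x \<in> S \<Longrightarrow> \<forall>i<m. bump N (c ! i) (\<xi> i x) \<noteq> 0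
        \<Longrightarrow> \<exists>q. (\<forall>i<m. q i \<le> N \<and> \<bar>\<xi> i x - real (q i) / real N\<bar> \<le> 1 / real N) \<and> (\<forall>l\<in>Lk. U (c, l) x = table l q)"
      unfolding VV_def I_def G_def by blast
    define FF where "FF = case_sum (case_sum \<xi> (\<lambda>(c, i) x. bump N c (\<xi> i x))) U"
    have FF: "FF v x \<in> {0..1}" if "v \<in> VV" "x \<in> S" for v x
    proof -
      have "bump N c (\<xi> i x) \<in> {0..1}" if "i < m" for c i
        using \<xi>[of i x] that \<open>x \<in> S\<close> by (intro bump_unit N) auto
      then show ?thesis
        using that \<xi>[of _ x] U01[of _ x] unfolding VV_def FF_def by (elim PlusE) auto
    qed
    have cardVV: "card VV + 1 \<le> \<kappa>"
      using finI by (simp add: VV_def card_Plus card_cartesian_product \<kappa>_def cardI)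
    have "b \<ge> 8"
    proof -
      have "8 * 1 \<le> (real m + 20 + real (card I) * K') * real G"
        using rG1 K'1 by (intro mult_mono) auto
      then show ?thesis by (simp add: b_def)
    qed
    have sub: "set (term_factors m t) \<subseteq> VV" if "t \<in> I" for t
    proof -
      obtain c p q e \<sigma> where t: "t = (c, p, q, e, \<sigma>)" "q < n" "e \<in> expos s m"
        using \<open>t \<in> I\<close> by (auto simp: I_def Lk_def)
      then have "set (mono_factors e) \<subseteq> {..<m}"
        using set_mono_factors[of e] by (simp add: expos_def)
      then show ?thesis using t that by (auto simp: term_factors_def VV_def)
    qed
    have len: "length (term_factors m t) \<le> R" if "t \<in> I" for t
    proof -
      obtain c p q e \<sigma> where t: "t = (c, p, q, e, \<sigma>)" "q < n" "e \<in> expos s m"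
        using \<open>t \<in> I\<close> by (auto simp: I_def Lk_def)
      then show ?thesis
        using length_mono_factors[of e s] by (simp add: expos_def term_factors_def R_def)
    qed
    have wle: "card VV + 1 + 12 * card I \<le> w"
    proof -
      have "card VV + 1 + 12 * card I \<le> \<kappa>2 * 1" using cardVV by (simp add: \<kappa>2_def)
      also have "\<dots> \<le> \<kappa>2 * G" using G1 by (rule mult_le_mono2)
      finally show ?thesis by (simp add: w_def)
    qed
    have "\<exists>P. computes a w S (\<lambda>x. snd (snd x)) I P (Suc 5 + R * (k + 3))
        (5 * \<kappa>\<^sup>2 * G + (R * (k + 3) + 1) * (card VV + 12 * card I + 2)\<^sup>2) b
      \<and> (\<forall>t\<in>I. \<forall>x\<in>S. \<bar>P t x - prod_list (map (\<lambda>v. FF v x) (term_factors m t))\<bar> \<le> real R / 4 ^ k)"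
      by (rule computes_products[OF U[folded FF_def] FF finI sub len \<open>8 \<le> b\<close> wle])
    then obtain P where P: "computes a w S (\<lambda>x. snd (snd x)) I P (Suc 5 + R * (k + 3))
        (5 * \<kappa>\<^sup>2 * G + (R * (k + 3) + 1) * (card VV + 12 * card I + 2)\<^sup>2) b"
      and Perr: "\<And>t x. t \<in> I \<Longrightarrow> x \<in> S \<Longrightarrow> \<bar>P t x - prod_list (map (\<lambda>v. FF v x) (term_factors m t))\<bar> \<le> real R / 4 ^ k"
      by blast
    define co where "co = (\<lambda>p (t :: bool list \<times> nat \<times> nat \<times> nat list \<times> bool).
      case t of (c, p', q, e, \<sigma>) \<Rightarrow> if p' = p then sgn_of \<sigma> * K' else 0)"
    have co: "\<bar>co p t\<bar> \<le> K'" for p t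
      using K'1 by (auto simp: co_def sgn_of_def abs_mult split: prod.splits)
    define out where "out = (\<lambda>p x. \<Sum>t\<in>I. co p t * P t x)"
    have aff: "affine_comb S I P b (out p)" for p
    proof -
      have "affine_comb S I P (\<Sum>t\<in>I. \<bar>co p t\<bar> * 1) (\<lambda>x. \<Sum>t\<in>I. co p t * P t x)"
        by (intro affine_comb_sum affine_comb_scale affine_comb_base finI) auto
      moreover have "(\<Sum>t\<in>I. \<bar>co p t\<bar> * 1) \<le> b"
      proof -
        have "(\<Sum>t\<in>I. \<bar>co p t\<bar> * 1) \<le> (\<Sum>t\<in>I. K')" by (intro sum_mono) (use co in auto)
        also have "\<dots> \<le> (real m + 20 + real (card I) * K') * 1" by simp
        also have "\<dots> \<le> b" unfolding b_def using rG1 K'1 by (intro mult_left_mono) auto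
        finally show ?thesis .
      qed
      ultimately show ?thesis unfolding out_def by (rule affine_comb_mono)
    qed
    have b0: "0 \<le> b" using \<open>8 \<le> b\<close> by simp
    obtain ls where ls: "length ls = Suc (Suc 5 + R * (k + 3))"
      "\<And>x p. x \<in> S \<Longrightarrow> p < d \<Longrightarrow> fnn_run a w ls (snd (snd x)) p = out p x"
      "\<And>y. y \<in> fnn_params a d w ls \<Longrightarrow> \<bar>y\<bar> \<le> b"
      "fnn_nnz a d w ls \<le> 5 * \<kappa>\<^sup>2 * G + (R * (k + 3) + 1) * (card VV + 12 * card I + 2)\<^sup>2 + d * (card I + 1)"
      using computes_output[OF P b0, of d out] aff by blast
    have err: "\<bar>out p (X, q, z) - f X p q\<bar> \<le> C0 * (1 / real N) powr \<gamma> + C0 / 4 ^ k"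
      if x: "(X, q, z) \<in> S" and p: "p < d" for X q z p
    proof -
      let ?x = "(X, q, z)"
      have X: "X \<in> cube d n" and q: "q < n" using x by (auto simp: S_def encoded_def)
      \<comment> \<open>\<open>ex\<close> is the output with exact products, \<open>th c\<close> the
        partition weight of colour \<open>c\<close>, and \<open>Sc c\<close> the sum over its table
        labels.\<close>
      define ex where "ex = (\<Sum>t\<in>I. co p t * prod_list (map (\<lambda>v. FF v ?x) (term_factors m t)))"
      define th where "th = (\<lambda>c. \<Prod>i<m. bump N (c ! i) (\<xi> i ?x))"
      define Sc where "Sc = (\<lambda>c. \<Sum>(p', q', e, \<sigma>)\<in>Lk. (if p' = p then sgn_of \<sigma> * K' else 0) *
        (U (c, p', q', e, \<sigma>) ?x * (if q' = q then 1 else 0) * mono_val e (coord n X)))"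
      have "\<bar>out p ?x - ex\<bar> \<le> (\<Sum>t\<in>I. K' * (real R / 4 ^ k))"
      proof -
        have "out p ?x - ex = (\<Sum>t\<in>I. co p t * (P t ?x - prod_list (map (\<lambda>v. FF v ?x) (term_factors m t))))"
          by (simp add: out_def ex_def sum_subtractf right_diff_distrib)
        also have "\<bar>\<dots>\<bar> \<le> (\<Sum>t\<in>I. \<bar>co p t * (P t ?x - prod_list (map (\<lambda>v. FF v ?x) (term_factors m t)))\<bar>)"
          by (rule sum_abs)
        also have "\<dots> \<le> (\<Sum>t\<in>I. K' * (real R / 4 ^ k))"
          unfolding abs_mult using Perr[OF _ x] co K'1 by (intro sum_mono mult_mono) auto
        finally show ?thesis .
      qed
      also have "\<dots> = real (card I) * K' * real R / 4 ^ k" by simp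
      also have "\<dots> \<le> C0 / 4 ^ k" using C0parts by (intro divide_right_mono) auto
      finally have e1: "\<bar>out p ?x - ex\<bar> \<le> C0 / 4 ^ k" .
      have exeq: "ex = (\<Sum>c | length c = m. th c * Sc c)"
      proof -
        have "ex = (\<Sum>c | length c = m. \<Sum>l\<in>Lk. co p (c, l) * prod_list (map (\<lambda>v. FF v ?x) (term_factors m (c, l))))"
          unfolding ex_def I_def by (simp add: sum.cartesian_product)
        also have "\<dots> = (\<Sum>c | length c = m. th c * Sc c)"
        proof (rule sum.cong[OF refl])
          fix c :: "bool list"
          have "co p (c, l) * prod_list (map (\<lambda>v. FF v ?x) (term_factors m (c, l)))
            = th c * (case l of (p', q', e, \<sigma>) \<Rightarrow> (if p' = p then sgn_of \<sigma> * K' else 0) *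
        (U (c, p', q', e, \<sigma>) ?x * (if q' = q then 1 else 0) * mono_val e (coord n X)))" if l: "l \<in> Lk" for l
          proof -
            obtain p' q' e \<sigma> where l': "l = (p', q', e, \<sigma>)" "q' < n" "e \<in> expos s m"
              using l by (auto simp: Lk_def)
            have "mono_val e (\<lambda>u. \<xi> u ?x) = mono_val e (coord n X)"
              using feature_coord[of X q z d n] x l'(3)
              by (intro mono_val_cong) (auto simp: \<xi>_def S_def expos_def m_def)
            moreover have "\<xi> (m + q') ?x = (if q' = q then 1 else 0)"
              using feature_position[of X q z d n q'] x l'(2) by (simp add: \<xi>_def S_def m_def)
            ultimately show ?thesis
              unfolding FF_def l' prod_term_factors th_def co_def by simp
          qed
          then show "(\<Sum>l\<in>Lk. co p (c, l) * prod_list (map (\<lambda>v. FF v ?x) (term_factors m (c, l)))) = th c * Sc c"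
            unfolding Sc_def sum_distrib_left by (intro sum.cong refl) (simp add: case_prod_unfold)
        qed
        finally show ?thesis .
      qed
      have th0: "0 \<le> th c" for c
        unfolding th_def using bump_unit[OF \<xi>[OF _ x] N] by (intro prod_nonneg) auto
      have th1: "(\<Sum>c | length c = m. th c) = 1"
        unfolding th_def by (rule colour_partition) (rule bump_partition)
      \<comment> \<open>If a bump of \<open>c\<close> vanishes, the lookup is uncontrolled but both
        sides are 0. Otherwise it returns the coefficients of a grid point \<open>A\<close> within
        \<open>1 / N\<close> of \<open>X\<close> in each coordinate.\<close>
      have local: "\<bar>th c * (Sc c - f X p q)\<bar> \<le> th c * (K' * (1 / real N) powr \<gamma>)" if c: "length c = m" for c
      proof (cases "th c = 0")
        case False
        then have "\<forall>i<m. bump N (c ! i) (\<xi> i ?x) \<noteq> 0"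
          by (auto simp: th_def)
        from Ugood[OF c x this] obtain Q where Q: "\<And>i. i < m \<Longrightarrow> Q i \<le> N \<and> \<bar>\<xi> i ?x - real (Q i) / real N\<bar> \<le> 1 / real N"
          and UQ: "\<And>l. l \<in> Lk \<Longrightarrow> U (c, l) ?x = table l Q" by blast
        define A where "A = grid_point d n N Q"
        have A: "A \<in> cube d n" unfolding A_def using N Q by (intro grid_point_cube) (auto simp: m_def)
        have "Sc c = (\<Sum>(p', q', e, \<sigma>)\<in>Lk. (if p' = p then sgn_of \<sigma> * K' else 0) *
          (max (sgn_of \<sigma> * \<beta> p' q' A e) 0 / K' * (if q' = q then 1 else 0) * mono_val e (coord n X)))"
          unfolding Sc_def by (rule sum.cong) (auto simp: UQ table_def A_def)
        also have "\<dots> = (\<Sum>e\<in>expos s m. \<beta> p q A e * mono_val e (coord n X))"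
          unfolding Lk_def using K'1 by (intro sum_signed_table p q) auto
        finally have Sc: "Sc c = (\<Sum>e\<in>expos s m. \<beta> p q A e * mono_val e (coord n X))" .
        have "\<bar>f X p q - Sc c\<bar> \<le> K p q * (1 / real N) powr \<gamma>"
          unfolding Sc
        proof (rule approximates_nearD(2)[OF \<beta>[OF p q A] _ X])
          show "0 < 1 / real N" using N by simp
          show "\<bar>coord n X i - coord n A i\<bar> \<le> 1 / real N" if "i < m" for i
            using Q[OF that] feature_coord[of X q z d n i] coord_grid_point[of i d n N Q] x that
            by (simp add: A_def \<xi>_def S_def m_def)
        qed (simp add: m_def)
        also have "\<dots> \<le> K' * (1 / real N) powr \<gamma>"
          using K'_ge[OF p q] by (intro mult_right_mono) auto
        finally have "\<bar>Sc c - f X p q\<bar> \<le> K' * (1 / real N) powr \<gamma>" by (simp add: abs_minus_commute)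
        then show ?thesis using th0[of c] by (simp add: abs_mult mult_left_mono)
      qed simp
      have "\<bar>ex - f X p q\<bar> = \<bar>\<Sum>c | length c = m. th c * (Sc c - f X p q)\<bar>"
      proof -
        have "f X p q = (\<Sum>c | length c = m. th c * f X p q)"
          using th1 by (simp add: sum_distrib_right[symmetric])
        then show ?thesis unfolding exeq by (simp add: right_diff_distrib sum_subtractf)
      qed
      also have "\<dots> \<le> (\<Sum>c | length c = m. \<bar>th c * (Sc c - f X p q)\<bar>)" by (rule sum_abs)
      also have "\<dots> \<le> (\<Sum>c | length c = m. th c * (K' * (1 / real N) powr \<gamma>))"
        using local by (intro sum_mono) auto
      also have "\<dots> = K' * (1 / real N) powr \<gamma>"
        using th1 by (simp add: sum_distrib_right[symmetric])
      also have "\<dots> \<le> C0 * (1 / real N) powr \<gamma>"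
        using C0parts by (intro mult_right_mono) auto
      finally show ?thesis using e1 by linarith
    qed
    have lenls: "real (length ls) \<le> C0 * (1 + real k)"
    proof -
      have "real (length ls) = real (7 + 3 * R) * 1 + real R * real k" unfolding ls(1) by (simp add: algebra_simps)
      also have "\<dots> \<le> C0 * 1 + C0 * real k"
        using C0parts(6) by (intro add_mono mult_right_mono) auto
      finally show ?thesis by (simp add: algebra_simps)
    qed
    have wbound: "real w \<le> C0 * (real N + 1) ^ m"
      unfolding rG[symmetric] w_def of_nat_mult using C0parts(1) by (intro mult_right_mono) auto
    have bbound: "b \<le> C0 * (real N + 1) ^ m"
      unfolding rG[symmetric] b_def using C0parts(3) by (intro mult_right_mono) auto
    have nnz: "real (fnn_nnz a d w ls) \<le> C0 * ((real N + 1) ^ m + real k)"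
    proof -
      have "(card VV + 12 * card I + 2)\<^sup>2 \<le> \<kappa>2\<^sup>2"
        using cardVV by (intro power_mono) (auto simp: \<kappa>2_def)
      then have "(R * (k + 3) + 1) * (card VV + 12 * card I + 2)\<^sup>2 \<le> (R * (k + 3) + 1) * \<kappa>2\<^sup>2"
        by (rule mult_le_mono2)
      with ls(4) have "fnn_nnz a d w ls \<le> 5 * \<kappa>\<^sup>2 * G + (R * (k + 3) + 1) * \<kappa>2\<^sup>2 + d * (card I + 1)"
        by linarith
      also have "\<dots> = 5 * \<kappa>\<^sup>2 * G + ((3 * R + 1) * \<kappa>2\<^sup>2 + d * (card I + 1)) * 1 + R * \<kappa>2\<^sup>2 * k"
        by (simp add: algebra_simps)
      also have "\<dots> \<le> 5 * \<kappa>\<^sup>2 * G + ((3 * R + 1) * \<kappa>2\<^sup>2 + d * (card I + 1)) * G + R * \<kappa>2\<^sup>2 * k"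
        using G1 by (intro add_mono mult_le_mono2) auto
      also have "\<dots> \<le> C1 * (G + k)"
        unfolding C1_def by (simp add: algebra_simps)
      finally have "real (fnn_nnz a d w ls) \<le> real (C1 * (G + k))" by (simp only: of_nat_le_iff)
      also have "\<dots> = real C1 * (real G + real k)" by simp
      also have "\<dots> \<le> C0 * (real G + real k)"
        using C0parts(2) by (intro mult_right_mono) auto
      finally show ?thesis by (simp add: rG)
    qed
    show ?thesis
    proof (intro exI conjI allI impI ballI)
      show "ls \<noteq> []" using ls(1) by auto
      show "real (length ls) \<le> C0 * (1 + real k)" by (rule lenls)
      show "real w \<le> C0 * (real N + 1) ^ m" by (rule wbound)
      show "real (fnn_nnz a d w ls) \<le> C0 * ((real N + 1) ^ m + real k)" by (rule nnz)
      show "\<bar>y\<bar> \<le> C0 * (real N + 1) ^ m" if "y \<in> fnn_params a d w ls" for y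
        using ls(3)[OF that] bbound by linarith
      show "\<bar>fnn_run a w ls z p - f X p q\<bar> \<le> C0 * (1 / real N) powr \<gamma> + C0 / 4 ^ k"
        if "(X, q, z) \<in> encoded d n" "p < d" for X q z p
        using err[of X q z p] ls(2)[of "(X, q, z)" p] that by (simp add: S_def)
    qed
  qed
  show ?thesis
    using main C0parts(7) unfolding m_def \<gamma>_def by blast
qed

section \<open>Choice of the resolution for a given accuracy\<close>

lemma network_for_accuracy:
  fixes f :: "mat \<Rightarrow> mat"
  assumes "1 \<le> d" "1 \<le> n" "0 < lam" "2 * (d * n) + n \<le> a"
    and hol: "\<forall>p<d. \<forall>q<n. holder d n s lam (\<lambda>X. f X p q)"
  defines "\<gamma> \<equiv> real s + lam"
  shows "\<exists>C\<ge>1. \<forall>\<epsilon>. 0 < \<epsilon> \<longrightarrow> \<epsilon> < 1 \<longrightarrow> (\<exists>ls w. ls \<noteq> []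
     \<and> real (length ls) \<le> C * max 1 (ln (1 / \<epsilon>))
     \<and> real w \<le> C * \<epsilon> powr (- (real (d * n) / \<gamma>))
     \<and> (\<forall>y\<in>fnn_params a d w ls. \<bar>y\<bar> \<le> C * \<epsilon> powr (- (real (d * n) / \<gamma>)))
     \<and> real (fnn_nnz a d w ls) \<le> C * \<epsilon> powr (- (real (d * n) / \<gamma>))
     \<and> (\<forall>X q z. (X, q, z) \<in> encoded d n \<longrightarrow> (\<forall>p<d. \<bar>fnn_run a w ls z p - f X p q\<bar> \<le> \<epsilon>)))"
proof -
  define m where "m = d * n"
  have m1: "1 \<le> m" using assms(1,2) by (simp add: m_def)
  have \<gamma>: "0 < \<gamma>" using assms(3) by (simp add: \<gamma>_def)
  obtain C0 where C0: "1 \<le> C0" and net: "\<And>N k. 1 \<le> N \<Longrightarrow> \<exists>ls w. ls \<noteq> [] \<and> real (length ls) \<le> C0 * (1 + real k)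
     \<and> real w \<le> C0 * (real N + 1) ^ m
     \<and> (\<forall>y\<in>fnn_params a d w ls. \<bar>y\<bar> \<le> C0 * (real N + 1) ^ m)
     \<and> real (fnn_nnz a d w ls) \<le> C0 * ((real N + 1) ^ m + real k)
     \<and> (\<forall>X q z. (X, q, z) \<in> encoded d n \<longrightarrow> (\<forall>p<d. \<bar>fnn_run a w ls z p - f X p q\<bar>
          \<le> C0 * (1 / real N) powr \<gamma> + C0 / 4 ^ k))"
    using network_for_resolution[OF assms(1,2) less_imp_le[OF assms(3)] assms(4) hol] unfolding m_def \<gamma>_def by blast
  \<comment> \<open>\<open>3 ^ m\<close> comes from \<open>N + 1 \<le> t + 2 \<le> 3 * t\<close>. In
    \<open>B\<close> below, the 2 covers the rounding in \<open>k\<close> and the term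
    \<open>ln (1 / \<epsilon>)\<close>; \<open>B'\<close> absorbs the logarithm into a power of
    \<open>\<epsilon>\<close>.\<close>
  define A where "A = 3 ^ m * (2 * C0) powr (real m / \<gamma>)"
  define B where "B = ln (2 * C0) + 2"
  define B' where "B' = B * (1 + \<gamma> / real m)"
  have A0: "0 \<le> A" by (simp add: A_def)
  have B2: "2 \<le> B" using C0 by (simp add: B_def)
  have B'0: "0 \<le> B'" using B2 \<gamma> by (simp add: B'_def)
  define C where "C = C0 * (1 + A + B + B')"
  have C1: "1 \<le> C"
  proof -
    have "1 * 1 \<le> C0 * (1 + A + B + B')" using C0 A0 B2 B'0 by (intro mult_mono) auto
    then show ?thesis by (simp add: C_def)
  qed
  show ?thesis
  proof (intro exI[of _ C] conjI C1 allI impI)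
    fix \<epsilon> :: real assume \<epsilon>: "0 < \<epsilon>" "\<epsilon> < 1"
    define E where "E = \<epsilon> powr (- (real m / \<gamma>))"
    define L where "L = max 1 (ln (1 / \<epsilon>))"
    \<comment> \<open>The real solution of
      \<open>C0 * (1 / t) powr \<gamma> = \<epsilon> / 2\<close>; \<open>k\<close> plays the same
      role for the products, a natural logarithm being enough since
      \<open>exp 1 \<le> 4\<close>.\<close>
    define t where "t = (2 * C0 / \<epsilon>) powr (1 / \<gamma>)"
    define N where "N = nat \<lceil>t\<rceil>"
    define k where "k = nat \<lceil>ln (2 * C0 / \<epsilon>)\<rceil>"
    have big: "1 \<le> 2 * C0 / \<epsilon>" using C0 \<epsilon> by (simp add: divide_simps)
    have t1: "1 \<le> t" unfolding t_def using big \<gamma> by (intro ge_one_powr_ge_zero) auto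
    have Nt: "t \<le> real N" "real N \<le> t + 1" using t1 unfolding N_def by linarith+
    have N1: "1 \<le> N" using t1 Nt(1) by (metis of_nat_1 of_nat_le_iff order_trans)
    have ln0: "0 \<le> ln (2 * C0 / \<epsilon>)" using big by (rule ln_ge_zero)
    have k: "ln (2 * C0 / \<epsilon>) \<le> real k" "real k \<le> ln (2 * C0 / \<epsilon>) + 1"
      using ln0 unfolding k_def by linarith+
    have e1: "C0 * (1 / real N) powr \<gamma> \<le> \<epsilon> / 2"
    proof -
      have "(1 / real N) powr \<gamma> \<le> (1 / t) powr \<gamma>"
        using Nt t1 \<gamma> by (intro powr_mono2) (auto simp: divide_simps)
      also have "\<dots> = \<epsilon> / (2 * C0)"
        using \<gamma> C0 \<epsilon> by (simp add: t_def powr_divide powr_powr)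
      finally have "C0 * (1 / real N) powr \<gamma> \<le> C0 * (\<epsilon> / (2 * C0))"
        using C0 by (intro mult_left_mono) auto
      then show ?thesis using C0 by simp
    qed
    have e2: "C0 / 4 ^ k \<le> \<epsilon> / 2"
    proof -
      have "2 * C0 / \<epsilon> = exp (ln (2 * C0 / \<epsilon>))" using big by simp
      also have "\<dots> \<le> exp (real k)" using k(1) by simp
      also have "\<dots> = exp 1 ^ k" using exp_of_nat_mult[of k "1::real"] by simp
      also have "\<dots> \<le> 4 ^ k" using exp_le by (intro power_mono) auto
      finally show ?thesis using \<epsilon> by (simp add: divide_simps mult_ac)
    qed
    have E1: "1 \<le> E"
    proof -
      have "\<epsilon> powr 0 \<le> \<epsilon> powr (- (real m / \<gamma>))" using \<epsilon> \<gamma> by (intro powr_mono') auto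
      then show ?thesis using \<epsilon> by (simp add: E_def)
    qed
    have NE: "(real N + 1) ^ m \<le> A * E"
    proof -
      have "(real N + 1) ^ m \<le> (3 * t) ^ m" using Nt t1 by (intro power_mono) auto
      also have "\<dots> = 3 ^ m * t powr real m"
        using t1 by (simp add: power_mult_distrib powr_realpow)
      also have "\<dots> = 3 ^ m * (2 * C0 / \<epsilon>) powr (real m / \<gamma>)"
        by (simp add: t_def powr_powr)
      also have "\<dots> = A * E"
        using C0 \<epsilon> by (simp add: A_def E_def powr_divide powr_minus field_simps)
      finally show ?thesis .
    qed
    have kL: "real k \<le> B * L"
    proof -
      have l0: "0 \<le> ln (2 * C0)" using C0 by (intro ln_ge_zero) auto
      have "ln (2 * C0 / \<epsilon>) = ln (2 * C0) + ln (1 / \<epsilon>)"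
        using C0 \<epsilon> by (simp add: ln_div ln_mult)
      then have "real k \<le> ln (2 * C0) * 1 + L + 1" using k(2) by (simp add: L_def)
      also have "\<dots> \<le> ln (2 * C0) * L + L + L"
        using l0 by (intro add_mono mult_left_mono) (auto simp: L_def)
      finally show ?thesis by (simp add: B_def algebra_simps)
    qed
    \<comment> \<open>Combine \<open>ln E \<le> E\<close> with
      \<open>ln (1 / \<epsilon>) = \<gamma> / m * ln E\<close>.\<close>
    have LE: "L \<le> (1 + \<gamma> / real m) * E"
    proof -
      have "ln E \<le> E" using ln_le_minus_one[of E] E1 by linarith
      moreover have "ln (1 / \<epsilon>) = \<gamma> / real m * ln E"
        using \<epsilon> \<gamma> m1 by (simp add: E_def ln_powr ln_div)
      ultimately have "ln (1 / \<epsilon>) \<le> \<gamma> / real m * E"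
        using \<gamma> by (simp add: divide_right_mono mult_left_mono)
      moreover have "0 \<le> \<gamma> / real m * E" using \<gamma> E1 by simp
      ultimately show ?thesis using E1 by (simp add: L_def distrib_right)
    qed
    have kE: "real k \<le> B' * E"
    proof -
      have "B * L \<le> B * ((1 + \<gamma> / real m) * E)" using B2 LE by (intro mult_left_mono) auto
      then show ?thesis using kL by (simp add: B'_def mult_ac)
    qed
    have L1: "1 \<le> L" by (simp add: L_def)
    have CN: "C0 * (real N + 1) ^ m \<le> C * E"
    proof -
      have "(real N + 1) ^ m \<le> (1 + A + B + B') * E"
        using NE B2 B'0 E1 by (intro order_trans[OF NE] mult_right_mono) auto
      then show ?thesis using C0 by (simp add: C_def mult.assoc mult_left_mono)
    qed
    obtain ls w where ls: "ls \<noteq> []" "real (length ls) \<le> C0 * (1 + real k)"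
      "real w \<le> C0 * (real N + 1) ^ m"
      "\<forall>y\<in>fnn_params a d w ls. \<bar>y\<bar> \<le> C0 * (real N + 1) ^ m"
      "real (fnn_nnz a d w ls) \<le> C0 * ((real N + 1) ^ m + real k)"
      "\<forall>X q z. (X, q, z) \<in> encoded d n \<longrightarrow> (\<forall>p<d. \<bar>fnn_run a w ls z p - f X p q\<bar>
          \<le> C0 * (1 / real N) powr \<gamma> + C0 / 4 ^ k)"
      using net[OF N1] by blast
    show "\<exists>ls w. ls \<noteq> [] \<and> real (length ls) \<le> C * max 1 (ln (1 / \<epsilon>))
       \<and> real w \<le> C * \<epsilon> powr (- (real (d * n) / \<gamma>))
       \<and> (\<forall>y\<in>fnn_params a d w ls. \<bar>y\<bar> \<le> C * \<epsilon> powr (- (real (d * n) / \<gamma>)))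
       \<and> real (fnn_nnz a d w ls) \<le> C * \<epsilon> powr (- (real (d * n) / \<gamma>))
       \<and> (\<forall>X q z. (X, q, z) \<in> encoded d n \<longrightarrow> (\<forall>p<d. \<bar>fnn_run a w ls z p - f X p q\<bar> \<le> \<epsilon>))"
      unfolding m_def[symmetric] E_def[symmetric] L_def[symmetric]
    proof (intro exI conjI ballI allI impI)
      show "ls \<noteq> []" by (rule ls(1))
      have "1 + real k \<le> (1 + A + B + B') * L"
      proof -
        have "1 + real k \<le> 1 * L + B * L" using kL L1 by linarith
        also have "\<dots> = (1 + B) * L" by (simp add: distrib_right)
        also have "\<dots> \<le> (1 + A + B + B') * L" using A0 B'0 L1 by (intro mult_right_mono) auto
        finally show ?thesis .
      qed
      then have "C0 * (1 + real k) \<le> C0 * ((1 + A + B + B') * L)" using C0 by (intro mult_left_mono) auto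
      then show "real (length ls) \<le> C * L" using ls(2) by (simp add: C_def mult.assoc)
      show "real w \<le> C * E" using ls(3) CN by linarith
      show "\<bar>y\<bar> \<le> C * E" if "y \<in> fnn_params a d w ls" for y
        using ls(4) that CN by fastforce
      have "(real N + 1) ^ m + real k \<le> (1 + A + B + B') * E"
      proof -
        have "(real N + 1) ^ m + real k \<le> (A + B') * E" using NE kE by (simp add: distrib_right)
        also have "\<dots> \<le> (1 + A + B + B') * E" using B2 E1 by (intro mult_right_mono) auto
        finally show ?thesis .
      qed
      then have "C0 * ((real N + 1) ^ m + real k) \<le> C0 * ((1 + A + B + B') * E)" using C0 by (intro mult_left_mono) auto
      then show "real (fnn_nnz a d w ls) \<le> C * E" using ls(5) by (simp add: C_def mult.assoc)
      show "\<bar>fnn_run a w ls z p - f X p q\<bar> \<le> \<epsilon>" if "(X, q, z) \<in> encoded d n" "p < d" for X q z p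
        using ls(6)[rule_format, OF that] e1 e2 by linarith
    qed
  qed
qed

section \<open>The Transformer\<close>

definition id_mat :: "nat \<Rightarrow> mat" where
  "id_mat D = (\<lambda>i j. if i = j \<and> i < D then 1 else 0)"

lemma aff_id_mat: "D \<le> m \<Longrightarrow> aff m (id_mat D) (\<lambda>_. 0) z = (\<lambda>i. if i < D then z i else 0)"
proof
  fix i assume "D \<le> m"
  have "(\<Sum>j<m. id_mat D i j * z j) = (\<Sum>j<m. if j = i then (if i < D then z i else 0) else 0)"
    by (rule sum.cong) (auto simp: id_mat_def)
  then show "aff m (id_mat D) (\<lambda>_. 0) z i = (if i < D then z i else 0)"
    using \<open>D \<le> m\<close> by (simp add: aff_def)
qed

text \<open>Hidden layers clip at 0, so only nonnegative entries survive. The matrix vanishes beyond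
  \<open>D\<close>, and the width may therefore exceed \<open>D\<close>.\<close>

lemma id_layers:
  assumes "D \<le> m" "D \<le> w" "\<And>i. i < D \<Longrightarrow> 0 \<le> z i" "p < D"
  shows "fnn_run m w [(id_mat D, \<lambda>_. 0), (id_mat D, \<lambda>_. 0), (id_mat D, \<lambda>_. 0)] z p = z p"
  using assms by (simp add: aff_id_mat relu_def)

definition id_block :: "nat \<Rightarrow> (mat \<times> vec) list" where
  "id_block D = replicate 3 (id_mat D, \<lambda>_. 0)"

lemma id_block_run:
  assumes "D \<le> w" "\<And>i. i < D \<Longrightarrow> 0 \<le> z i" "p < D"
  shows "fnn_run D w (id_block D) z p = z p"
  using id_layers[OF order_refl assms] by (simp add: id_block_def numeral_3_eq_3)

definition emb_W :: "nat \<Rightarrow> mat" where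
  "emb_W d = (\<lambda>i k. if i = k \<and> i < d then 1 else 0)"
definition emb_B :: "nat \<Rightarrow> mat" where
  "emb_B d = (\<lambda>i j. if i = d + j then 1 else 0)"

lemma emb_layer_value:
  "emb_layer d (emb_W d) (emb_B d) X i j = (if i < d then X i j else if i = d + j then 1 else 0)"
proof -
  have "(\<Sum>k<d. emb_W d i k * X k j) = (\<Sum>k<d. if k = i then X i j else 0)"
    by (rule sum.cong) (auto simp: emb_W_def)
  then show ?thesis by (simp add: emb_layer_def emb_B_def)
qed

text \<open>Row \<open>i * n + j\<close> computes \<open>max (x\<^sub>i + e\<^sub>j - 1) 0\<close>, where \<open>e\<close> is the one-hot position:
  it keeps \<open>x\<^sub>i\<close> in column \<open>j\<close> and vanishes in the others.\<close>
definition mask_W :: "nat \<Rightarrow> nat \<Rightarrow> mat" where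
  "mask_W d n = (\<lambda>r c. if r < d * n then (if c = r div n \<or> c = d + r mod n then 1 else 0)
     else if r < d * n + n \<and> c = d + (r - d * n) then 1 else 0)"
definition mask_c :: "nat \<Rightarrow> nat \<Rightarrow> vec" where
  "mask_c d n = (\<lambda>r. if r < d * n then - 1 else 0)"

text \<open>Masking takes a single hidden layer; the three identity layers behind it bring the depth
  to the prescribed 4.\<close>

definition mask_block :: "nat \<Rightarrow> nat \<Rightarrow> nat \<Rightarrow> (mat \<times> vec) list" where
  "mask_block d n D = (mask_W d n, mask_c d n) # id_block D"

definition masked :: "nat \<Rightarrow> nat \<Rightarrow> mat \<Rightarrow> mat" where
  "masked d n X = (\<lambda>r j. if r < d * n then (if r mod n = j then coord n X r else 0)
     else if r = d * n + j then 1 else 0)"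

lemma mask_layer:
  assumes X: "X \<in> cube d n" and j: "j < n" and d0: "d + n \<le> d0"
  shows "relu (aff d0 (mask_W d n) (mask_c d n) (\<lambda>k. emb_layer d (emb_W d) (emb_B d) X k j)) r = masked d n X r j"
proof -
  let ?z = "\<lambda>k. emb_layer d (emb_W d) (emb_B d) X k j"
  consider "r < d * n" | "d * n \<le> r" "r < d * n + n" | "d * n + n \<le> r" by linarith
  then show ?thesis
  proof cases
    case 1
    note b = coord_bounds[OF 1]
    have "(\<Sum>c<d0. mask_W d n r c * ?z c)
        = (\<Sum>c<d0. (if c = r div n then ?z (r div n) else 0) + (if c = d + r mod n then ?z (d + r mod n) else 0))"
      using 1 b by (intro sum.cong) (auto simp: mask_W_def)
    also have "\<dots> = ?z (r div n) + ?z (d + r mod n)"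
      using b d0 by (simp add: sum.distrib)
    also have "\<dots> = X (r div n) j + (if r mod n = j then 1 else 0)"
      using b by (simp add: emb_layer_value)
    finally have "(\<Sum>c<d0. mask_W d n r c * ?z c) = X (r div n) j + (if r mod n = j then 1 else 0)" .
    moreover have "0 \<le> X (r div n) j" "X (r div n) j \<le> 1"
      using X b j by (auto simp: cube_def)
    ultimately show ?thesis
      using 1 by (auto simp: relu_def aff_def mask_c_def masked_def coord_def)
  next
    case 2
    have "(\<Sum>c<d0. mask_W d n r c * ?z c) = (\<Sum>c<d0. if c = d + (r - d * n) then ?z (d + (r - d * n)) else 0)"
      using 2 by (intro sum.cong) (auto simp: mask_W_def)
    also have "\<dots> = ?z (d + (r - d * n))"
      using 2 d0 by simp
    also have "\<dots> = (if r = d * n + j then 1 else 0)"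
      using 2 by (auto simp: emb_layer_value)
    finally show ?thesis
      using 2 by (simp add: relu_def aff_def mask_c_def masked_def)
  next
    case 3
    then show ?thesis using j by (simp add: relu_def aff_def mask_c_def masked_def mask_W_def)
  qed
qed

lemma masked_nonneg: "X \<in> cube d n \<Longrightarrow> 0 \<le> masked d n X r j"
  using coord_in_unit[of X d n r] by (auto simp: masked_def)

lemma mask_block_run:
  assumes "X \<in> cube d n" "j < n" "d + n \<le> d0" "r < D"
  shows "fnn_run d0 D (mask_block d n D) (\<lambda>k. emb_layer d (emb_W d) (emb_B d) X k j) r = masked d n X r j"
proof -
  have eq: "relu (aff d0 (mask_W d n) (mask_c d n) (\<lambda>k. emb_layer d (emb_W d) (emb_B d) X k j)) = (\<lambda>r. masked d n X r j)"
    using mask_layer[OF assms(1-3)] by blast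
  have "fnn_run d0 D (mask_block d n D) (\<lambda>k. emb_layer d (emb_W d) (emb_B d) X k j) r
      = fnn_run D D (id_block D) (\<lambda>r. masked d n X r j) r"
    using eq by (simp add: mask_block_def id_block_def numeral_3_eq_3)
  also have "\<dots> = masked d n X r j"
    using assms masked_nonneg by (intro id_block_run) auto
  finally show ?thesis .
qed

section \<open>Attention as an exact sum of columns\<close>

definition zero_head :: head where
  "zero_head = (\<lambda>_ _. 0, \<lambda>_ _. 0, \<lambda>_ _. 0, \<lambda>_ _. 0)"

text \<open>Vanishing query and key matrices make the softmax uniform, so this head adds up the value vectors of
  all \<open>n\<close> columns exactly.\<close>
definition sum_head :: "nat \<Rightarrow> nat \<Rightarrow> head" where
  "sum_head d n = (\<lambda>p r. if r < d * n \<and> p = d * n + n + r then 1 else 0,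
     \<lambda>r k. if r = k \<and> r < d * n then real n else 0, \<lambda>_ _. 0, \<lambda>_ _. 0)"

lemma zero_head_out: "head_out D S n zero_head X p j = 0"
  by (simp add: head_out_def zero_head_def)

lemma sum_head_out:
  assumes "d * n \<le> S" "d * n \<le> D" "1 \<le> n"
  shows "head_out D S n (sum_head d n) X p j
    = (if d * n + n \<le> p \<and> p < d * n + n + d * n then \<Sum>i<n. X (p - (d * n + n)) i else 0)"
proof -
  \<comment> \<open>All scores are 0, so every column has weight \<open>1 / n\<close>; the factor
    \<open>real n\<close> in the value matrix cancels it.\<close>
  have soft: "softmax_col n (att_score D S (\<lambda>_ _. 0) (\<lambda>_ _. 0) X) i j = 1 / real n" for i
    by (simp add: softmax_col_def att_score_def)
  have val: "(\<Sum>k<D. (if r = k \<and> r < d * n then real n else 0) * X k i) = (if r < d * n then real n * X r i else 0)" for r i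
  proof -
    have "(\<Sum>k<D. (if r = k \<and> r < d * n then real n else 0) * X k i)
        = (\<Sum>k<D. if k = r then (if r < d * n then real n * X r i else 0) else 0)"
      by (rule sum.cong) auto
    also have "\<dots> = (if r < d * n then real n * X r i else 0)"
      using assms(2) by auto
    finally show ?thesis .
  qed
  have out: "(\<Sum>r<S. (if r < d * n \<and> p = d * n + n + r then 1 else 0) * (if r < d * n then real n * X r i else 0))
      = (if d * n + n \<le> p \<and> p < d * n + n + d * n then real n * X (p - (d * n + n)) i else 0)" for i
  proof -
    have "(\<Sum>r<S. (if r < d * n \<and> p = d * n + n + r then 1 else 0) * (if r < d * n then real n * X r i else 0))
      = (\<Sum>r<S. if r = p - (d * n + n) then
          (if d * n + n \<le> p \<and> p < d * n + n + d * n then real n * X (p - (d * n + n)) i else 0) else 0)"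
      by (rule sum.cong) auto
    also have "\<dots> = (if d * n + n \<le> p \<and> p < d * n + n + d * n then real n * X (p - (d * n + n)) i else 0)"
      using assms(1) by auto
    finally show ?thesis .
  qed
  show ?thesis
    unfolding head_out_def sum_head_def prod.case soft val out
    using assms(3) by (cases "d * n + n \<le> p \<and> p < d * n + n + d * n") auto
qed

lemma sum_masked:
  assumes "k < d * n"
  shows "(\<Sum>i<n. masked d n X k i) = coord n X k"
proof -
  have "(\<Sum>i<n. masked d n X k i) = (\<Sum>i<n. if i = k mod n then coord n X k else 0)"
    using assms by (intro sum.cong) (auto simp: masked_def)
  then show ?thesis using coord_bounds[OF assms] by simp
qed

definition first_attention :: "nat \<Rightarrow> nat \<Rightarrow> nat \<Rightarrow> head list" where
  "first_attention d n h = sum_head d n # replicate (h - 1) zero_head"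

lemma sa_zero: "sa_layer D S n (replicate h zero_head) X = X"
  by (intro ext) (simp add: sa_layer_def zero_head_out sum_list_replicate)

text \<open>The target rows are 0 before the layer, so the skip connection adds nothing to the
  copied matrix; it carries all other rows through unchanged.\<close>

lemma first_attention_value:
  assumes "d * n \<le> S" "d * n \<le> D" "1 \<le> n" "\<And>r i. r < D \<Longrightarrow> i < n \<Longrightarrow> Y r i = masked d n X r i" "p < D" "j < n"
  shows "sa_layer D S n (first_attention d n h) Y p j
    = (if d * n + n \<le> p \<and> p < d * n + n + d * n then coord n X (p - (d * n + n)) else masked d n X p j)"
proof -
  have "(\<Sum>i<n. Y (p - (d * n + n)) i) = coord n X (p - (d * n + n))" if "d * n + n \<le> p" "p < d * n + n + d * n"
  proof -
    have "(\<Sum>i<n. Y (p - (d * n + n)) i) = (\<Sum>i<n. masked d n X (p - (d * n + n)) i)"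
      using that assms(2,4,5) by (intro sum.cong) auto
    then show ?thesis using that by (simp add: sum_masked)
  qed
  moreover have "masked d n X p j = 0" if "d * n + n \<le> p"
    using that assms(6) by (simp add: masked_def)
  ultimately show ?thesis
    using assms by (simp add: sa_layer_def first_attention_def sum_head_out zero_head_out sum_list_replicate)
qed

text \<open>Nonnegativity is recorded because the identity blocks preserve nothing else.\<close>

definition good_state :: "nat \<Rightarrow> nat \<Rightarrow> nat \<Rightarrow> mat \<Rightarrow> mat \<Rightarrow> bool" where
  "good_state d n D X Y \<longleftrightarrow> (\<forall>j<n. (X, j, \<lambda>p. Y p j) \<in> encoded d n \<and> (\<forall>p<D. 0 \<le> Y p j))"

lemma good_state_cong:
  assumes "good_state d n D X Y" "2 * (d * n) + n \<le> D" "\<And>p j. p < D \<Longrightarrow> j < n \<Longrightarrow> Y' p j = Y p j"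
  shows "good_state d n D X Y'"
  using assms unfolding good_state_def encoded_def by auto

lemma good_state_first_attention:
  assumes "X \<in> cube d n" "2 * (d * n) + n \<le> D" "d * n \<le> S" "1 \<le> n"
    and Y: "\<And>r i. r < D \<Longrightarrow> i < n \<Longrightarrow> Y r i = masked d n X r i"
  shows "good_state d n D X (sa_layer D S n (first_attention d n h) Y)"
proof -
  let ?Z = "sa_layer D S n (first_attention d n h) Y"
  have Z: "?Z p j = (if d * n + n \<le> p \<and> p < d * n + n + d * n then coord n X (p - (d * n + n)) else masked d n X p j)"
    if "p < D" "j < n" for p j
    by (rule first_attention_value) (use assms that in auto)
  have "0 \<le> ?Z p j" if "p < D" "j < n" for p j
    using Z[OF that] masked_nonneg[OF assms(1)] coord_in_unit[OF assms(1), of "p - (d * n + n)"] by auto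
  moreover have "(X, j, \<lambda>p. ?Z p j) \<in> encoded d n" if "j < n" for j
  proof -
    have "?Z (d * n + i) j = (if i = j then 1 else 0)" if "i < n" for i
      using Z[of "d * n + i" j] that \<open>j < n\<close> assms(2) by (auto simp: masked_def)
    moreover have "?Z (d * n + n + k) j = coord n X k" if "k < d * n" for k
      using Z[of "d * n + n + k" j] that \<open>j < n\<close> assms(2) by auto
    ultimately show ?thesis using assms(1) that by (auto simp: encoded_def)
  qed
  ultimately show ?thesis unfolding good_state_def by blast
qed

section \<open>Assembly of the Transformer and bookkeeping\<close>

definition assemble ::
  "nat \<Rightarrow> nat \<Rightarrow> nat \<Rightarrow> nat \<Rightarrow> nat \<Rightarrow> nat \<Rightarrow> nat \<Rightarrow> (mat \<times> vec) list \<Rightarrow> nat \<Rightarrow> transformer" where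
  "assemble d n d0 D h1 h w1 ls w =
    \<lparr>tf_dims = [d, d0] @ replicate n D @ [d], tf_WE = emb_W d, tf_BE = emb_B d,
     tf_ff = mask_block d n D # replicate (n - 1) (id_block D) @ [ls],
     tf_ffw = D # replicate (n - 1) w1 @ [w],
     tf_sa = first_attention d n h1 # replicate (n - 1) (replicate h zero_head),
     tf_hs = max (d * n) 3 # replicate (n - 1) 3\<rparr>"

lemma unit_layers_params:
  assumes "y \<in> fnn_params a b v xs" "\<And>A c i j. (A, c) \<in> set xs \<Longrightarrow> \<bar>A i j\<bar> \<le> 1 \<and> \<bar>c i\<bar> \<le> (1::real)"
  shows "\<bar>y\<bar> \<le> 1"
proof -
  obtain l where l: "l < length xs" and y: "(\<exists>i j. y = fst (xs ! l) i j) \<or> (\<exists>i. y = snd (xs ! l) i)"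
    using assms(1) by (auto simp: fnn_params_def mat_entries_def vec_entries_def)
  have "(fst (xs ! l), snd (xs ! l)) \<in> set xs" using l by simp
  from assms(2)[OF this] y show ?thesis by auto
qed

context
  fixes d n d0 D h1 h w1 w :: nat and ls :: "(mat \<times> vec) list"
  assumes n: "1 \<le> n"
begin

abbreviation "tf \<equiv> assemble d n d0 D h1 h w1 ls w"

lemma assemble_len: "tf_len tf = n"
  using n by (simp add: tf_len_def assemble_def)

lemma assemble_dims:
  "tf_dims tf ! 0 = d" "tf_dims tf ! Suc 0 = d0" "1 \<le> k \<Longrightarrow> k \<le> n \<Longrightarrow> tf_dims tf ! Suc k = D"
  "tf_dims tf ! Suc (Suc n) = d"
  by (auto simp: assemble_def nth_append nth_Cons split: nat.splits)

lemma assemble_ff: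
  "tf_ff tf ! 0 = mask_block d n D" "1 \<le> k \<Longrightarrow> k < n \<Longrightarrow> tf_ff tf ! k = id_block D" "tf_ff tf ! n = ls"
  "tf_ffw tf ! 0 = D" "1 \<le> k \<Longrightarrow> k < n \<Longrightarrow> tf_ffw tf ! k = w1" "tf_ffw tf ! n = w"
  using n by (auto simp: assemble_def nth_append nth_Cons split: nat.splits)

lemma assemble_sa:
  "tf_sa tf ! 0 = first_attention d n h1" "1 \<le> k \<Longrightarrow> k < n \<Longrightarrow> tf_sa tf ! k = replicate h zero_head"
  "tf_hs tf ! 0 = max (d * n) 3" "1 \<le> k \<Longrightarrow> k < n \<Longrightarrow> tf_hs tf ! k = 3"
  by (auto simp: assemble_def nth_Cons split: nat.splits)

lemma assemble_wf: "ls \<noteq> [] \<Longrightarrow> tf_wf tf"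
proof -
  assume ls: "ls \<noteq> []"
  have "tf_ff tf ! k \<noteq> []" if "k \<le> n" for k
  proof -
    consider "k = 0" | "1 \<le> k" "k < n" | "k = n" using \<open>k \<le> n\<close> by linarith
    then show ?thesis
      by cases (use ls n in \<open>auto simp: assemble_ff mask_block_def id_block_def\<close>)
  qed
  moreover have "length (tf_dims tf) = n + 3" "length (tf_ff tf) = n + 1" "length (tf_ffw tf) = n + 1" "length (tf_hs tf) = n"
    using n by (simp_all add: assemble_def)
  ultimately show ?thesis by (simp add: tf_wf_def assemble_len)
qed

text \<open>The invariant describes the state right behind an attention layer: the encoding does not
  exist before the first one, and for \<open>n = 1\<close> the last block follows it at
  once.\<close>

lemma assemble_eval:
  assumes X: "X \<in> cube d n" and D: "2 * (d * n) + n \<le> D" and d0: "d + n \<le> d0" and w1: "D \<le> w1" and j: "j < n"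
  shows "\<exists>z. (X, j, z) \<in> encoded d n \<and> tf_eval n tf X p j = fnn_run D w ls z p"
proof -
  define sa where "sa = (\<lambda>k. sa_layer (tf_dims tf ! (k + 1)) (tf_hs tf ! (k - 1)) n (tf_sa tf ! (k - 1)))"
  define F where "F = (\<lambda>k Y. ff_block (tf_dims tf ! (k + 1)) (tf_ffw tf ! k) (tf_ff tf ! k) (sa k Y))"
  define Y0 where "Y0 = ff_block (tf_dims tf ! 1) (tf_ffw tf ! 0) (tf_ff tf ! 0)
             (emb_layer (tf_dims tf ! 0) (tf_WE tf) (tf_BE tf) X)"
  have WB: "tf_WE tf = emb_W d" "tf_BE tf = emb_B d" by (simp_all add: assemble_def)
  have good: "good_state d n D X (sa (Suc k) (fold F [1..<Suc k] Y0))" if "k < n" for k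
    using that
  proof (induction k)
    case 0
    have "Y0 r i = masked d n X r i" if "r < D" "i < n" for r i
      unfolding Y0_def ff_block_def
      using mask_block_run[OF X that(2) d0 that(1)] by (simp add: assemble_ff assemble_dims WB)
    then have "good_state d n D X (sa_layer D (max (d * n) 3) n (first_attention d n h1) Y0)"
      by (intro good_state_first_attention X D n) auto
    moreover have "tf_dims tf ! Suc (Suc 0) = D" using assemble_dims(3)[of 1] n by simp
    ultimately show ?case by (simp add: sa_def assemble_sa)
  next
    case (Suc k)
    define Z where "Z = sa (Suc k) (fold F [1..<Suc k] Y0)"
    have Z: "good_state d n D X Z" using Suc by (simp add: Z_def)
    have "fold F [1..<Suc (Suc k)] Y0 = F (Suc k) (fold F [1..<Suc k] Y0)" by simp
    also have "\<dots> = ff_block D w1 (id_block D) Z"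
    proof -
      have "F (Suc k) Y = ff_block D w1 (id_block D) (sa (Suc k) Y)" for Y
        using Suc.prems by (simp add: F_def assemble_ff assemble_dims)
      then show ?thesis by (simp add: Z_def)
    qed
    finally have step: "fold F [1..<Suc (Suc k)] Y0 = ff_block D w1 (id_block D) Z" .
    have "ff_block D w1 (id_block D) Z p i = Z p i" if "p < D" "i < n" for p i
      unfolding ff_block_def using Z that by (intro id_block_run w1) (auto simp: good_state_def)
    then have "good_state d n D X (ff_block D w1 (id_block D) Z)"
      using good_state_cong[OF Z D] by blast
    moreover have "sa (Suc (Suc k)) Y = Y" for Y
      using Suc.prems by (simp add: sa_def assemble_sa sa_zero)
    ultimately show ?case using step by simp
  qed
  obtain n' where n': "n = Suc n'" using n by (cases n) auto
  define Z where "Z = sa n (fold F [1..<n] Y0)"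
  have Z: "good_state d n D X Z" using good[of n'] by (simp add: Z_def n')
  have "tf_eval n tf X = fold F [1..<n + 1] Y0"
    by (simp add: tf_eval_def assemble_len F_def sa_def Y0_def)
  also have "\<dots> = F n (fold F [1..<n] Y0)" using n by simp
  also have "\<dots> = ff_block D w ls Z"
  proof -
    have "F n Y = ff_block D w ls (sa n Y)" for Y
      using n by (simp add: F_def assemble_ff assemble_dims)
    then show ?thesis by (simp add: Z_def)
  qed
  finally show ?thesis
    using Z j by (intro exI[of _ "\<lambda>p. Z p j"]) (simp add: ff_block_def good_state_def)
qed

text \<open>Isolates the last block, the only one that will vary with
  \<open>\<epsilon>\<close>.\<close>

lemma assemble_M_FF:
  "M_FF tf = (\<Sum>k<n. fnn_nnz (tf_dims tf ! (k+1)) (tf_dims tf ! (k+2)) (tf_ffw tf ! k) (tf_ff tf ! k)) + fnn_nnz D d w ls"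
proof -
  have "{..n} = insert n {..<n}" by auto
  then show ?thesis
    using n by (simp add: M_FF_def assemble_len assemble_ff assemble_dims)
qed

lemma assemble_FF_params:
  assumes "y \<in> FF_params tf"
  shows "\<bar>y\<bar> \<le> 1 \<or> y \<in> fnn_params D d w ls"
proof -
  obtain k where k: "k \<le> n" "y \<in> fnn_params (tf_dims tf ! (k+1)) (tf_dims tf ! (k+2)) (tf_ffw tf ! k) (tf_ff tf ! k)"
    using assms by (auto simp: FF_params_def assemble_len)
  have idm: "\<bar>id_mat D i j\<bar> \<le> 1" for i j by (simp add: id_mat_def)
  consider "k = 0" | "1 \<le> k" "k < n" | "k = n" using k(1) by linarith
  then show ?thesis
  proof cases
    case 1
    have "\<bar>y\<bar> \<le> 1"
      by (rule unit_layers_params[OF k(2)])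
        (use 1 idm in \<open>auto simp: assemble_ff mask_block_def id_block_def mask_W_def mask_c_def\<close>)
    then show ?thesis ..
  next
    case 2
    have "\<bar>y\<bar> \<le> 1"
      by (rule unit_layers_params[OF k(2)]) (use 2 idm in \<open>auto simp: assemble_ff id_block_def\<close>)
    then show ?thesis ..
  next
    case 3
    then show ?thesis using k(2) n by (simp add: assemble_ff assemble_dims)
  qed
qed

lemma assemble_SA_params:
  assumes "y \<in> SA_params tf"
  shows "\<bar>y\<bar> \<le> real n"
proof -
  obtain k hd where k: "1 \<le> k" "k \<le> n" "hd \<in> set (tf_sa tf ! (k - 1))"
    "y \<in> head_params (tf_dims tf ! (k+1)) (tf_hs tf ! (k-1)) hd"
    using assms by (auto simp: SA_params_def assemble_len)
  have "hd = zero_head \<or> hd = sum_head d n"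
    using k(1-3) assemble_sa(1) assemble_sa(2)[of "k - 1"]
    by (cases "k = 1") (auto simp: first_attention_def)
  then show ?thesis
    using k(4) n by (auto simp: head_params_def zero_head_def sum_head_def mat_entries_def)
qed

lemma assemble_EB_params:
  assumes "y \<in> EB_params n tf"
  shows "\<bar>y\<bar> \<le> 1"
  using assms by (auto simp: EB_params_def mat_entries_def assemble_def emb_W_def emb_B_def)

end

section \<open>Prescribed sizes and constants independent of \<epsilon>\<close>

theorem theorem2:
  fixes d n s :: nat and lam :: real and f :: "mat \<Rightarrow> mat"
  assumes "d \<ge> 1" and "n \<ge> 1" and "0 < lam" and "lam \<le> 1"
    and "\<forall>p<d. \<forall>q<n. holder d n s lam (\<lambda>X. f X p q)"
  shows "\<exists>C::real. \<forall>\<epsilon>::real. 0 < \<epsilon> \<and> \<epsilon> < 1 \<longrightarrow>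
    (let \<gamma> = real s + lam; B = (s + d*n - 1) choose (d*n - 1) in
     \<exists>T. tf_wf T \<and> tf_len T = n
       \<and> tf_dims T = [d, d + n + 1 + 3^n] @ replicate n ((2*d*n + 5*d) * 3^(d*n) * B) @ [d]
       \<and> L_ff T 0 = 4 \<and> real (W_ff T 0) \<le> C * \<epsilon> powr (-(1/\<gamma>))
       \<and> H_sa T 1 = (3*d + 1) * 3^(d*n) * B \<and> S_sa T 1 = max (d*n) 3
       \<and> (\<forall>l\<in>{1..n-1}. L_ff T l = 3 \<and> W_ff T l = d * 3^(d*n) * B * (4*n + 11))
       \<and> (\<forall>l\<in>{2..n}. H_sa T l = d * 3^(d*n + 1) * B \<and> S_sa T l = 3)
       \<and> real (L_ff T n) \<le> C * max 1 (ln (1/\<epsilon>))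
       \<and> real (W_ff T n) \<le> C * \<epsilon> powr (-(real (d*n)/\<gamma>))
       \<and> (\<forall>X\<in>cube d n. \<forall>p<d. \<forall>q<n. \<bar>tf_eval n T X p q - f X p q\<bar> \<le> \<epsilon>)
       \<and> (\<forall>w\<in>EB_params n T. \<bar>w\<bar> \<le> C)
       \<and> (\<forall>w\<in>FF_params T. \<bar>w\<bar> \<le> C * \<epsilon> powr (-(max ((6*real (d*n) + 2)/\<gamma>) (1/lam))))
       \<and> (\<forall>w\<in>SA_params T. \<bar>w\<bar> \<le> C * max 1 (ln (1/\<epsilon>)))
       \<and> real (M_EB n T) \<le> C
       \<and> real (M_FF T) \<le> C * \<epsilon> powr (-(real (d*n)/\<gamma>))
       \<and> real (M_SA T) \<le> C)"
proof -
  define \<gamma> where "\<gamma> = real s + lam"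
  define B where "B = (s + d*n - 1) choose (d*n - 1)"
  define d0 where "d0 = d + n + 1 + 3^n"
  define D where "D = (2*d*n + 5*d) * 3^(d*n) * B"
  define h1 where "h1 = (3*d + 1) * 3^(d*n) * B"
  define h where "h = d * 3^(d*n + 1) * B"
  define w1 where "w1 = d * 3^(d*n) * B * (4*n + 11)"
  define T where "T = assemble d n d0 D h1 h w1"
  have dn: "1 \<le> d * n" using assms(1,2) by simp
  have \<gamma>: "0 < \<gamma>" using assms(3) by (simp add: \<gamma>_def)
  have B1: "1 \<le> B" unfolding B_def by (simp add: Suc_le_eq)
  have h1_pos: "1 \<le> h1" using B1 by (simp add: h1_def Suc_le_eq)
  have D_ge: "2 * (d * n) + n \<le> D"
  proof -
    have "(3::nat) ^ 1 \<le> 3 ^ (d * n)" using dn by (intro power_increasing) auto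
    then have "(2*d*n + 5*d) * 3 * 1 \<le> D" unfolding D_def using B1 by (intro mult_le_mono) auto
    moreover have "n \<le> d * n" using assms(1) by simp
    moreover have "(2*d*n + 5*d) * 3 * 1 = 6 * (d * n) + 15 * d" by simp
    ultimately show ?thesis by linarith
  qed
  \<comment> \<open>Both numbers contain \<open>d * 3^(d*n) * B\<close>; the remaining factors are
    \<open>2*n + 5\<close> and \<open>4*n + 11\<close>. Identity blocks on \<open>D\<close> rows
    thus fit the prescribed width.\<close>
  have Dw1: "D \<le> w1"
  proof -
    have "D = d * 3^(d*n) * B * (2*n + 5)" by (simp add: D_def algebra_simps)
    also have "\<dots> \<le> w1" unfolding w1_def by (intro mult_le_mono2) simp
    finally show ?thesis .
  qed
  obtain C0 where C0: "1 \<le> C0" and net: "\<And>\<epsilon>. 0 < \<epsilon> \<Longrightarrow> \<epsilon> < 1 \<Longrightarrow> \<exists>ls w. ls \<noteq> []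
     \<and> real (length ls) \<le> C0 * max 1 (ln (1 / \<epsilon>))
     \<and> real w \<le> C0 * \<epsilon> powr (- (real (d * n) / \<gamma>))
     \<and> (\<forall>y\<in>fnn_params D d w ls. \<bar>y\<bar> \<le> C0 * \<epsilon> powr (- (real (d * n) / \<gamma>)))
     \<and> real (fnn_nnz D d w ls) \<le> C0 * \<epsilon> powr (- (real (d * n) / \<gamma>))
     \<and> (\<forall>X q z. (X, q, z) \<in> encoded d n \<longrightarrow> (\<forall>p<d. \<bar>fnn_run D w ls z p - f X p q\<bar> \<le> \<epsilon>))"
    using network_for_accuracy[OF assms(1-3) D_ge assms(5)] unfolding \<gamma>_def by blast
  \<comment> \<open>These three counts do not involve the last block, so they are evaluated at the
    dummy \<open>[]\<close> of width 0 and are constants in \<open>\<epsilon>\<close>.\<close>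
  define mEB where "mEB = M_EB n (T [] 0)"
  define mSA where "mSA = M_SA (T [] 0)"
  define mFF where "mFF = (\<Sum>k<n. fnn_nnz (tf_dims (T [] 0) ! (k+1)) (tf_dims (T [] 0) ! (k+2))
    (tf_ffw (T [] 0) ! k) (tf_ff (T [] 0) ! k))"
  define C where "C = C0 + real D + real n + real mEB + real mSA + real mFF"
  have C_ge: "C0 \<le> C" "real D \<le> C" "real n \<le> C" "real mEB \<le> C" "real mSA \<le> C" "1 \<le> C" "real mFF + C0 \<le> C"
    using C0 by (simp_all add: C_def)
  show ?thesis
    unfolding Let_def \<gamma>_def[symmetric] B_def[symmetric] d0_def[symmetric] D_def[symmetric]
      h1_def[symmetric] h_def[symmetric] w1_def[symmetric]
  proof (intro exI[of _ C] allI impI, elim conjE)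
    fix \<epsilon> :: real assume \<epsilon>: "0 < \<epsilon>" "\<epsilon> < 1"
    define E where "E = \<epsilon> powr (- (real (d * n) / \<gamma>))"
    define L where "L = max 1 (ln (1 / \<epsilon>))"
    define E' where "E' = \<epsilon> powr (-(max ((6*real (d*n) + 2)/\<gamma>) (1/lam)))"
    have ge1: "1 \<le> \<epsilon> powr (- t)" if "0 \<le> t" for t
      using powr_mono'[of "- t" 0 \<epsilon>] that \<epsilon> by simp
    have E1: "1 \<le> E" unfolding E_def using \<gamma> by (intro ge1) simp
    have EE': "E \<le> E'"
      unfolding E_def E'_def
    proof (rule powr_mono')
      have "real (d * n) / \<gamma> \<le> (6*real (d*n) + 2)/\<gamma>" using \<gamma> by (intro divide_right_mono) auto
      then show "- max ((6*real (d*n) + 2)/\<gamma>) (1/lam) \<le> - (real (d * n) / \<gamma>)" by linarith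
    qed (use \<epsilon> in auto)
    have L1: "1 \<le> L" by (simp add: L_def)
    \<comment> \<open>Constants meet every bound that grows as \<open>\<epsilon>\<close> decreases,
      since \<open>L\<close>, \<open>E\<close> and the other powers are at least 1.\<close>
    have scale: "x \<le> C * y" if "x \<le> C" "1 \<le> y" for x y
      using that C_ge(6) mult_left_mono[of 1 y C] by linarith
    have scale': "x \<le> C * y" if "x \<le> C0 * y" "1 \<le> y" for x y
      using that C_ge(1) mult_right_mono[of C0 C y] by linarith
    obtain ls w where ls: "ls \<noteq> []" "real (length ls) \<le> C0 * L" "real w \<le> C0 * E"
      "\<forall>y\<in>fnn_params D d w ls. \<bar>y\<bar> \<le> C0 * E" "real (fnn_nnz D d w ls) \<le> C0 * E"
      "\<And>X q z p. (X, q, z) \<in> encoded d n \<Longrightarrow> p < d \<Longrightarrow> \<bar>fnn_run D w ls z p - f X p q\<bar> \<le> \<epsilon>"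
      using net[OF \<epsilon>] unfolding E_def L_def by blast
    note a = assemble_len[OF assms(2)] assemble_ff[OF assms(2)] assemble_sa[OF assms(2)]
    show "\<exists>T. tf_wf T \<and> tf_len T = n
       \<and> tf_dims T = [d, d0] @ replicate n D @ [d]
       \<and> L_ff T 0 = 4 \<and> real (W_ff T 0) \<le> C * \<epsilon> powr (-(1/\<gamma>))
       \<and> H_sa T 1 = h1 \<and> S_sa T 1 = max (d*n) 3
       \<and> (\<forall>l\<in>{1..n-1}. L_ff T l = 3 \<and> W_ff T l = w1)
       \<and> (\<forall>l\<in>{2..n}. H_sa T l = h \<and> S_sa T l = 3)
       \<and> real (L_ff T n) \<le> C * max 1 (ln (1/\<epsilon>))
       \<and> real (W_ff T n) \<le> C * \<epsilon> powr (-(real (d*n)/\<gamma>))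
       \<and> (\<forall>X\<in>cube d n. \<forall>p<d. \<forall>q<n. \<bar>tf_eval n T X p q - f X p q\<bar> \<le> \<epsilon>)
       \<and> (\<forall>w\<in>EB_params n T. \<bar>w\<bar> \<le> C)
       \<and> (\<forall>w\<in>FF_params T. \<bar>w\<bar> \<le> C * \<epsilon> powr (-(max ((6*real (d*n) + 2)/\<gamma>) (1/lam))))
       \<and> (\<forall>w\<in>SA_params T. \<bar>w\<bar> \<le> C * max 1 (ln (1/\<epsilon>)))
       \<and> real (M_EB n T) \<le> C
       \<and> real (M_FF T) \<le> C * \<epsilon> powr (-(real (d*n)/\<gamma>))
       \<and> real (M_SA T) \<le> C"
      unfolding E_def[symmetric] L_def[symmetric] E'_def[symmetric]
    proof (intro exI[of _ "T ls w"] conjI ballI allI impI)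
      show "tf_wf (T ls w)" unfolding T_def by (rule assemble_wf[OF assms(2) ls(1)])
      show "tf_len (T ls w) = n" by (simp add: T_def a)
      show "tf_dims (T ls w) = [d, d0] @ replicate n D @ [d]" by (simp add: T_def assemble_def)
      show "L_ff (T ls w) 0 = 4" by (simp add: L_ff_def T_def a mask_block_def id_block_def)
      have "real D \<le> C * \<epsilon> powr (-(1/\<gamma>))" by (rule scale[OF C_ge(2) ge1]) (use \<gamma> in simp)
      then show "real (W_ff (T ls w) 0) \<le> C * \<epsilon> powr (-(1/\<gamma>))" by (simp add: W_ff_def T_def a)
      show "H_sa (T ls w) 1 = h1" using h1_pos by (simp add: H_sa_def T_def a first_attention_def)
      show "S_sa (T ls w) 1 = max (d*n) 3" by (simp add: S_sa_def T_def a)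
      show "real (L_ff (T ls w) n) \<le> C * L" using scale'[OF ls(2) L1] by (simp add: L_ff_def T_def a)
      show "real (W_ff (T ls w) n) \<le> C * E" using scale'[OF ls(3) E1] by (simp add: W_ff_def T_def a)
      show "real (M_EB n (T ls w)) \<le> C"
        using C_ge(4) by (simp add: mEB_def M_EB_def T_def assemble_def)
      show "real (M_SA (T ls w)) \<le> C"
        using C_ge(5) by (simp add: mSA_def M_SA_def T_def assemble_def tf_len_def)
      have "M_FF (T ls w) = mFF + fnn_nnz D d w ls"
      proof -
        have "tf_ff (T ls w) ! k = tf_ff (T [] 0) ! k" "tf_ffw (T ls w) ! k = tf_ffw (T [] 0) ! k" if "k < n" for k
          using that unfolding T_def by (cases k; simp add: a)+
        moreover have "tf_dims (T ls w) = tf_dims (T [] 0)" by (simp add: T_def assemble_def)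
        ultimately show ?thesis
          using assemble_M_FF[OF assms(2), of d d0 D h1 h w1 ls w] by (simp add: mFF_def T_def[symmetric])
      qed
      then have "real (M_FF (T ls w)) = real mFF + real (fnn_nnz D d w ls)" by simp
      also have "\<dots> \<le> real mFF * E + C0 * E"
        using ls(5) E1 by (intro add_mono) (auto simp: mult_le_cancel_left1)
      also have "\<dots> \<le> C * E"
        using C_ge(7) E1 by (simp add: distrib_right[symmetric] mult_right_mono)
      finally show "real (M_FF (T ls w)) \<le> C * E" .
    next
      fix l assume l: "l \<in> {1..n-1}"
      show "L_ff (T ls w) l = 3" "W_ff (T ls w) l = w1"
        using l by (auto simp: L_ff_def W_ff_def T_def a id_block_def)
    next
      fix l assume l: "l \<in> {2..n}"
      show "H_sa (T ls w) l = h" "S_sa (T ls w) l = 3"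
        using l by (auto simp: H_sa_def S_sa_def T_def a)
    next
      fix X p q assume X: "X \<in> cube d n" and p: "p < d" and q: "q < n"
      have "d + n \<le> d0" by (simp add: d0_def)
      then show "\<bar>tf_eval n (T ls w) X p q - f X p q\<bar> \<le> \<epsilon>"
        using assemble_eval[OF assms(2) X D_ge _ Dw1 q, of d0 h1 h ls w p] ls(6)[OF _ p] unfolding T_def by metis
    next
      fix y assume "y \<in> EB_params n (T ls w)"
      then show "\<bar>y\<bar> \<le> C" using assemble_EB_params[OF assms(2)] C_ge(6) unfolding T_def by force
    next
      fix y assume "y \<in> FF_params (T ls w)"
      then have "\<bar>y\<bar> \<le> 1 \<or> y \<in> fnn_params D d w ls" unfolding T_def by (rule assemble_FF_params[OF assms(2)])
      then have "\<bar>y\<bar> \<le> C * E"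
        using ls(4) scale[of "\<bar>y\<bar>" E] scale'[of "\<bar>y\<bar>" E] C_ge(6) E1 by fastforce
      also have "\<dots> \<le> C * E'" using EE' C_ge(6) by (intro mult_left_mono) auto
      finally show "\<bar>y\<bar> \<le> C * E'" .
    next
      fix y assume "y \<in> SA_params (T ls w)"
      then have "\<bar>y\<bar> \<le> real n" unfolding T_def by (rule assemble_SA_params[OF assms(2)])
      then show "\<bar>y\<bar> \<le> C * L" using scale[of "\<bar>y\<bar>" L] C_ge(3) L1 by linarith
    qed
  qed
qed

end
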